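(* Let $u^1,\dots,u^n:\mathbb{R}^m\to\mathbb{R}$ be smooth functions such that their graph $M=\{(x,u^1(x),\dots,u^n(x)) : x\in\mathbb{R}^m\}$ is a spacelike translating soliton in $\mathbb{R}^{m+n}_n$. Let $g_{ij}=\delta_{ij}-\sum_{\alpha=1}^n \frac{\partial u^\alpha}{\partial x_i}\frac{\partial u^\alpha}{\partial x_j}$ be the induced metric. Suppose there exists a number $\epsilon>0$ such that $$\det(g_{ij}(x))>\frac{\epsilon}{|x|}\quad\text{as } |x|\to\infty,$$ i.e. there is $R_0>0$ such that this inequality holds for all $|x|>R_0$. Then $M$ is an affine $m$-plane.
   Context: $\mathbb{R}^{m+n}_n$ is the linear space $\mathbb{R}^{m+n}$ with the indefinite metric $\langle\cdot,\cdot\rangle = \sum_{i=1}^m (dx^i)^2-\sum_{\alpha=m+1}^{m+n}(dx^\alpha)^2$. A graph over $\mathbb{R}^m$ is spacelike if the induced metric $(g_{ij})$ is positive definite everywhere. With $\overline\nabla$ the flat connection and $(\cdot)^\perp$ the orthogonal projection (with respect to $\langle\cdot,\cdot\rangle$) onto the normal bundle, the second fundamental form is $B_{YW}=(\overline\nabla_Y W)^\perp$ and the mean curvature vector $H$ is its trace with respect to the induced metric. $M$ is a spacelike translating soliton (translator) if it is spacelike and there is a non-zero constant vector $T\in\mathbb{R}^{m+n}$ such that $H=T^\perp$ on $M$. $|x|$ is the Euclidean norm on $\mathbb{R}^m$. *)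

theory Defs
  imports "HOL-Analysis.Analysis"
begin

section \<open>Smooth functions on Euclidean space\<close>

definition partial :: "'m \<Rightarrow> (real^'m::finite \<Rightarrow> 'b::real_normed_vector) \<Rightarrow> real^'m \<Rightarrow> 'b" where
  "partial i f x = frechet_derivative f (at x) (axis i 1)"

primrec C_k :: "nat \<Rightarrow> (real^'m::finite \<Rightarrow> real) \<Rightarrow> bool" where
  "C_k 0 f \<longleftrightarrow> continuous_on UNIV f"
| "C_k (Suc k) f \<longleftrightarrow> (\<forall>x. f differentiable (at x)) \<and> (\<forall>i. C_k k (partial i f))"

definition smooth :: "(real^'m::finite \<Rightarrow> real) \<Rightarrow> bool" where
  "smooth f \<longleftrightarrow> (\<forall>k. C_k k f)"


section \<open>Graphs in pseudo-Euclidean space\<close>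

text \<open>
  The ambient space is \<^typ>\<open>(real^'m) \<times> (real^'n)\<close>; the first factor is the positive definite
  part and the second factor the negative definite part of the metric.
\<close>

definition pseudo_inner :: "(real^'m::finite) \<times> (real^'n::finite) \<Rightarrow> (real^'m) \<times> (real^'n) \<Rightarrow> real" where
  "pseudo_inner p q = fst p \<bullet> fst q - snd p \<bullet> snd q"

definition graph_map :: "('n::finite \<Rightarrow> real^'m::finite \<Rightarrow> real) \<Rightarrow> real^'m \<Rightarrow> (real^'m) \<times> (real^'n)" where
  "graph_map u x = (x, \<chi> \<alpha>. u \<alpha> x)"

definition graph_of :: "('n::finite \<Rightarrow> real^'m::finite \<Rightarrow> real) \<Rightarrow> ((real^'m) \<times> (real^'n)) set" where
  "graph_of u = range (graph_map u)"

definition induced_metric :: "('n::finite \<Rightarrow> real^'m::finite \<Rightarrow> real) \<Rightarrow> real^'m \<Rightarrow> real^'m^'m" where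
  "induced_metric u x =
     (\<chi> i j. (if i = j then 1 else 0) - (\<Sum>\<alpha>\<in>UNIV. partial i (u \<alpha>) x * partial j (u \<alpha>) x))"

definition spacelike_graph :: "('n::finite \<Rightarrow> real^'m::finite \<Rightarrow> real) \<Rightarrow> bool" where
  "spacelike_graph u \<longleftrightarrow> (\<forall>x v. v \<noteq> 0 \<longrightarrow> v \<bullet> (induced_metric u x *v v) > 0)"


section \<open>Extrinsic geometry\<close>

text \<open>
  Points of the graph are identified with their parameters \<open>x\<close>, so vector fields along the graph
  are functions of \<open>x\<close> with values in the ambient space.
\<close>

definition graph_tangent_space ::
    "('n::finite \<Rightarrow> real^'m::finite \<Rightarrow> real) \<Rightarrow> real^'m \<Rightarrow> ((real^'m) \<times> (real^'n)) set" where
  "graph_tangent_space u x = range (frechet_derivative (graph_map u) (at x))"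

definition graph_normal_space ::
    "('n::finite \<Rightarrow> real^'m::finite \<Rightarrow> real) \<Rightarrow> real^'m \<Rightarrow> ((real^'m) \<times> (real^'n)) set" where
  "graph_normal_space u x = {w. \<forall>t\<in>graph_tangent_space u x. pseudo_inner w t = 0}"

text \<open>
  The description below determines a unique vector where the graph is spacelike; see
  \<open>normal_part_ex1\<close>.
\<close>

definition normal_part ::
    "('n::finite \<Rightarrow> real^'m::finite \<Rightarrow> real) \<Rightarrow> real^'m \<Rightarrow> (real^'m) \<times> (real^'n) \<Rightarrow> (real^'m) \<times> (real^'n)" where
  "normal_part u x w = (THE w'. w' \<in> graph_normal_space u x \<and> w - w' \<in> graph_tangent_space u x)"

text \<open>
  The flat derivative of a field \<open>W\<close> along the graph in the direction of a tangent field \<open>Y\<close>.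
  A tangent vector of a graph has the form \<open>(v, du v)\<close>, hence it is the image of its first
  component under the differential of the parametrisation.
\<close>

definition flat_conn ::
    "(real^'m::finite \<Rightarrow> (real^'m) \<times> (real^'n::finite)) \<Rightarrow> (real^'m \<Rightarrow> (real^'m) \<times> (real^'n))
       \<Rightarrow> real^'m \<Rightarrow> (real^'m) \<times> (real^'n)" where
  "flat_conn Y W x = frechet_derivative W (at x) (fst (Y x))"

definition second_fundamental_form ::
    "('n::finite \<Rightarrow> real^'m::finite \<Rightarrow> real) \<Rightarrow> (real^'m \<Rightarrow> (real^'m) \<times> (real^'n))
       \<Rightarrow> (real^'m \<Rightarrow> (real^'m) \<times> (real^'n)) \<Rightarrow> real^'m \<Rightarrow> (real^'m) \<times> (real^'n)" where
  "second_fundamental_form u Y W x = normal_part u x (flat_conn Y W x)"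

definition mean_curvature ::
    "('n::finite \<Rightarrow> real^'m::finite \<Rightarrow> real) \<Rightarrow> real^'m \<Rightarrow> (real^'m) \<times> (real^'n)" where
  "mean_curvature u x =
     (\<Sum>i\<in>UNIV. \<Sum>j\<in>UNIV. (matrix_inv (induced_metric u x) $ i $ j) *\<^sub>R
        second_fundamental_form u (partial i (graph_map u)) (partial j (graph_map u)) x)"

definition spacelike_translator :: "('n::finite \<Rightarrow> real^'m::finite \<Rightarrow> real) \<Rightarrow> bool" where
  "spacelike_translator u \<longleftrightarrow>
     spacelike_graph u \<and> (\<exists>T. T \<noteq> 0 \<and> (\<forall>x. mean_curvature u x = normal_part u x T))"


section \<open>Consistency of the definitions\<close>

lemma graph_map_has_derivative:
  assumes "\<And>\<alpha>. u \<alpha> differentiable (at x)"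
  shows "(graph_map u has_derivative (\<lambda>v. (v, \<chi> \<alpha>. frechet_derivative (u \<alpha>) (at x) v))) (at x)"
proof -
  have "((\<lambda>x. \<chi> \<alpha>. u \<alpha> x) has_derivative (\<lambda>v. \<chi> \<alpha>. frechet_derivative (u \<alpha>) (at x) v)) (at x)"
  proof (subst has_derivative_componentwise_within, intro ballI)
    fix b :: "real^'a"
    assume "b \<in> Basis"
    then obtain \<alpha> where b: "b = axis \<alpha> 1"
      by (auto simp: Basis_vec_def)
    have "(u \<alpha> has_derivative frechet_derivative (u \<alpha>) (at x)) (at x)"
      using assms frechet_derivative_works by blast
    then show "((\<lambda>x. (\<chi> \<alpha>. u \<alpha> x) \<bullet> b) has_derivative
                (\<lambda>v. (\<chi> \<alpha>. frechet_derivative (u \<alpha>) (at x) v) \<bullet> b)) (at x)"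
      by (simp add: b inner_axis)
  qed
  then show ?thesis
    unfolding graph_map_def by (intro has_derivative_Pair has_derivative_ident)
qed

lemma induced_metric_eq_pullback:
  assumes "\<And>\<alpha>. u \<alpha> differentiable (at x)"
  shows "induced_metric u x $ i $ j =
           pseudo_inner (partial i (graph_map u) x) (partial j (graph_map u) x)"
proof -
  have F: "frechet_derivative (graph_map u) (at x) = (\<lambda>v. (v, \<chi> \<alpha>. frechet_derivative (u \<alpha>) (at x) v))"
    by (rule frechet_derivative_at[symmetric]) (rule graph_map_has_derivative, rule assms)
  show ?thesis
    unfolding induced_metric_def pseudo_inner_def partial_def F
    by (simp add: inner_axis_axis) (simp add: inner_vec_def)
qed

lemma linear_axis_expansion:
  assumes "linear (A :: real^'m::finite \<Rightarrow> 'b::real_vector)"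
  shows "A v = (\<Sum>i\<in>UNIV. (v $ i) *\<^sub>R A (axis i 1))"
proof -
  have "A (\<Sum>i\<in>UNIV. (v $ i) *\<^sub>R axis i 1) = (\<Sum>i\<in>UNIV. (v $ i) *\<^sub>R A (axis i 1))"
    using assms by (simp add: linear_sum linear_scale)
  then show ?thesis
    using basis_expansion[of v] by (simp add: scalar_mult_eq_scaleR)
qed

lemma pseudo_inner_commute: "pseudo_inner p q = pseudo_inner q p"
  by (simp add: pseudo_inner_def inner_commute)

lemma pseudo_inner_axis_expansion:
  assumes "linear A"
  shows "pseudo_inner p (A v) = (\<Sum>i\<in>UNIV. v $ i * pseudo_inner p (A (axis i 1)))"
  unfolding linear_axis_expansion[OF assms, of v]
  by (simp add: pseudo_inner_def fst_sum snd_sum inner_sum_right sum_subtractf right_diff_distrib)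

lemma linear_graph_map_derivative:
  assumes "\<And>\<alpha>. u \<alpha> differentiable (at x)"
  shows "linear (frechet_derivative (graph_map u) (at x))"
  by (rule linear_frechet_derivative, rule differentiableI, rule graph_map_has_derivative, rule assms)

lemma induced_metric_quadratic:
  assumes "\<And>\<alpha>. u \<alpha> differentiable (at x)"
  shows "v \<bullet> (induced_metric u x *v v) =
           pseudo_inner (frechet_derivative (graph_map u) (at x) v)
                        (frechet_derivative (graph_map u) (at x) v)"
proof -
  let ?A = "frechet_derivative (graph_map u) (at x)"
  have "linear ?A"
    using assms by (rule linear_graph_map_derivative)
  note expand = pseudo_inner_axis_expansion[OF this]
  have g: "induced_metric u x $ i $ j = pseudo_inner (?A (axis i 1)) (?A (axis j 1))" for i j
    using induced_metric_eq_pullback[of u x i j] assms by (simp add: partial_def)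
  have "v \<bullet> (induced_metric u x *v v) =
          (\<Sum>i\<in>UNIV. \<Sum>j\<in>UNIV. v $ i * v $ j * pseudo_inner (?A (axis i 1)) (?A (axis j 1)))"
    by (simp add: inner_vec_def matrix_vector_mult_def sum_distrib_left g mult_ac)
  also have "\<dots> = (\<Sum>i\<in>UNIV. v $ i * pseudo_inner (?A (axis i 1)) (?A v))"
    by (simp add: expand[of _ v] sum_distrib_left mult_ac)
  also have "\<dots> = pseudo_inner (?A v) (?A v)"
    unfolding expand[of "?A v" v] by (subst pseudo_inner_commute) (rule refl)
  finally show ?thesis .
qed

lemma normal_part_ex1:
  assumes "\<And>\<alpha>. u \<alpha> differentiable (at x)" and "spacelike_graph u"
  shows "\<exists>!w'. w' \<in> graph_normal_space u x \<and> w - w' \<in> graph_tangent_space u x"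
proof -
  let ?A = "frechet_derivative (graph_map u) (at x)"
  have A: "linear ?A"
    using assms(1) by (rule linear_graph_map_derivative)
  have pos: "pseudo_inner (?A v) (?A v) > 0" if "v \<noteq> 0" for v
    using assms that by (metis induced_metric_quadratic spacelike_graph_def)
  have add: "pseudo_inner (p + q) r = pseudo_inner p r + pseudo_inner q r"
    and diff: "pseudo_inner (p - q) r = pseudo_inner p r - pseudo_inner q r"
    and scale: "pseudo_inner (c *\<^sub>R p) r = c * pseudo_inner p r"
    for p q r :: "(real^'b) \<times> (real^'a)" and c
    by (simp_all add: pseudo_inner_def algebra_simps)
  note expand = pseudo_inner_axis_expansion[OF A]
  define L where "L v = (\<chi> i. pseudo_inner (?A v) (?A (axis i 1)))" for v
  have L: "linear L"
    unfolding L_def using A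
    by (intro linearI) (simp_all add: vec_eq_iff linear_add linear_scale add scale)
  have "v = 0" if "L v = 0" for v
  proof -
    have "pseudo_inner (?A v) (?A (axis i 1)) = 0" for i
      using that by (simp add: L_def vec_eq_iff)
    then have "pseudo_inner (?A v) (?A v) = 0"
      by (simp add: expand[of _ v])
    then show ?thesis
      using pos[of v] by fastforce
  qed
  then have "surj L"
    using L linear_injective_0 linear_injective_imp_surjective by blast
  then obtain v where v: "L v = (\<chi> i. pseudo_inner w (?A (axis i 1)))"
    by (metis surjD)
  have "pseudo_inner (w - ?A v) (?A (axis i 1)) = 0" for i
    using v by (simp add: L_def vec_eq_iff diff)
  then have "pseudo_inner (w - ?A v) (?A t) = 0" for t
    by (simp add: expand[of _ t])
  then have "w - ?A v \<in> graph_normal_space u x"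
    by (simp add: graph_normal_space_def graph_tangent_space_def)
  moreover have "w - (w - ?A v) \<in> graph_tangent_space u x"
    by (simp add: graph_tangent_space_def)
  moreover have "a = b" if a: "a \<in> graph_normal_space u x" "w - a \<in> graph_tangent_space u x"
    and b: "b \<in> graph_normal_space u x" "w - b \<in> graph_tangent_space u x" for a b
  proof -
    obtain s t where st: "w - a = ?A s" "w - b = ?A t"
      using a b by (auto simp: graph_tangent_space_def)
    have "a - b = ?A t - ?A s"
      by (simp flip: st)
    then have eq: "a - b = ?A (t - s)"
      using A by (simp add: linear_diff)
    have "pseudo_inner (a - b) (?A (t - s)) = 0"
      using a b by (simp add: diff graph_normal_space_def graph_tangent_space_def)
    then have "t - s = 0"
      using pos[of "t - s"] eq by fastforce
    then show "a = b"
      using eq A by (simp add: linear_0)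
  qed
  ultimately show ?thesis
    by blast
qed

end

theory Submission
  imports Defs
begin

text \<open>
  Let \<open>U = (u\<^sup>1, \<dots>, u\<^sup>n)\<close>, let \<open>g = I - DU\<^sup>T DU\<close> be the induced metric and \<open>T = (a, b)\<close>. Subscripts
  denote derivatives. Read modulo tangent vectors, \<open>H = T\<^sup>\<bottom>\<close> is the quasilinear elliptic system
  \<open>L U = b\<close> with \<open>L = g\<^sup>i\<^sup>j \<partial>\<^sub>i \<partial>\<^sub>j + \<partial>\<^sub>a\<close> (\<open>translator_equation\<close>). The proof is a maximum principle for the
  normal curvatures
    \<open>k(x, v, q) = q \<bullet> U\<^sub>v\<^sub>v / (g(v, v) \<surd>(|q|\<^sup>2 - |grad (q \<bullet> U)|\<^sup>2))\<close>,
  the values of the second fundamental form on a unit tangent vector, tested with a unit normal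
  covector. (Here the negative definite metric of the normal bundle is replaced by its negative, and the
  same convention applies to \<open>|B|\<close> below.) All of them vanish exactly when \<open>D\<^sup>2U = 0\<close>, that is, when
  the graph is a plane.

  The point is a differential inequality. Move along a \<open>g\<close>-orthonormal frame \<open>E\<^sub>c\<close> and carry \<open>v\<close> and
  \<open>q\<close> along by parallel transport to first order. Then the two factors of the denominator have
  vanishing first variation, and their second variations, summed over the frame and completed by the
  drift along \<open>a\<close>, are \<open>-2 \<Sum> |B(E\<^sub>c, v)|\<^sup>2\<close> and \<open>-2 \<Sum> W\<^sub>c\<^sub>d\<^sup>2\<close>, where \<open>W\<^sub>c\<^sub>d = q \<bullet> U\<^sub>c\<^sub>d\<close>. The
  twice differentiated equation gives \<open>-2 \<Sum> W\<^sub>c\<^sub>d \<langle>B(E\<^sub>c, v), B(E\<^sub>d, v)\<rangle>\<close> for the numerator: all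
  derivatives of \<open>U\<close> of order three and four cancel. If \<open>v\<close> maximises \<open>k\<close> for given \<open>x\<close> and \<open>q\<close>, then
  \<open>W \<le> k g\<close>, so the numerator is absorbed by the first factor of the denominator, and what is left is,
  formally, \<open>L (log k) \<ge> k\<^sup>2 - |\<nabla> log k|\<^sup>2\<close>. At a maximum of \<open>\<eta> k\<close>, for a cutoff \<open>\<eta>\<close>, this reads
    \<open>(\<eta> k)\<^sup>2 \<le> 2 |\<nabla>\<eta>|\<^sup>2 - \<eta> L \<eta>\<close>   (\<open>curvature_estimate_at_max\<close>).

  The hypothesis on the determinant enters only through the size of the inverse metric. Since the
  entries of \<open>g\<close> are at most 1 in absolute value, Cramer's rule bounds the trace of \<open>g\<^sup>-\<^sup>1\<close> by
  \<open>m m! / det g\<close>, which is at most \<open>C (1 + |x|\<^sup>2)\<close>. Therefore \<open>\<eta> = R - log (1 + |x|\<^sup>2)\<close> has bounded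
  \<open>|\<nabla>\<eta>|\<close>, and \<open>L \<eta>\<close> is bounded below, uniformly in \<open>R\<close>. This gives \<open>(\<eta> k)\<^sup>2 \<le> const (1 + R)\<close> on
  the ball where \<open>\<eta>\<close> is positive. At a fixed point \<open>\<eta>\<close> grows like \<open>R\<close>, so \<open>k \<le> 0\<close> there. As \<open>q\<close> is
  arbitrary, \<open>D\<^sup>2U = 0\<close>.
\<close>

section \<open>Directional derivatives of smooth maps\<close>

definition D :: "'a \<Rightarrow> ('a::real_normed_vector \<Rightarrow> 'b::real_normed_vector) \<Rightarrow> 'a \<Rightarrow> 'b" where
  "D v f x = frechet_derivative f (at x) v"

text \<open>
  Smoothness for maps into \<open>\<real>\<^sup>n\<close>, so that all components of the graph are differentiated at once.
\<close>

definition smooth_map :: "(real^'m::finite \<Rightarrow> real^'n::finite) \<Rightarrow> bool" where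
  "smooth_map U \<longleftrightarrow> (\<forall>\<alpha>. smooth (\<lambda>x. U x $ \<alpha>))"

lemma smooth_differentiable: "smooth f \<Longrightarrow> f differentiable (at x)"
  unfolding smooth_def using C_k.simps(2) by blast

lemma smooth_partial: "smooth f \<Longrightarrow> smooth (partial i f)"
  unfolding smooth_def using C_k.simps(2) by blast

lemma partial_linear_combination:
  fixes f g :: "real^'m::finite \<Rightarrow> real"
  assumes "f differentiable (at x)" "g differentiable (at x)"
  shows "partial i (\<lambda>x. a * f x + b * g x) x = a * partial i f x + b * partial i g x"
proof -
  have "(f has_derivative frechet_derivative f (at x)) (at x)"
    "(g has_derivative frechet_derivative g (at x)) (at x)"
    using assms frechet_derivative_works by blast+
  then have "((\<lambda>x. a * f x + b * g x) has_derivative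
      (\<lambda>v. a * frechet_derivative f (at x) v + b * frechet_derivative g (at x) v)) (at x)"
    by (auto intro!: derivative_eq_intros)
  then show ?thesis
    unfolding partial_def by (simp add: frechet_derivative_at[symmetric])
qed

lemma C_k_linear_combination:
  fixes f g :: "real^'m::finite \<Rightarrow> real"
  assumes "C_k k f" "C_k k g"
  shows "C_k k (\<lambda>x. a * f x + b * g x)"
  using assms
proof (induction k arbitrary: f g)
  case 0
  then show ?case by (auto intro!: continuous_intros)
next
  case (Suc k)
  have "partial i (\<lambda>x. a * f x + b * g x) = (\<lambda>x. a * partial i f x + b * partial i g x)" for i
    using Suc.prems by (intro ext partial_linear_combination) auto
  then show ?case
    using Suc by auto
qed

lemma smooth_linear_combination:
  fixes f :: "'i \<Rightarrow> real^'m::finite \<Rightarrow> real"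
  assumes "finite I" "I \<noteq> {}" "\<And>i. i \<in> I \<Longrightarrow> smooth (f i)"
  shows "smooth (\<lambda>x. \<Sum>i\<in>I. c i * f i x)"
  using assms
proof (induction I rule: finite_ne_induct)
  case (singleton i)
  then show ?case
    using C_k_linear_combination[where b = 0] unfolding smooth_def by fastforce
next
  case (insert i I)
  then have "C_k k (\<lambda>x. c i * f i x + 1 * (\<Sum>i\<in>I. c i * f i x))" for k
    by (intro C_k_linear_combination) (auto simp: smooth_def)
  then show ?case
    using insert by (simp add: smooth_def)
qed

lemma linear_D:
  assumes "f differentiable (at x)"
  shows "linear (\<lambda>v. D v f x)"
  using linear_frechet_derivative[OF assms] unfolding D_def .

lemma smooth_D:
  fixes f :: "real^'m::finite \<Rightarrow> real"
  assumes "smooth f"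
  shows "smooth (D v f)"
proof -
  have "D v f = (\<lambda>x. \<Sum>i\<in>UNIV. v $ i * partial i f x)"
  proof
    fix x
    show "D v f x = (\<Sum>i\<in>UNIV. v $ i * partial i f x)"
      using linear_axis_expansion[OF linear_D[OF smooth_differentiable[OF assms]], of v x]
      by (simp add: partial_def D_def)
  qed
  then show ?thesis
    using smooth_linear_combination[of UNIV "\<lambda>i. partial i f" "\<lambda>i. v $ i"] smooth_partial[OF assms]
    by simp
qed

lemma D_nth:
  fixes U :: "'a::real_normed_vector \<Rightarrow> real^'n::finite"
  assumes "U differentiable (at x)"
  shows "D v U x $ \<alpha> = D v (\<lambda>x. U x $ \<alpha>) x"
proof -
  have "((\<lambda>x. U x $ \<alpha>) has_derivative (\<lambda>v. frechet_derivative U (at x) v $ \<alpha>)) (at x)"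
    using assms frechet_derivative_works bounded_linear.has_derivative[OF bounded_linear_vec_nth]
    by blast
  then show ?thesis
    unfolding D_def by (simp add: frechet_derivative_at[symmetric])
qed

lemma smooth_map_differentiable:
  assumes "smooth_map U"
  shows "U differentiable (at x)"
proof -
  have "(U has_derivative (\<lambda>v. \<chi> \<alpha>. frechet_derivative (\<lambda>x. U x $ \<alpha>) (at x) v)) (at x)"
  proof (subst has_derivative_componentwise_within, intro ballI)
    fix b :: "real^'b"
    assume "b \<in> Basis"
    then obtain \<alpha> where b: "b = axis \<alpha> 1"
      by (auto simp: Basis_vec_def)
    have "((\<lambda>x. U x $ \<alpha>) has_derivative frechet_derivative (\<lambda>x. U x $ \<alpha>) (at x)) (at x)"
      using assms smooth_differentiable frechet_derivative_works unfolding smooth_map_def by blast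
    then show "((\<lambda>x. U x \<bullet> b) has_derivative
        (\<lambda>v. (\<chi> \<alpha>. frechet_derivative (\<lambda>x. U x $ \<alpha>) (at x) v) \<bullet> b)) (at x)"
      by (simp add: b inner_axis)
  qed
  then show ?thesis
    by (rule differentiableI)
qed

lemma smooth_map_D:
  assumes "smooth_map U"
  shows "smooth_map (D v U)"
proof -
  have "(\<lambda>x. D v U x $ \<alpha>) = D v (\<lambda>x. U x $ \<alpha>)" for \<alpha>
    by (intro ext D_nth smooth_map_differentiable assms)
  then show ?thesis
    using assms smooth_D unfolding smooth_map_def by metis
qed

lemma smooth_map_isCont: "smooth_map U \<Longrightarrow> isCont U x"
  using differentiable_imp_continuous_within smooth_map_differentiable by blast

lemma smooth_map_continuous_on: "smooth_map U \<Longrightarrow> continuous_on S U"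
  using smooth_map_isCont continuous_at_imp_continuous_on by blast

lemma D_along_line:
  assumes "f differentiable (at (x + s *\<^sub>R e))"
  shows "((\<lambda>s. f (x + s *\<^sub>R e)) has_vector_derivative D e f (x + s *\<^sub>R e)) (at s)"
proof -
  let ?F = "frechet_derivative f (at (x + s *\<^sub>R e))"
  have F: "(f has_derivative ?F) (at (x + s *\<^sub>R e))"
    using assms frechet_derivative_works by blast
  have "((\<lambda>s. x + s *\<^sub>R e) has_derivative (\<lambda>h. h *\<^sub>R e)) (at s)"
    by (auto intro!: derivative_eq_intros)
  from has_derivative_compose[OF this F]
  have "((\<lambda>s. f (x + s *\<^sub>R e)) has_derivative (\<lambda>h. ?F (h *\<^sub>R e))) (at s)" .
  moreover have "?F (h *\<^sub>R e) = h *\<^sub>R ?F e" for h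
    using linear_frechet_derivative[OF assms] by (simp add: linear_scale)
  ultimately show ?thesis
    unfolding has_vector_derivative_def D_def by simp
qed

lemma D_along_line_real:
  fixes f :: "'a::real_normed_vector \<Rightarrow> real"
  assumes "f differentiable (at (x + s *\<^sub>R e))"
  shows "((\<lambda>s. f (x + s *\<^sub>R e)) has_real_derivative D e f (x + s *\<^sub>R e)) (at s)"
  using D_along_line[OF assms] by (simp add: has_real_derivative_iff_has_vector_derivative)

text \<open>
  Two applications of the mean value theorem, first in direction \<open>a\<close>, then in direction \<open>b\<close>. The left
  side is symmetric in \<open>a\<close> and \<open>b\<close>, which is what makes second derivatives commute.
\<close>

lemma second_difference_mean_value:
  fixes f :: "real^'m::finite \<Rightarrow> real"
  assumes f: "smooth f" and h: "h > 0"
  obtains s t where "0 < s" "s < h" "0 < t" "t < h"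
    "f (x + h *\<^sub>R a + h *\<^sub>R b) - f (x + h *\<^sub>R a) - f (x + h *\<^sub>R b) + f x
       = h * h * D b (D a f) (x + s *\<^sub>R a + t *\<^sub>R b)"
proof -
  define \<phi> where "\<phi> s = f ((x + h *\<^sub>R b) + s *\<^sub>R a) - f (x + s *\<^sub>R a)" for s
  have "(\<phi> has_real_derivative D a f ((x + h *\<^sub>R b) + s *\<^sub>R a) - D a f (x + s *\<^sub>R a)) (at s)" for s
    unfolding \<phi>_def by (intro DERIV_diff D_along_line_real smooth_differentiable f)
  then obtain s where s: "0 < s" "s < h"
    "\<phi> h - \<phi> 0 = h * (D a f ((x + h *\<^sub>R b) + s *\<^sub>R a) - D a f (x + s *\<^sub>R a))"
    using MVT2[of 0 h \<phi> "\<lambda>s. D a f ((x + h *\<^sub>R b) + s *\<^sub>R a) - D a f (x + s *\<^sub>R a)"] h by auto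
  have "((\<lambda>t. D a f ((x + s *\<^sub>R a) + t *\<^sub>R b)) has_real_derivative
      D b (D a f) ((x + s *\<^sub>R a) + t *\<^sub>R b)) (at t)" for t
    by (intro D_along_line_real smooth_differentiable smooth_D f)
  then obtain t where t: "0 < t" "t < h"
    "D a f ((x + s *\<^sub>R a) + h *\<^sub>R b) - D a f ((x + s *\<^sub>R a) + 0 *\<^sub>R b)
       = h * D b (D a f) ((x + s *\<^sub>R a) + t *\<^sub>R b)"
    using MVT2[of 0 h "\<lambda>t. D a f ((x + s *\<^sub>R a) + t *\<^sub>R b)"
        "\<lambda>t. D b (D a f) ((x + s *\<^sub>R a) + t *\<^sub>R b)"] h by auto
  have "\<phi> h - \<phi> 0 = h * (h * D b (D a f) (x + s *\<^sub>R a + t *\<^sub>R b))"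
    using s t by (simp add: add_ac)
  then show ?thesis
    using that[of s t] s t by (simp add: \<phi>_def algebra_simps)
qed

lemma D_commute_real:
  fixes f :: "real^'m::finite \<Rightarrow> real"
  assumes f: "smooth f"
  shows "D a (D b f) = D b (D a f)"
proof
  fix x
  have close: "\<exists>h>0. \<forall>s t. 0 < s \<longrightarrow> s < h \<longrightarrow> 0 < t \<longrightarrow> t < h \<longrightarrow>
      \<bar>g (x + s *\<^sub>R a + t *\<^sub>R b) - g x\<bar> < e"
    if g: "smooth g" and e: "e > 0" for g :: "real^'m \<Rightarrow> real" and e
  proof -
    have "isCont g x"
      using differentiable_imp_continuous_within smooth_differentiable[OF g] by blast
    then obtain d where d: "d > 0" "\<And>y. norm (y - x) < d \<Longrightarrow> \<bar>g y - g x\<bar> < e"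
      using e unfolding continuous_at_eps_delta dist_norm by (metis real_norm_def)
    define h where "h = d / (norm a + norm b + 1)"
    have pos: "norm a + norm b + 1 > 0"
      by (smt (verit) norm_ge_zero)
    have h: "h > 0"
      using d pos by (simp add: h_def)
    have "\<bar>g (x + s *\<^sub>R a + t *\<^sub>R b) - g x\<bar> < e" if st: "0 < s" "s < h" "0 < t" "t < h" for s t
    proof (rule d(2))
      have "norm (x + s *\<^sub>R a + t *\<^sub>R b - x) \<le> norm (s *\<^sub>R a) + norm (t *\<^sub>R b)"
        using norm_triangle_ineq[of "s *\<^sub>R a" "t *\<^sub>R b"] by (simp add: add_ac)
      also have "\<dots> \<le> h * norm a + h * norm b"
        using st by (intro add_mono) (auto intro: mult_right_mono)
      also have "\<dots> < h * (norm a + norm b + 1)"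
        using h by (simp add: algebra_simps)
      also have "\<dots> = d"
        using pos by (simp add: h_def)
      finally show "norm (x + s *\<^sub>R a + t *\<^sub>R b - x) < d" .
    qed
    with h show ?thesis by blast
  qed
  have "\<bar>D a (D b f) x - D b (D a f) x\<bar> < e" if "e > 0" for e
  proof -
    have "e / 2 > 0" using that by simp
    then obtain h1 h2 where h1: "h1 > 0" "\<And>s t. 0 < s \<Longrightarrow> s < h1 \<Longrightarrow> 0 < t \<Longrightarrow> t < h1 \<Longrightarrow>
        \<bar>D a (D b f) (x + s *\<^sub>R a + t *\<^sub>R b) - D a (D b f) x\<bar> < e / 2"
      and h2: "h2 > 0" "\<And>s t. 0 < s \<Longrightarrow> s < h2 \<Longrightarrow> 0 < t \<Longrightarrow> t < h2 \<Longrightarrow>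
        \<bar>D b (D a f) (x + s *\<^sub>R a + t *\<^sub>R b) - D b (D a f) x\<bar> < e / 2"
      using close[of "D a (D b f)"] close[of "D b (D a f)"] f smooth_D by metis
    define h where "h = min h1 h2"
    have h: "h > 0" "h \<le> h1" "h \<le> h2"
      using h1 h2 by (auto simp: h_def)
    obtain s t where st: "0 < s" "s < h" "0 < t" "t < h"
      "f (x + h *\<^sub>R a + h *\<^sub>R b) - f (x + h *\<^sub>R a) - f (x + h *\<^sub>R b) + f x
         = h * h * D b (D a f) (x + s *\<^sub>R a + t *\<^sub>R b)"
      using second_difference_mean_value[OF f h(1)] .
    obtain s' t' where st': "0 < s'" "s' < h" "0 < t'" "t' < h"
      "f (x + h *\<^sub>R b + h *\<^sub>R a) - f (x + h *\<^sub>R b) - f (x + h *\<^sub>R a) + f x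
         = h * h * D a (D b f) (x + s' *\<^sub>R b + t' *\<^sub>R a)"
      using second_difference_mean_value[OF f h(1)] .
    have "h * h * D b (D a f) (x + s *\<^sub>R a + t *\<^sub>R b)
        = h * h * D a (D b f) (x + t' *\<^sub>R a + s' *\<^sub>R b)"
      using st(5) st'(5) by (simp add: algebra_simps)
    then have "D b (D a f) (x + s *\<^sub>R a + t *\<^sub>R b) = D a (D b f) (x + t' *\<^sub>R a + s' *\<^sub>R b)"
      using h by simp
    with h1(2)[of t' s'] h2(2)[of s t] st st' h show ?thesis
      by linarith
  qed
  from this[of "\<bar>D a (D b f) x - D b (D a f) x\<bar>"]
  show "D a (D b f) x = D b (D a f) x"
    by fastforce
qed

lemma D_commute:
  assumes "smooth_map U"
  shows "D a (D b U) = D b (D a U)"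
proof (intro ext iffD2[OF vec_eq_iff] allI)
  fix x \<alpha>
  have nth: "D a (D b U) x $ \<alpha> = D a (D b (\<lambda>x. U x $ \<alpha>)) x" for a b
    using assms by (simp add: D_nth smooth_map_differentiable smooth_map_D)
  show "D a (D b U) x $ \<alpha> = D b (D a U) x $ \<alpha>"
    using assms D_commute_real unfolding nth smooth_map_def by metis
qed

lemma D_sum:
  assumes "U differentiable (at x)"
  shows "D (\<Sum>b\<in>B. c b *\<^sub>R E b) U x = (\<Sum>b\<in>B. c b *\<^sub>R D (E b) U x)"
  using linear_sum[OF linear_D[OF assms], of "\<lambda>b. c b *\<^sub>R E b" B] linear_scale[OF linear_D[OF assms]]
  by simp

lemma D_along_varying_direction:
  assumes "f differentiable (at z)"
  shows "D (v + s *\<^sub>R V) f z = D v f z + s *\<^sub>R D V f z"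
  using linear_add[OF linear_D[OF assms], of v "s *\<^sub>R V"] linear_scale[OF linear_D[OF assms], of s V] by simp

lemma constant_if_D_zero:
  fixes F :: "real^'m::finite \<Rightarrow> real^'n::finite"
  assumes "\<And>x. F differentiable (at x)" "\<And>v x. D v F x = 0"
  shows "F x = F 0"
proof -
  have "(F has_derivative (\<lambda>h. 0)) (at x)" for x
  proof -
    have "frechet_derivative F (at x) = (\<lambda>h. 0)"
      using assms(2) by (auto simp: D_def)
    then show ?thesis
      using assms(1)[of x] frechet_derivative_works by metis
  qed
  then show ?thesis
    using has_derivative_zero_constant[of UNIV F] by auto
qed

section \<open>Two-jets of curves\<close>

text \<open>
  All variations below are second variations along curves. Recording value, first and second derivative
  at 0 together makes product rule and uniqueness statements about triples, and the maximum principle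
  on a curve becomes \<open>jet2_local_max\<close>.
\<close>

definition jet2 :: "(real \<Rightarrow> 'a::real_normed_vector) \<Rightarrow> 'a \<Rightarrow> 'a \<Rightarrow> 'a \<Rightarrow> bool" where
  "jet2 f a b c \<longleftrightarrow> f 0 = a \<and>
     (\<exists>f'. f' 0 = b \<and> (\<forall>s. (f has_vector_derivative f' s) (at s)) \<and> (f' has_vector_derivative c) (at 0))"

lemma jet2_const: "jet2 (\<lambda>s. c) c 0 0"
  unfolding jet2_def by (auto intro!: exI[of _ "\<lambda>_. 0"])

lemma jet2_line: "jet2 (\<lambda>s. c + s *\<^sub>R e) c e 0"
  unfolding jet2_def by (auto intro!: exI[of _ "\<lambda>_. e"] derivative_eq_intros)

lemma jet2_add:
  assumes "jet2 f a b c" "jet2 g a' b' c'"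
  shows "jet2 (\<lambda>s. f s + g s) (a + a') (b + b') (c + c')"
proof -
  obtain f' g' where "f' 0 = b" "\<forall>s. (f has_vector_derivative f' s) (at s)" "(f' has_vector_derivative c) (at 0)"
    "g' 0 = b'" "\<forall>s. (g has_vector_derivative g' s) (at s)" "(g' has_vector_derivative c') (at 0)"
    using assms unfolding jet2_def by blast
  then show ?thesis
    using assms unfolding jet2_def
    by (auto intro!: exI[of _ "\<lambda>s. f' s + g' s"] has_vector_derivative_add)
qed

lemma jet2_bilinear:
  assumes B: "bounded_bilinear B" and "jet2 f a b c" "jet2 g a' b' c'"
  shows "jet2 (\<lambda>s. B (f s) (g s)) (B a a') (B a b' + B b a') (B a c' + 2 *\<^sub>R B b b' + B c a')"
proof -
  obtain f' g' where fg: "f' 0 = b" "\<forall>s. (f has_vector_derivative f' s) (at s)" "(f' has_vector_derivative c) (at 0)"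
    "g' 0 = b'" "\<forall>s. (g has_vector_derivative g' s) (at s)" "(g' has_vector_derivative c') (at 0)"
    using assms unfolding jet2_def by blast
  have "((\<lambda>s. B (f s) (g' s) + B (f' s) (g s)) has_vector_derivative
     (B (f 0) c' + B (f' 0) (g' 0)) + (B (f' 0) (g' 0) + B c (g 0))) (at 0)"
    using fg by (intro has_vector_derivative_add bounded_bilinear.has_vector_derivative[OF B]) auto
  then show ?thesis
    using assms fg unfolding jet2_def
    by (auto intro!: exI[of _ "\<lambda>s. B (f s) (g' s) + B (f' s) (g s)"]
        bounded_bilinear.has_vector_derivative[OF B] simp: scaleR_2 add_ac)
qed

lemmas jet2_inner = jet2_bilinear[OF bounded_bilinear_inner]
lemmas jet2_scaleR = jet2_bilinear[OF bounded_bilinear_scaleR]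
lemmas jet2_mult = jet2_bilinear[OF bounded_bilinear_mult]

lemma jet2_sum:
  assumes "\<And>i. i \<in> I \<Longrightarrow> jet2 (f i) (a i) (b i) (c i)"
  shows "jet2 (\<lambda>s. \<Sum>i\<in>I. f i s) (\<Sum>i\<in>I. a i) (\<Sum>i\<in>I. b i) (\<Sum>i\<in>I. c i)"
  using assms
proof (induction I rule: infinite_finite_induct)
  case (insert i I)
  then show ?case
    by (simp add: jet2_add)
qed (simp_all add: jet2_const)

lemma jet2_along_line:
  assumes "smooth_map U"
  shows "jet2 (\<lambda>s. U (x + s *\<^sub>R e)) (U x) (D e U x) (D e (D e U) x)"
  unfolding jet2_def
proof (intro conjI exI[of _ "\<lambda>s. D e U (x + s *\<^sub>R e)"] allI)
  show "((\<lambda>s. D e U (x + s *\<^sub>R e)) has_vector_derivative D e (D e U) x) (at 0)"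
    using D_along_line[of "D e U" x 0 e] smooth_map_differentiable[OF smooth_map_D[OF assms]] by simp
qed (use assms in \<open>auto intro!: D_along_line smooth_map_differentiable\<close>)

text \<open>
  The first derivative test, and the second derivative test in contrapositive form: if \<open>c > 0\<close> then the
  derivative is positive just to the right of the critical point 0, so \<open>f\<close> increases there.
\<close>

lemma jet2_local_max:
  fixes f :: "real \<Rightarrow> real"
  assumes "jet2 f a b c" and \<delta>: "\<delta> > 0" "\<And>s. \<bar>s\<bar> < \<delta> \<Longrightarrow> f s \<le> f 0"
  shows "b = 0" "c \<le> 0"
proof -
  obtain f' where f': "f' 0 = b" "\<And>s. (f has_real_derivative f' s) (at s)" "(f' has_real_derivative c) (at 0)"
    using assms unfolding jet2_def by (auto simp: has_real_derivative_iff_has_vector_derivative)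
  show b: "b = 0"
    using DERIV_local_max[OF f'(2)[of 0] \<delta>(1)] \<delta>(2) f'(1) by simp
  show "c \<le> 0"
  proof (rule ccontr)
    assume "\<not> c \<le> 0"
    then obtain d where d: "d > 0" "\<And>h. 0 < h \<Longrightarrow> h < d \<Longrightarrow> f' 0 < f' h"
      using DERIV_pos_inc_right[OF f'(3)] by auto
    define r where "r = min d \<delta> / 2"
    have r: "0 < r" "r < d" "r < \<delta>"
      using d \<delta> by (auto simp: r_def)
    obtain z where z: "0 < z" "z < r" "f r - f 0 = (r - 0) * f' z"
      using MVT2[of 0 r f f'] r f' by auto
    have "f' z > 0"
      using d(2)[of z] z r f' b by simp
    then have "f r > f 0"
      using z r by (smt (verit) mult_pos_pos)
    then show False
      using \<delta>(2)[of r] r by simp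
  qed
qed

lemma jet2_unique:
  assumes "jet2 f a b c" "jet2 f a' b' c'"
  shows "b = b'" "c = c'"
proof -
  obtain f1 f2 where f: "f1 0 = b" "\<And>s. (f has_vector_derivative f1 s) (at s)" "(f1 has_vector_derivative c) (at 0)"
    "f2 0 = b'" "\<And>s. (f has_vector_derivative f2 s) (at s)" "(f2 has_vector_derivative c') (at 0)"
    using assms unfolding jet2_def by blast
  have "f1 = f2"
    using f(2,5) vector_derivative_unique_at by blast
  then show "b = b'" "c = c'"
    using f vector_derivative_unique_at by blast+
qed

lemma jet2_bounded_linear:
  assumes L: "bounded_linear L" and "jet2 f a b c"
  shows "jet2 (\<lambda>s. L (f s)) (L a) (L b) (L c)"
proof -
  obtain f' where "f' 0 = b" "\<And>s. (f has_vector_derivative f' s) (at s)" "(f' has_vector_derivative c) (at 0)"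
    using assms unfolding jet2_def by blast
  then show ?thesis
    using assms unfolding jet2_def
    by (auto intro!: exI[of _ "\<lambda>s. L (f' s)"] bounded_linear.has_vector_derivative[OF L])
qed

lemma has_vector_derivative_iff_slope:
  "(f has_vector_derivative d) (at x) \<longleftrightarrow> ((\<lambda>t. (1 / (t - x)) *\<^sub>R (f t - f x)) \<longlongrightarrow> d) (at x)"
proof -
  have eq: "norm (f t - f x - (t - x) *\<^sub>R d) / norm (t - x) = norm ((1 / (t - x)) *\<^sub>R (f t - f x) - d)"
    if "t \<noteq> x" for t
  proof -
    have "(1 / (t - x)) *\<^sub>R (f t - f x) - d = (1 / (t - x)) *\<^sub>R (f t - f x - (t - x) *\<^sub>R d)"
      using that by (simp add: scaleR_diff_right)
    then show ?thesis
      by simp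
  qed
  have "(f has_vector_derivative d) (at x) \<longleftrightarrow>
      ((\<lambda>t. norm (f t - f x - (t - x) *\<^sub>R d) / norm (t - x)) \<longlongrightarrow> 0) (at x)"
    by (simp add: has_vector_derivative_def has_derivative_iff_norm bounded_linear_scaleR_left)
  also have "\<dots> \<longleftrightarrow> ((\<lambda>t. norm ((1 / (t - x)) *\<^sub>R (f t - f x) - d)) \<longlongrightarrow> 0) (at x)"
  proof (rule tendsto_cong)
    show "\<forall>\<^sub>F t in at x. norm (f t - f x - (t - x) *\<^sub>R d) / norm (t - x)
        = norm ((1 / (t - x)) *\<^sub>R (f t - f x) - d)"
      unfolding eventually_at_filter using eq by (intro always_eventually allI impI) blast
  qed
  also have "\<dots> \<longleftrightarrow> ((\<lambda>t. (1 / (t - x)) *\<^sub>R (f t - f x)) \<longlongrightarrow> d) (at x)"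
    by (simp only: tendsto_norm_zero_iff) (rule Lim_null[symmetric])
  finally show ?thesis .
qed

lemma has_vector_derivative_vec:
  fixes f :: "real \<Rightarrow> 'a::real_normed_vector^'i::finite"
  assumes "\<And>i. ((\<lambda>s. f s $ i) has_vector_derivative d $ i) (at s)"
  shows "(f has_vector_derivative d) (at s)"
  using assms unfolding has_vector_derivative_iff_slope
  by (intro vec_tendstoI) simp

lemma jet2_vec:
  fixes f :: "real \<Rightarrow> 'a::real_normed_vector^'i::finite"
  assumes "\<And>i. jet2 (\<lambda>s. f s $ i) (a $ i) (b $ i) (c $ i)"
  shows "jet2 f a b c"
proof -
  have "\<exists>f'. f' 0 = b $ i \<and> (\<forall>s. ((\<lambda>s. f s $ i) has_vector_derivative f' s) (at s)) \<and>
      (f' has_vector_derivative c $ i) (at 0)" for i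
    using assms[of i] unfolding jet2_def by blast
  then obtain f' where f': "\<And>i. f' i 0 = b $ i"
    "\<And>i s. ((\<lambda>s. f s $ i) has_vector_derivative f' i s) (at s)"
    "\<And>i. (f' i has_vector_derivative c $ i) (at 0)"
    by metis
  have "f 0 = a"
    using assms by (simp add: jet2_def vec_eq_iff)
  moreover have "((\<lambda>s. \<chi> i. f' i s) has_vector_derivative c) (at 0)"
    by (rule has_vector_derivative_vec) (simp add: f')
  moreover have "(f has_vector_derivative (\<chi> i. f' i s)) (at s)" for s
    by (rule has_vector_derivative_vec) (simp add: f')
  moreover have "(\<chi> i. f' i 0) = b"
    by (simp add: vec_eq_iff f')
  ultimately show ?thesis
    unfolding jet2_def by (intro conjI exI[of _ "\<lambda>s. \<chi> i. f' i s"] allI)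
qed

lemma jet2_cong:
  assumes "jet2 f a b c" "\<And>s. f' s = f s" "a' = a" "b' = b" "c' = c"
  shows "jet2 f' a' b' c'"
proof -
  have "f' = f"
    using assms(2) by blast
  with assms show ?thesis
    by simp
qed

lemma jet2_id: "jet2 (\<lambda>s. s) 0 1 0"
  using jet2_line[of "0::real" 1] by simp

lemma jet2_times_id:
  assumes "jet2 f a b c"
  shows "jet2 (\<lambda>s. s *\<^sub>R f s) 0 a (2 *\<^sub>R b)"
  using jet2_scaleR[OF jet2_id assms] by simp

lemma line_stays_near:
  fixes x e :: "'a::real_normed_vector"
  assumes "\<delta> > 0"
  obtains r where "r > 0" "\<And>s. \<bar>s\<bar> < r \<Longrightarrow> norm (x + s *\<^sub>R e - x) < \<delta>"
proof
  have pos: "norm e + 1 > 0"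
    by (smt (verit) norm_ge_zero)
  show "\<delta> / (norm e + 1) > 0"
    using assms pos by simp
  fix s :: real
  assume "\<bar>s\<bar> < \<delta> / (norm e + 1)"
  then have "\<bar>s\<bar> * (norm e + 1) < \<delta>"
    using pos by (simp add: field_simps)
  moreover have "\<bar>s\<bar> * norm e \<le> \<bar>s\<bar> * (norm e + 1)"
    by (simp add: mult_left_mono)
  ultimately show "norm (x + s *\<^sub>R e - x) < \<delta>"
    by simp
qed

text \<open>
  The logarithm is slow enough for its derivatives to beat an inverse metric of quadratic growth: for
  \<open>r = 1 + |x|\<^sup>2\<close>, first derivatives are of order \<open>r\<^sup>-\<^sup>1\<^sup>/\<^sup>2\<close> and second derivatives of order \<open>r\<^sup>-\<^sup>1\<close>.
\<close>

lemma jet2_log_cutoff: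
  fixes x e :: "'a::real_inner"
  defines "r \<equiv> 1 + x \<bullet> x"
  shows "jet2 (\<lambda>s. R - ln (1 + (x + s *\<^sub>R e) \<bullet> (x + s *\<^sub>R e))) (R - ln r)
    (- (2 * (x \<bullet> e) / r)) (- (2 * (e \<bullet> e) / r - (2 * (x \<bullet> e) / r)\<^sup>2))"
proof -
  define \<rho> where "\<rho> s = 1 + (x + s *\<^sub>R e) \<bullet> (x + s *\<^sub>R e)" for s
  define \<rho>' where "\<rho>' s = 2 * (x \<bullet> e) + 2 * s * (e \<bullet> e)" for s
  have \<rho>_eq: "\<rho> = (\<lambda>s. r + 2 * s * (x \<bullet> e) + s * s * (e \<bullet> e))"
    by (rule ext) (simp add: \<rho>_def r_def inner_add_left inner_add_right inner_commute[of e x] algebra_simps)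
  have \<rho>_pos: "\<rho> s > 0" for s
    by (simp add: \<rho>_def add_pos_nonneg)
  have d1: "(\<rho> has_real_derivative \<rho>' s) (at s)" for s
    unfolding \<rho>_eq \<rho>'_def by (auto intro!: derivative_eq_intros)
  have d2: "(\<rho>' has_real_derivative 2 * (e \<bullet> e)) (at s)" for s
    unfolding \<rho>'_def by (auto intro!: derivative_eq_intros)
  have f1: "((\<lambda>s. R - ln (\<rho> s)) has_real_derivative - (\<rho>' s / \<rho> s)) (at s)" for s
    using d1[of s] \<rho>_pos[of s] by (auto intro!: derivative_eq_intros simp: field_simps)
  have f2: "((\<lambda>s. - (\<rho>' s / \<rho> s)) has_real_derivative
      - ((2 * (e \<bullet> e) * \<rho> 0 - \<rho>' 0 * \<rho>' 0) / (\<rho> 0 * \<rho> 0))) (at 0)"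
    using \<rho>_pos[of 0] by (intro DERIV_minus DERIV_divide d1 d2) simp
  have 0: "\<rho> 0 = r" "\<rho>' 0 = 2 * (x \<bullet> e)" "r > 0"
    using \<rho>_pos[of 0] by (auto simp: \<rho>_def \<rho>'_def r_def)
  have "- ((2 * (e \<bullet> e) * \<rho> 0 - \<rho>' 0 * \<rho>' 0) / (\<rho> 0 * \<rho> 0)) = - (2 * (e \<bullet> e) / r - (2 * (x \<bullet> e) / r)\<^sup>2)"
    using 0(3) unfolding 0 by (simp add: field_simps power2_eq_square)
  with f1 f2 0 show ?thesis
    unfolding jet2_def has_real_derivative_iff_has_vector_derivative \<rho>_def[symmetric]
    by (intro conjI exI[of _ "\<lambda>s. - (\<rho>' s / \<rho> s)"]) auto
qed

section \<open>Positive definite matrices\<close>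

lemma matrix_inv_inverse:
  fixes A :: "real^'m::finite^'m"
  assumes "invertible A"
  shows "A ** matrix_inv A = mat 1" "matrix_inv A ** A = mat 1"
  using someI_ex[of "\<lambda>A'. A ** A' = mat 1 \<and> A' ** A = mat 1"] assms
  unfolding invertible_def matrix_inv_def by auto

lemma matrix_inv_unique:
  fixes A :: "real^'m::finite^'m"
  assumes "A ** B = mat 1"
  shows "matrix_inv A = B"
proof -
  have "invertible A"
    using assms invertible_right_inverse by blast
  then show ?thesis
    using matrix_inv_inverse(2)[of A] assms by (metis matrix_mul_assoc matrix_mul_lid matrix_mul_rid)
qed

lemma symmetric_inner_matrix:
  fixes g :: "real^'m::finite^'m"
  assumes "transpose g = g"
  shows "v \<bullet> (g *v w) = w \<bullet> (g *v v)"
  by (metis assms dot_lmul_matrix inner_commute transpose_matrix_vector)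

lemma axis_inner_matrix: "axis i (1::real) \<bullet> (g *v axis j 1) = g $ i $ j"
  by (simp add: inner_axis' matrix_vector_mult_basis column_def)

lemma psd_zero_diagonal:
  fixes g :: "real^'m::finite^'m"
  assumes sym: "transpose g = g" and psd: "\<And>v. v \<bullet> (g *v v) \<ge> 0" and 0: "g $ i $ i = 0"
  shows "g $ i $ j = 0"
proof -
  have sym': "g $ j $ i = g $ i $ j"
    by (metis sym transpose_def vec_lambda_beta)
  have "0 \<le> 2 * t * g $ i $ j + g $ j $ j" for t
    using psd[of "t *\<^sub>R axis i 1 + axis j 1"] 0 sym'
    by (simp add: matrix_vector_right_distrib inner_add_left inner_add_right axis_inner_matrix
        matrix_vector_mult_scaleR)
  from this[of "- (g $ j $ j + 1) / (2 * g $ i $ j)"] show ?thesis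
    by (cases "g $ i $ j = 0") (auto simp: field_simps)
qed

text \<open>
  Cholesky factorisation, eliminating one index at a time: for \<open>c = g\<^sub>k\<^sub>k > 0\<close> and the \<open>k\<close>-th column
  \<open>r\<close>, the Schur complement \<open>g - r r\<^sup>T / c\<close> is again positive semidefinite and has zero \<open>k\<close>-th row
  and column. The set \<open>A\<close> contains the indices that are still to be eliminated; the \<open>k\<close>-th vector of the
  factorisation is the one split off in step \<open>k\<close>.
\<close>

lemma psd_factorization_supported:
  fixes g :: "real^'m::finite^'m"
  assumes "finite A" "transpose g = g" "\<And>v. v \<bullet> (g *v v) \<ge> 0" "\<And>i. i \<notin> A \<Longrightarrow> g $ i $ i = 0"
  shows "\<exists>F :: 'm \<Rightarrow> real^'m. (\<forall>a. a \<notin> A \<longrightarrow> F a = 0) \<and> (\<forall>i j. g $ i $ j = (\<Sum>a\<in>UNIV. F a $ i * F a $ j))"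
  using assms
proof (induction A arbitrary: g rule: finite_induct)
  case empty
  then have "g $ i $ j = 0" for i j
    using psd_zero_diagonal[OF empty.prems(1,2)] by simp
  then show ?case
    by (intro exI[of _ "\<lambda>_. 0"]) auto
next
  case (insert k A)
  show ?case
  proof (cases "g $ k $ k = 0")
    case True
    then have "\<exists>F :: 'm \<Rightarrow> real^'m. (\<forall>a. a \<notin> A \<longrightarrow> F a = 0) \<and> (\<forall>i j. g $ i $ j = (\<Sum>a\<in>UNIV. F a $ i * F a $ j))"
    proof (intro insert.IH)
      show "g $ i $ i = 0" if "i \<notin> A" for i
        using that True insert.prems(3)[of i] by (cases "i = k") auto
    qed (use insert.prems in auto)
    then show ?thesis by auto
  next
    case False
    define c where "c = g $ k $ k"
    have c: "c > 0"
      using insert.prems(2)[of "axis k 1"] False by (simp add: axis_inner_matrix c_def)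
    define r where "r = g *v axis k 1"
    have r: "r $ i = g $ i $ k" for i
      by (simp add: r_def matrix_vector_mult_basis column_def)
    have symg: "g $ i $ j = g $ j $ i" for i j
      using insert.prems(1) by (metis transpose_def vec_lambda_beta)
    define h where "h = (\<chi> i j. g $ i $ j - r $ i * r $ j / c)"
    have hv: "h *v v = g *v v - ((r \<bullet> v) / c) *\<^sub>R r" for v
    proof (subst vec_eq_iff, intro allI)
      fix i
      have "(h *v v) $ i = (\<Sum>j\<in>UNIV. g $ i $ j * v $ j - (r $ i / c) * (r $ j * v $ j))"
        unfolding h_def matrix_vector_mult_def vec_lambda_beta
        by (rule sum.cong)
          (auto simp only: left_diff_distrib mult.assoc times_divide_eq_left times_divide_eq_right)
      also have "\<dots> = (g *v v) $ i - (r $ i / c) * (r \<bullet> v)"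
        unfolding sum_subtractf matrix_vector_mult_def inner_vec_def
        by (simp add: sum_distrib_left)
      finally show "(h *v v) $ i = (g *v v - ((r \<bullet> v) / c) *\<^sub>R r) $ i"
        by simp
    qed
    have psd: "v \<bullet> (h *v v) \<ge> 0" for v
    proof -
      \<comment> \<open>The minimum of the old form on the line through \<open>v\<close> in direction \<open>k\<close> is the new form at \<open>v\<close>.\<close>
      define t where "t = (v \<bullet> r) / c"
      have "0 \<le> (v - t *\<^sub>R axis k 1) \<bullet> (g *v (v - t *\<^sub>R axis k 1))"
        by (rule insert.prems)
      also have "\<dots> = v \<bullet> (g *v v) - 2 * t * (v \<bullet> r) + t * t * c"
        using symmetric_inner_matrix[OF insert.prems(1), of "axis k 1" v]
        by (simp add: matrix_vector_mult_diff_distrib inner_diff_left inner_diff_right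
            matrix_vector_mult_scaleR axis_inner_matrix c_def r_def algebra_simps)
      also have "\<dots> = v \<bullet> (g *v v) - (v \<bullet> r) * (v \<bullet> r) / c"
        using c by (simp add: t_def field_simps)
      also have "\<dots> = v \<bullet> (h *v v)"
        by (simp add: hv inner_diff_right inner_commute[of r])
      finally show ?thesis .
    qed
    have sym: "transpose h = h"
      using symg by (simp add: vec_eq_iff transpose_def h_def mult.commute)
    have diag: "h $ i $ i = 0" if "i \<notin> A" for i
    proof (cases "i = k")
      case True
      then show ?thesis using c by (simp add: h_def r c_def)
    next
      case False
      then have "g $ i $ i = 0"
        using insert.prems(3) that by auto
      moreover from this have "g $ i $ k = 0"
        by (rule psd_zero_diagonal[OF insert.prems(1,2)])
      ultimately show ?thesis by (simp add: h_def r)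
    qed
    obtain F :: "'m \<Rightarrow> real^'m" where F: "\<And>a. a \<notin> A \<Longrightarrow> F a = 0"
      "\<And>i j. h $ i $ j = (\<Sum>a\<in>UNIV. F a $ i * F a $ j)"
      using insert.IH[OF sym psd diag] by blast
    define F' where "F' = F(k := (1 / sqrt c) *\<^sub>R r)"
    have "g $ i $ j = (\<Sum>a\<in>UNIV. F' a $ i * F' a $ j)" for i j
    proof -
      have "(\<Sum>a\<in>UNIV. F' a $ i * F' a $ j) =
          F' k $ i * F' k $ j + (\<Sum>a\<in>UNIV - {k}. F' a $ i * F' a $ j)"
        by (simp add: sum.remove)
      also have "F' k $ i * F' k $ j = r $ i * r $ j / c"
        using c by (simp add: F'_def)
      also have "(\<Sum>a\<in>UNIV - {k}. F' a $ i * F' a $ j) = (\<Sum>a\<in>UNIV - {k}. F a $ i * F a $ j)"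
        by (rule sum.cong) (auto simp: F'_def)
      also have "\<dots> = (\<Sum>a\<in>UNIV. F a $ i * F a $ j)"
        using F(1)[OF insert.hyps(2)] by (simp add: sum.remove[of UNIV k])
      also have "\<dots> = g $ i $ j - r $ i * r $ j / c"
        by (simp flip: F(2)) (simp add: h_def)
      finally show ?thesis by simp
    qed
    moreover have "F' a = 0" if "a \<notin> insert k A" for a
      using that F(1) by (simp add: F'_def)
    ultimately show ?thesis by blast
  qed
qed

text \<open>
  If \<open>g = M\<^sup>T M\<close>, the columns of \<open>M\<^sup>-\<^sup>1\<close> are orthonormal for \<open>g\<close>.
\<close>

lemma orthonormal_frame_exists:
  fixes g :: "real^'m::finite^'m"
  assumes sym: "transpose g = g" and pos: "\<And>v. v \<noteq> 0 \<Longrightarrow> v \<bullet> (g *v v) > 0"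
  obtains E :: "'m \<Rightarrow> real^'m"
  where "\<And>a b. E a \<bullet> (g *v E b) = (if a = b then 1 else 0)"
    and "\<And>v. v = (\<Sum>b\<in>UNIV. (E b \<bullet> (g *v v)) *\<^sub>R E b)"
    and "det g > 0"
proof -
  have psd: "v \<bullet> (g *v v) \<ge> 0" for v
    using pos[of v] by (cases "v = 0") auto
  obtain F :: "'m \<Rightarrow> real^'m" where F: "\<And>i j. g $ i $ j = (\<Sum>a\<in>UNIV. F a $ i * F a $ j)"
    using psd_factorization_supported[OF finite sym psd, of UNIV] by auto
  define M where "M = (\<chi> a i. F a $ i)"
  have g: "g = transpose M ** M"
    by (simp add: vec_eq_iff F matrix_matrix_mult_def transpose_def M_def)
  have "x = 0" if "M *v x = 0" for x
    using pos[of x] that by (cases "x = 0") (auto simp: g simp flip: matrix_vector_mul_assoc)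
  then have inv: "invertible M"
    by (simp add: invertible_left_inverse matrix_left_invertible_ker)
  define N where "N = matrix_inv M"
  have N: "M ** N = mat 1" "N ** M = mat 1"
    using matrix_inv_inverse[OF inv] by (auto simp: N_def)
  define E where "E b = N *v axis b 1" for b
  have ME: "M *v E b = axis b 1" for b
    by (simp add: E_def matrix_vector_mul_assoc N)
  have inner: "v \<bullet> (g *v w) = (M *v v) \<bullet> (M *v w)" for v w
    by (metis g dot_lmul_matrix matrix_vector_mul_assoc transpose_matrix_vector inner_commute)
  show thesis
  proof
    show "E a \<bullet> (g *v E b) = (if a = b then 1 else 0)" for a b
      by (simp add: inner ME inner_axis_axis)
    show "v = (\<Sum>b\<in>UNIV. (E b \<bullet> (g *v v)) *\<^sub>R E b)" for v
    proof -
      have "v = N *v (M *v v)"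
        by (simp add: matrix_vector_mul_assoc N)
      also have "\<dots> = (\<Sum>b\<in>UNIV. (M *v v) $ b *\<^sub>R E b)"
        by (subst linear_axis_expansion[OF matrix_vector_mul_linear]) (simp add: E_def)
      also have "\<dots> = (\<Sum>b\<in>UNIV. (E b \<bullet> (g *v v)) *\<^sub>R E b)"
        by (simp add: inner ME inner_axis')
      finally show ?thesis .
    qed
    have "det M \<noteq> 0"
      using inv by (simp add: invertible_det_nz)
    then show "det g > 0"
      by (metis g det_mul det_transpose not_real_square_gt_zero)
  qed
qed

lemma abs_det_le_fact:
  fixes A :: "real^'m::finite^'m"
  assumes "\<And>i j. \<bar>A $ i $ j\<bar> \<le> 1"
  shows "\<bar>det A\<bar> \<le> fact CARD('m)"
proof -
  have "\<bar>det A\<bar> \<le> (\<Sum>p | p permutes (UNIV :: 'm set). \<bar>of_int (sign p) * (\<Prod>i\<in>UNIV. A $ i $ p i)\<bar>)"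
    unfolding det_def by (rule sum_abs)
  also have "\<dots> \<le> (\<Sum>p | p permutes (UNIV :: 'm set). 1)"
  proof (rule sum_mono)
    fix p :: "'m \<Rightarrow> 'm"
    have "\<bar>\<Prod>i\<in>UNIV. A $ i $ p i\<bar> \<le> 1"
      unfolding abs_prod using assms by (intro prod_le_1) auto
    then show "\<bar>of_int (sign p) * (\<Prod>i\<in>UNIV. A $ i $ p i)\<bar> \<le> 1"
      by (simp add: abs_mult sign_def)
  qed
  also have "\<dots> = fact CARD('m)"
    by (simp add: card_permutations)
  finally show ?thesis .
qed

text \<open>
  The sum of the \<open>j\<close>-th squared coordinates of a \<open>g\<close>-orthonormal frame is the \<open>j\<close>-th diagonal entry of
  \<open>g\<^sup>-\<^sup>1\<close>. By Cramer's rule this entry is a quotient of determinants, with numerator at most \<open>m!\<close>.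
\<close>

lemma orthonormal_frame_norm_bound:
  fixes g :: "real^'m::finite^'m"
  assumes exp: "\<And>v. v = (\<Sum>b\<in>UNIV. (E b \<bullet> (g *v v)) *\<^sub>R E b)"
    and det: "det g > 0" and le: "\<And>i j. \<bar>g $ i $ j\<bar> \<le> 1"
  shows "(\<Sum>b\<in>UNIV. E b \<bullet> E b) \<le> real CARD('m) * fact CARD('m) / det g"
proof -
  have "(\<Sum>b\<in>UNIV. E b $ j * E b $ j) \<le> fact CARD('m) / det g" for j :: 'm
  proof -
    \<comment> \<open>the \<open>j\<close>-th column of the inverse of \<open>g\<close>\<close>
    define v where "v = (\<chi> k. det (\<chi> i j'. if j' = k then axis j 1 $ i else g $ i $ j') / det g)"
    have gv: "g *v v = axis j 1"
      using det cramer[of g v "axis j 1"] by (simp add: v_def)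
    have "v $ j = (\<Sum>b\<in>UNIV. (E b \<bullet> (g *v v)) *\<^sub>R E b) $ j"
      by (metis exp)
    then have "(\<Sum>b\<in>UNIV. E b $ j * E b $ j) = v $ j"
      by (simp add: gv inner_axis)
    also have "\<dots> = det (\<chi> i j'. if j' = j then axis j 1 $ i else g $ i $ j') / det g"
      by (simp add: v_def)
    also have "\<dots> \<le> fact CARD('m) / det g"
    proof (intro divide_right_mono)
      have "\<bar>det (\<chi> i j'. if j' = j then axis j 1 $ i else g $ i $ j')\<bar> \<le> fact CARD('m)"
        using le by (intro abs_det_le_fact) (simp add: axis_def)
      then show "det (\<chi> i j'. if j' = j then axis j 1 $ i else g $ i $ j') \<le> fact CARD('m)"
        by simp
    qed (use det in simp)
    finally show ?thesis .
  qed
  then have "(\<Sum>j\<in>UNIV. \<Sum>b\<in>UNIV. E b $ j * E b $ j) \<le> (\<Sum>j\<in>(UNIV::'m set). fact CARD('m) / det g)"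
    by (intro sum_mono) auto
  then show ?thesis
    by (subst (asm) sum.swap) (simp add: inner_vec_def)
qed

section \<open>The inverse of a matrix-valued curve\<close>

lemma bounded_bilinear_matrix_mult:
  "bounded_bilinear ((**) :: real^'m::finite^'m \<Rightarrow> real^'m^'m \<Rightarrow> real^'m^'m)"
  unfolding bilinear_conv_bounded_bilinear[symmetric] bilinear_def
  by (auto intro!: linearI simp: vec_eq_iff matrix_matrix_mult_def
      sum_distrib_left sum.distrib algebra_simps)

lemma tendsto_det:
  fixes A :: "'x \<Rightarrow> real^'m::finite^'m"
  assumes "\<And>i j. ((\<lambda>t. A t $ i $ j) \<longlongrightarrow> B $ i $ j) F"
  shows "((\<lambda>t. det (A t)) \<longlongrightarrow> det B) F"
  unfolding det_def by (intro tendsto_intros assms)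

lemma matrix_inv_cramer:
  fixes A :: "real^'m::finite^'m"
  assumes "invertible A"
  shows "matrix_inv A $ k $ l = det (\<chi> i j. if j = k then axis l 1 $ i else A $ i $ j) / det A"
proof -
  have "A *v (matrix_inv A *v axis l 1) = axis l 1"
    using matrix_inv_inverse[OF assms] by (simp add: matrix_vector_mul_assoc)
  then have "matrix_inv A *v axis l 1 = (\<chi> k. det (\<chi> i j. if j = k then axis l 1 $ i else A $ i $ j) / det A)"
    using cramer[of A] assms invertible_det_nz by blast
  then show ?thesis
    by (simp add: vec_eq_iff matrix_vector_mult_basis column_def)
qed

lemma tendsto_matrix_inv:
  fixes A :: "'x \<Rightarrow> real^'m::finite^'m"
  assumes lim: "(A \<longlongrightarrow> B) F" and "\<And>t. invertible (A t)" "invertible B"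
  shows "((\<lambda>t. matrix_inv (A t)) \<longlongrightarrow> matrix_inv B) F"
proof (intro vec_tendstoI)
  fix k l
  have nth: "((\<lambda>t. A t $ i $ j) \<longlongrightarrow> B $ i $ j) F" for i j
    by (intro tendsto_vec_nth lim)
  have "((\<lambda>t. if j = k then axis l 1 $ i else A t $ i $ j) \<longlongrightarrow>
      (if j = k then axis l 1 $ i else B $ i $ j)) F" for i j
    using nth by simp
  then show "((\<lambda>t. matrix_inv (A t) $ k $ l) \<longlongrightarrow> matrix_inv B $ k $ l) F"
    unfolding matrix_inv_cramer[OF assms(2)] matrix_inv_cramer[OF assms(3)]
    using assms(3) nth by (intro tendsto_divide tendsto_det) (auto simp: invertible_det_nz)
qed

text \<open>
  From \<open>K(t) - K(s) = - K(t) (M(t) - M(s)) K(s)\<close> for \<open>K = M\<^sup>-\<^sup>1\<close>: the difference quotients of \<open>K\<close>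
  converge because \<open>K\<close> is continuous.
\<close>

lemma has_vector_derivative_matrix_inv:
  fixes M :: "real \<Rightarrow> real^'m::finite^'m"
  assumes M: "(M has_vector_derivative M') (at s)" and inv: "\<And>t. invertible (M t)"
  shows "((\<lambda>t. matrix_inv (M t)) has_vector_derivative - (matrix_inv (M s) ** M' ** matrix_inv (M s))) (at s)"
proof -
  interpret bounded_bilinear "(**) :: real^'m^'m \<Rightarrow> real^'m^'m \<Rightarrow> real^'m^'m"
    by (rule bounded_bilinear_matrix_mult)
  let ?K = "\<lambda>t. matrix_inv (M t)"
  have "isCont M s"
    using M has_vector_derivative_continuous by blast
  then have K: "(?K \<longlongrightarrow> ?K s) (at s)"
    by (intro tendsto_matrix_inv inv) (simp add: continuous_at)
  have "((\<lambda>t. - (?K t ** ((1 / (t - s)) *\<^sub>R (M t - M s)) ** ?K s)) \<longlongrightarrow> - (?K s ** M' ** ?K s)) (at s)"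
    using M[unfolded has_vector_derivative_iff_slope]
    by (intro tendsto_minus tendsto K tendsto_const)
  moreover have "- (?K t ** ((1 / (t - s)) *\<^sub>R (M t - M s)) ** ?K s) = (1 / (t - s)) *\<^sub>R (?K t - ?K s)" for t
  proof -
    have "?K t ** (M t - M s) ** ?K s = (?K t ** M t) ** ?K s - ?K t ** (M s ** ?K s)"
      by (simp add: diff_left diff_right matrix_mul_assoc)
    also have "\<dots> = ?K s - ?K t"
      by (simp add: matrix_inv_inverse inv)
    finally show ?thesis
      by (simp add: scaleR_left scaleR_right flip: scaleR_minus_right)
  qed
  ultimately show ?thesis
    unfolding has_vector_derivative_iff_slope by simp
qed

lemma jet2_matrix_inv:
  fixes M :: "real \<Rightarrow> real^'m::finite^'m"
  assumes M: "jet2 M (mat 1) m1 m2" and inv: "\<And>t. invertible (M t)"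
  shows "jet2 (\<lambda>s. matrix_inv (M s)) (mat 1) (- m1) (2 *\<^sub>R (m1 ** m1) - m2)"
proof -
  interpret bounded_bilinear "(**) :: real^'m^'m \<Rightarrow> real^'m^'m \<Rightarrow> real^'m^'m"
    by (rule bounded_bilinear_matrix_mult)
  let ?K = "\<lambda>t. matrix_inv (M t)"
  obtain M' where M': "M 0 = mat 1" "M' 0 = m1" "\<And>s. (M has_vector_derivative M' s) (at s)"
    "(M' has_vector_derivative m2) (at 0)"
    using M unfolding jet2_def by blast
  have K: "(?K has_vector_derivative - (?K s ** M' s ** ?K s)) (at s)" for s
    by (intro has_vector_derivative_matrix_inv M' inv)
  have K0: "?K 0 = mat 1"
    using M'(1) by (simp add: matrix_inv_unique)
  have "((\<lambda>s. - (?K s ** M' s ** ?K s)) has_vector_derivative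
      - ((?K 0 ** M' 0) ** (- (?K 0 ** M' 0 ** ?K 0))
        + (?K 0 ** m2 + (- (?K 0 ** M' 0 ** ?K 0)) ** M' 0) ** ?K 0)) (at 0)"
    by (intro has_vector_derivative_minus has_vector_derivative K M')
  moreover have "- ((?K 0 ** M' 0) ** (- (?K 0 ** M' 0 ** ?K 0))
        + (?K 0 ** m2 + (- (?K 0 ** M' 0 ** ?K 0)) ** M' 0) ** ?K 0) = 2 *\<^sub>R (m1 ** m1) - m2"
    by (simp only: K0 M'(2) minus_left minus_right add_left matrix_mul_lid matrix_mul_rid minus_minus
        minus_add_distrib) (simp add: scaleR_2)
  ultimately have K': "((\<lambda>s. - (?K s ** M' s ** ?K s)) has_vector_derivative 2 *\<^sub>R (m1 ** m1) - m2) (at 0)"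
    by (simp only:)
  have "- (?K 0 ** M' 0 ** ?K 0) = - m1"
    by (simp only: K0 M'(2) matrix_mul_lid matrix_mul_rid)
  with K K0 K' show ?thesis
    unfolding jet2_def by (intro conjI exI[of _ "\<lambda>s. - (?K s ** M' s ** ?K s)"] allI)
qed

section \<open>The translator equation\<close>

definition first_form :: "(real^'m::finite \<Rightarrow> real^'n::finite) \<Rightarrow> real^'m \<Rightarrow> real^'m \<Rightarrow> real^'m \<Rightarrow> real" where
  "first_form U x v w = v \<bullet> w - D v U x \<bullet> D w U x"

definition metric_matrix :: "(real^'m::finite \<Rightarrow> real^'n::finite) \<Rightarrow> real^'m \<Rightarrow> real^'m^'m" where
  "metric_matrix U x = (\<chi> i j. first_form U x (axis i 1) (axis j 1))"

text \<open>
  The normal part of \<open>(0, w)\<close> has a definite metric, with matrix \<open>(I - DU DU\<^sup>T)\<^sup>-\<^sup>1\<close>. This is the dual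
  metric on covectors, \<open>|q|\<^sup>2 - |DU\<^sup>T q|\<^sup>2\<close>, which is free of matrix inverses.
\<close>

definition normal_form :: "(real^'m::finite \<Rightarrow> real^'n::finite) \<Rightarrow> real^'m \<Rightarrow> real^'n \<Rightarrow> real" where
  "normal_form U x q = q \<bullet> q - (\<Sum>i\<in>UNIV. (q \<bullet> D (axis i 1) U x) * (q \<bullet> D (axis i 1) U x))"

text \<open>
  The translator condition as it is used: a spacelike solution of \<open>g\<^sup>i\<^sup>j U\<^sub>i\<^sub>j + U\<^sub>a = b\<close>.
\<close>

locale translator_system =
  fixes U :: "real^'m::finite \<Rightarrow> real^'n::finite" and a :: "real^'m" and b :: "real^'n"
  assumes smooth: "smooth_map U"
    and spacelike: "\<And>x v. v \<noteq> 0 \<Longrightarrow> first_form U x v v > 0"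
    and equation: "\<And>x. (\<Sum>i\<in>UNIV. \<Sum>j\<in>UNIV. matrix_inv (metric_matrix U x) $ i $ j *\<^sub>R
                      D (axis i 1) (D (axis j 1) U) x) + D a U x = b"
begin

lemma smooth1: "smooth_map (D v U)"
  using smooth smooth_map_D by blast

lemma smooth2: "smooth_map (D v (D w U))"
  using smooth1 smooth_map_D by blast

lemma D1_sum: "D (\<Sum>b\<in>B. c b *\<^sub>R E b) U x = (\<Sum>b\<in>B. c b *\<^sub>R D (E b) U x)"
  by (intro D_sum smooth_map_differentiable smooth)

lemma D2_sum: "D (\<Sum>b\<in>B. c b *\<^sub>R E b) (D v U) x = (\<Sum>b\<in>B. c b *\<^sub>R D (E b) (D v U) x)"
  by (intro D_sum smooth_map_differentiable smooth1)

lemma D3_sum: "D (\<Sum>b\<in>B. c b *\<^sub>R E b) (D v (D w U)) x = (\<Sum>b\<in>B. c b *\<^sub>R D (E b) (D v (D w U)) x)"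
  by (intro D_sum smooth_map_differentiable smooth2)

lemma D2_commute: "D v (D w U) = D w (D v U)"
  by (rule D_commute[OF smooth])

lemma D2_sum_right: "D v (D (\<Sum>b\<in>B. c b *\<^sub>R E b) U) x = (\<Sum>b\<in>B. c b *\<^sub>R D v (D (E b) U) x)"
  by (simp add: D2_commute[of v] D2_sum)

lemma D3_commute: "D v (D w (D z U)) = D w (D v (D z U))"
  by (rule D_commute[OF smooth1])

lemma first_form_commute: "first_form U x v w = first_form U x w v"
  by (simp add: first_form_def inner_commute)

lemma first_form_sum_right:
  "first_form U x v (\<Sum>b\<in>B. c b *\<^sub>R E b) = (\<Sum>b\<in>B. c b * first_form U x v (E b))"
  by (simp add: first_form_def D1_sum inner_sum_right sum_subtractf right_diff_distrib)

lemma first_form_sum_left: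
  "first_form U x (\<Sum>b\<in>B. c b *\<^sub>R E b) v = (\<Sum>b\<in>B. c b * first_form U x (E b) v)"
  by (simp add: first_form_commute[of _ _ v] first_form_sum_right)

lemma first_form_matrix: "first_form U x v w = v \<bullet> (metric_matrix U x *v w)"
proof -
  have "first_form U x v w = first_form U x (\<Sum>i\<in>UNIV. v $ i *\<^sub>R axis i 1) (\<Sum>j\<in>UNIV. w $ j *\<^sub>R axis j 1)"
    using basis_expansion[of v] basis_expansion[of w] by (simp add: scalar_mult_eq_scaleR)
  also have "\<dots> = v \<bullet> (metric_matrix U x *v w)"
    by (subst first_form_sum_left, subst first_form_sum_right) (simp add: inner_vec_def matrix_vector_mult_def metric_matrix_def mult.commute)
  finally show ?thesis .
qed

lemma transpose_metric_matrix: "transpose (metric_matrix U x) = metric_matrix U x"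
  by (simp add: transpose_def metric_matrix_def vec_eq_iff first_form_commute)

lemma pos_metric_matrix: "v \<noteq> 0 \<Longrightarrow> v \<bullet> (metric_matrix U x *v v) > 0"
  using spacelike by (simp add: first_form_matrix)

lemma invertible_metric_matrix: "invertible (metric_matrix U x)"
proof -
  obtain E where "det (metric_matrix U x) > 0"
    using orthonormal_frame_exists[OF transpose_metric_matrix pos_metric_matrix] by metis
  then show ?thesis
    by (simp add: invertible_det_nz)
qed

text \<open>
  The second order part of the equation is the trace of \<open>D\<^sup>2U\<close> with respect to \<open>g\<close>, hence it can be
  written in any basis. A basis that is orthonormal at the point of interest turns the inverse matrix
  into a curve through the identity, whose jet is easy.
\<close>

lemma equation_in_basis:
  fixes x :: "real^'m" and N :: "real^'m^'m" and E :: "'m \<Rightarrow> real^'m"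
  assumes N: "invertible N" and E: "\<And>a i. E a $ i = N $ i $ a"
  defines "M \<equiv> \<chi> a b. first_form U x (E a) (E b)"
  shows "invertible M"
    and "(\<Sum>c\<in>UNIV. \<Sum>d\<in>UNIV. matrix_inv M $ c $ d *\<^sub>R D (E c) (D (E d) U) x) + D a U x = b"
proof -
  define g where "g = metric_matrix U x"
  define G where "G = matrix_inv g"
  define K where "K = matrix_inv M"
  have g: "invertible g"
    by (simp add: g_def invertible_metric_matrix)
  have E_col: "E c = N *v axis c 1" for c
    by (simp add: vec_eq_iff E matrix_vector_mult_basis column_def)
  have M: "M = transpose N ** g ** N"
  proof (subst vec_eq_iff, intro allI, subst vec_eq_iff, intro allI)
    fix c d
    have "M $ c $ d = (N *v axis c 1) \<bullet> (g *v (N *v axis d 1))"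
      by (simp add: M_def first_form_matrix g_def E_col)
    also have "\<dots> = axis c 1 \<bullet> ((transpose N ** g ** N) *v axis d 1)"
      by (metis dot_lmul_matrix inner_commute matrix_vector_mul_assoc transpose_matrix_vector)
    finally show "M $ c $ d = (transpose N ** g ** N) $ c $ d"
      by (simp add: axis_inner_matrix)
  qed
  show inv: "invertible M"
    unfolding M by (intro invertible_mult transpose_invertible N g)
  have "G = N ** K ** transpose N"
  proof -
    have "g ** (N ** K ** transpose N) = mat 1"
    proof -
      have tN: "transpose N ** matrix_inv (transpose N) = mat 1" "matrix_inv (transpose N) ** transpose N = mat 1"
        using matrix_inv_inverse[OF transpose_invertible[OF N]] .
      have "g ** (N ** K ** transpose N) = matrix_inv (transpose N) ** (M ** K) ** transpose N"
        unfolding M by (metis matrix_mul_assoc matrix_mul_lid tN(2))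
      also have "M ** K = mat 1"
        unfolding K_def by (rule matrix_inv_inverse[OF inv])
      finally show ?thesis
        by (simp add: tN)
    qed
    then show ?thesis
      unfolding G_def by (rule matrix_inv_unique)
  qed
  then have G: "G $ i $ j = (\<Sum>d\<in>UNIV. \<Sum>c\<in>UNIV. K $ c $ d * (E c $ i * E d $ j))" for i j
    by (simp add: matrix_matrix_mult_def transpose_def E sum_distrib_left sum_distrib_right mult_ac)
  have E_sum: "E c = (\<Sum>i\<in>UNIV. E c $ i *\<^sub>R axis i 1)" for c
    using basis_expansion[of "E c"] by (simp add: scalar_mult_eq_scaleR)
  let ?B = "\<lambda>i j. D (axis i 1) (D (axis j 1) U) x"
  have "(\<Sum>c\<in>UNIV. \<Sum>d\<in>UNIV. K $ c $ d *\<^sub>R D (E c) (D (E d) U) x)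
      = (\<Sum>c\<in>UNIV. \<Sum>d\<in>UNIV. \<Sum>i\<in>UNIV. \<Sum>j\<in>UNIV. (K $ c $ d * (E c $ i * E d $ j)) *\<^sub>R ?B i j)"
  proof (intro sum.cong refl)
    fix c d
    have "D (E c) (D (E d) U) x = (\<Sum>i\<in>UNIV. E c $ i *\<^sub>R D (axis i 1) (D (E d) U) x)"
      by (subst E_sum) (rule D2_sum)
    also have "\<dots> = (\<Sum>i\<in>UNIV. E c $ i *\<^sub>R (\<Sum>j\<in>UNIV. E d $ j *\<^sub>R ?B i j))"
      by (subst E_sum[of d]) (simp only: D2_sum_right)
    finally show "K $ c $ d *\<^sub>R D (E c) (D (E d) U) x
        = (\<Sum>i\<in>UNIV. \<Sum>j\<in>UNIV. (K $ c $ d * (E c $ i * E d $ j)) *\<^sub>R ?B i j)"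
      by (simp add: scaleR_sum_right)
  qed
  also have "\<dots> = (\<Sum>c\<in>UNIV. \<Sum>i\<in>UNIV. \<Sum>j\<in>UNIV. \<Sum>d\<in>UNIV. (K $ c $ d * (E c $ i * E d $ j)) *\<^sub>R ?B i j)"
    by (rule sum.cong[OF refl], subst sum.swap, rule sum.cong[OF refl], rule sum.swap)
  also have "\<dots> = (\<Sum>i\<in>UNIV. \<Sum>j\<in>UNIV. \<Sum>c\<in>UNIV. \<Sum>d\<in>UNIV. (K $ c $ d * (E c $ i * E d $ j)) *\<^sub>R ?B i j)"
    by (subst sum.swap, rule sum.cong[OF refl], rule sum.swap)
  also have "\<dots> = (\<Sum>i\<in>UNIV. \<Sum>j\<in>UNIV. G $ i $ j *\<^sub>R ?B i j)"
    unfolding G scaleR_sum_left by (intro sum.cong refl sum.swap)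
  finally show "(\<Sum>c\<in>UNIV. \<Sum>d\<in>UNIV. matrix_inv M $ c $ d *\<^sub>R D (E c) (D (E d) U) x) + D a U x = b"
    using equation[of x] by (simp add: K_def G_def g_def)
qed

end

section \<open>The differentiated equation in an orthonormal frame\<close>

locale translator_frame = translator_system U a b
  for U :: "real^'m::finite \<Rightarrow> real^'n::finite" and a b +
  fixes x :: "real^'m" and E :: "'m \<Rightarrow> real^'m"
  assumes orthonormal: "\<And>c d. first_form U x (E c) (E d) = (if c = d then 1 else 0)"
    and expansion: "\<And>v. v = (\<Sum>c\<in>UNIV. first_form U x (E c) v *\<^sub>R E c)"
begin

text \<open>
  \<open>k v c d\<close> is the \<open>d\<close>-th frame coordinate of \<open>-\<nabla>v\<close> along \<open>E c\<close> for constant \<open>v\<close>, up to sign the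
  Christoffel symbol.
\<close>

abbreviation "p c \<equiv> D (E c) U x"
abbreviation "A c d \<equiv> D (E c) (D (E d) U) x"
abbreviation "y v c \<equiv> D (E c) (D v U) x"
abbreviation "k v c d \<equiv> p d \<bullet> y v c"

lemma equation_in_frame:
  "invertible (\<chi> c d. first_form U z (E c) (E d))" (is "invertible ?M")
  "(\<Sum>c\<in>UNIV. \<Sum>d\<in>UNIV. matrix_inv (\<chi> c d. first_form U z (E c) (E d)) $ c $ d *\<^sub>R D (E c) (D (E d) U) z)
     + D a U z = b"
proof -
  define N where "N = (\<chi> i c. E c $ i)"
  have "v = 0" if "transpose N *v v = 0" for v
  proof -
    have "v \<bullet> E c = 0" for c
      using that by (simp add: vec_eq_iff N_def transpose_def matrix_vector_mult_def inner_vec_def mult.commute)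
    moreover have "v \<bullet> v = v \<bullet> (\<Sum>c\<in>UNIV. first_form U x (E c) v *\<^sub>R E c)"
      by (rule arg_cong[OF expansion])
    ultimately show "v = 0"
      by (simp add: inner_sum_right)
  qed
  then have "invertible (transpose N)"
    by (simp add: invertible_left_inverse matrix_left_invertible_ker)
  then have N: "invertible N"
    using transpose_invertible transpose_transpose by metis
  have E: "E c $ i = N $ i $ c" for c i
    by (simp add: N_def)
  show "invertible (\<chi> c d. first_form U z (E c) (E d))"
    by (rule equation_in_basis(1)[OF N E])
  show "(\<Sum>c\<in>UNIV. \<Sum>d\<in>UNIV. matrix_inv (\<chi> c d. first_form U z (E c) (E d)) $ c $ d *\<^sub>R D (E c) (D (E d) U) z)
     + D a U z = b"
    by (rule equation_in_basis(2)[OF N E])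
qed

text \<open>
  The equation is constant along the line in direction \<open>v\<close>, so both derivatives of its left side
  vanish. At the base point the metric has coefficients \<open>\<delta>\<close>, first derivative \<open>-S\<close> and second derivative
  \<open>m2\<close>, hence its inverse has first derivative \<open>S\<close> and second derivative \<open>2 S S - m2\<close>.
\<close>

lemma differentiated_equation:
  fixes v
  defines "S c d \<equiv> k v c d + k v d c"
    and "T c d \<equiv> D v (D (E c) (D (E d) U)) x"
    and "Q c d \<equiv> D v (D v (D (E c) (D (E d) U))) x"
    and "r c d \<equiv> p d \<bullet> D v (D v (D (E c) U)) x"
  shows "(\<Sum>c\<in>UNIV. T c c) + (\<Sum>c\<in>UNIV. \<Sum>d\<in>UNIV. S c d *\<^sub>R A c d) + D v (D a U) x = 0"
    and "(\<Sum>c\<in>UNIV. Q c c) + 2 *\<^sub>R (\<Sum>c\<in>UNIV. \<Sum>d\<in>UNIV. S c d *\<^sub>R T c d)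
       + (\<Sum>c\<in>UNIV. \<Sum>d\<in>UNIV. (2 * (\<Sum>e\<in>UNIV. S c e * S e d)
            + r c d + 2 * (y v c \<bullet> y v d) + r d c) *\<^sub>R A c d) + D v (D v (D a U)) x = 0"
proof -
  define M where "M s = (\<chi> c d. first_form U (x + s *\<^sub>R v) (E c) (E d))" for s
  define m1 where "m1 = (\<chi> c d. - S c d)"
  define m2 where "m2 = (\<chi> c d. - (r c d + 2 * (y v c \<bullet> y v d) + r d c))"
  have yv: "D v (D (E c) U) x = y v c" for c
    by (simp add: D2_commute)
  have M: "jet2 M (mat 1) m1 m2"
  proof (intro jet2_vec)
    fix c d
    have P: "jet2 (\<lambda>s. D (E c) U (x + s *\<^sub>R v)) (p c) (y v c) (D v (D v (D (E c) U)) x)" for c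
      using jet2_along_line[OF smooth1, of "E c" x v] by (simp add: yv)
    have "jet2 (\<lambda>s. E c \<bullet> E d + (- 1) * (D (E c) U (x + s *\<^sub>R v) \<bullet> D (E d) U (x + s *\<^sub>R v)))
       (mat 1 $ c $ d) (m1 $ c $ d) (m2 $ c $ d)"
      using jet2_add[OF jet2_const jet2_mult[OF jet2_const jet2_inner[OF P[of c] P[of d]]], of "E c \<bullet> E d" "- 1"]
        orthonormal[of c d]
      by (simp add: first_form_def mat_def m1_def m2_def S_def r_def inner_commute algebra_simps)
    then show "jet2 (\<lambda>s. M s $ c $ d) (mat 1 $ c $ d) (m1 $ c $ d) (m2 $ c $ d)"
      by (simp add: M_def first_form_def)
  qed
  have "invertible (M s)" for s
    unfolding M_def by (rule equation_in_frame)
  from jet2_matrix_inv[OF M this]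
  have K: "jet2 (\<lambda>s. matrix_inv (M s)) (mat 1) (- m1) (2 *\<^sub>R (m1 ** m1) - m2)" .
  have Kcd: "jet2 (\<lambda>s. matrix_inv (M s) $ c $ d) (if c = d then 1 else 0) (S c d)
      (2 * (\<Sum>e\<in>UNIV. S c e * S e d) + r c d + 2 * (y v c \<bullet> y v d) + r d c)" for c d
    using jet2_bounded_linear[OF bounded_linear_vec_nth[of d] jet2_bounded_linear[OF bounded_linear_vec_nth[of c] K]]
    by (simp add: mat_def m1_def m2_def matrix_matrix_mult_def algebra_simps)
  have "jet2 (\<lambda>s. (\<Sum>c\<in>UNIV. \<Sum>d\<in>UNIV. matrix_inv (M s) $ c $ d *\<^sub>R D (E c) (D (E d) U) (x + s *\<^sub>R v))
        + D a U (x + s *\<^sub>R v))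
     ((\<Sum>c\<in>UNIV. \<Sum>d\<in>UNIV. (if c = d then 1 else 0) *\<^sub>R A c d) + D a U x)
     ((\<Sum>c\<in>UNIV. \<Sum>d\<in>UNIV. (if c = d then 1 else 0) *\<^sub>R T c d + S c d *\<^sub>R A c d) + D v (D a U) x)
     ((\<Sum>c\<in>UNIV. \<Sum>d\<in>UNIV. (if c = d then 1 else 0) *\<^sub>R Q c d + 2 *\<^sub>R S c d *\<^sub>R T c d +
        (2 * (\<Sum>e\<in>UNIV. S c e * S e d) + r c d + 2 * (y v c \<bullet> y v d) + r d c) *\<^sub>R A c d)
      + D v (D v (D a U)) x)"
    unfolding T_def Q_def
    by (intro jet2_add jet2_sum jet2_scaleR Kcd jet2_along_line smooth1 smooth2)
  then have J: "jet2 (\<lambda>s. b)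
     ((\<Sum>c\<in>UNIV. \<Sum>d\<in>UNIV. (if c = d then 1 else 0) *\<^sub>R A c d) + D a U x)
     ((\<Sum>c\<in>UNIV. \<Sum>d\<in>UNIV. (if c = d then 1 else 0) *\<^sub>R T c d + S c d *\<^sub>R A c d) + D v (D a U) x)
     ((\<Sum>c\<in>UNIV. \<Sum>d\<in>UNIV. (if c = d then 1 else 0) *\<^sub>R Q c d + 2 *\<^sub>R S c d *\<^sub>R T c d +
        (2 * (\<Sum>e\<in>UNIV. S c e * S e d) + r c d + 2 * (y v c \<bullet> y v d) + r d c) *\<^sub>R A c d)
      + D v (D v (D a U)) x)"
    by (simp only: M_def equation_in_frame(2))
  have diag: "(\<Sum>c\<in>UNIV. \<Sum>d\<in>UNIV. (if c = d then 1 else 0) *\<^sub>R f c d) = (\<Sum>c\<in>UNIV. f c c)"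
    for f :: "'m \<Rightarrow> 'm \<Rightarrow> real^'n"
    by (simp add: if_distrib[of "\<lambda>t. t *\<^sub>R _"] cong: if_cong)
  show "(\<Sum>c\<in>UNIV. T c c) + (\<Sum>c\<in>UNIV. \<Sum>d\<in>UNIV. S c d *\<^sub>R A c d) + D v (D a U) x = 0"
    using jet2_unique(1)[OF J jet2_const] by (simp only: sum.distrib diag)
  show "(\<Sum>c\<in>UNIV. Q c c) + 2 *\<^sub>R (\<Sum>c\<in>UNIV. \<Sum>d\<in>UNIV. S c d *\<^sub>R T c d)
       + (\<Sum>c\<in>UNIV. \<Sum>d\<in>UNIV. (2 * (\<Sum>e\<in>UNIV. S c e * S e d)
            + r c d + 2 * (y v c \<bullet> y v d) + r d c) *\<^sub>R A c d) + D v (D v (D a U)) x = 0"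
    using jet2_unique(2)[OF J jet2_const] by (simp only: sum.distrib diag scaleR_sum_right)
qed

lemma differentiated_equation_symmetric:
  "(\<Sum>c\<in>UNIV. D (E c) (D (E c) (D v U)) x) + 2 *\<^sub>R (\<Sum>c\<in>UNIV. \<Sum>d\<in>UNIV. k v c d *\<^sub>R A c d) + D a (D v U) x = 0"
proof -
  have "(\<Sum>c\<in>UNIV. \<Sum>d\<in>UNIV. k v d c *\<^sub>R A c d) = (\<Sum>c\<in>UNIV. \<Sum>d\<in>UNIV. k v c d *\<^sub>R A c d)"
    by (subst sum.swap) (simp add: D2_commute)
  moreover have "D v (D (E c) (D (E c) U)) = D (E c) (D (E c) (D v U))" for c
    by (simp add: D3_commute[of v] D2_commute[of v])
  ultimately show ?thesis
    using differentiated_equation(1)[of v]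
    by (simp add: scaleR_left_distrib sum.distrib scaleR_2 D2_commute[of v a])
qed

end

section \<open>Second variation along parallel transported directions\<close>

text \<open>
  The cancellation behind the second variation of \<open>q \<bullet> U\<^sub>v\<^sub>v\<close>. In the application \<open>t\<close> and \<open>QQ\<close> are
  components of third and fourth derivatives of \<open>U\<close>, \<open>r\<close> pairs third derivatives with first ones, and
  \<open>eq\<close> is the twice differentiated equation paired with \<open>q\<close>. The square of \<open>k + k\<^sup>T\<close> consists of \<open>k k\<close>
  and its transpose (both contribute \<open>chain\<close>), \<open>k\<^sup>T k\<close> (\<open>out\<close>) and \<open>k k\<^sup>T\<close> (\<open>inn\<close>). The first three cancel
  against the terms produced by the motion of \<open>v\<close> and \<open>q\<close>, and \<open>inn\<close> survives.
\<close>

lemma numerator_algebra: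
  fixes k t r z w :: "'m::finite \<Rightarrow> 'm \<Rightarrow> real" and QQ :: "'m \<Rightarrow> real" and dr :: real
  assumes t: "\<And>c d. t c d = t d c" and w: "\<And>c d. w c d = w d c"
    and eq: "(\<Sum>c\<in>UNIV. QQ c) + 2 * (\<Sum>c\<in>UNIV. \<Sum>d\<in>UNIV. (k c d + k d c) * t c d)
       + (\<Sum>c\<in>UNIV. \<Sum>d\<in>UNIV. (2 * (\<Sum>e\<in>UNIV. (k c e + k e c) * (k e d + k d e))
            + r c d + 2 * z c d + r d c) * w c d) + dr = 0"
  shows "(\<Sum>c\<in>UNIV. QQ c) + 4 * (\<Sum>c\<in>UNIV. \<Sum>d\<in>UNIV. k c d * t c d)
       + 2 * (\<Sum>c\<in>UNIV. \<Sum>d\<in>UNIV. \<Sum>e\<in>UNIV. k c d * k c e * w d e)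
       + 2 * (\<Sum>c\<in>UNIV. \<Sum>d\<in>UNIV. w c d * r c d)
       + 4 * (\<Sum>c\<in>UNIV. \<Sum>d\<in>UNIV. \<Sum>e\<in>UNIV. w c d * (k c e * k e d)) + dr
     = - 2 * (\<Sum>c\<in>UNIV. \<Sum>d\<in>UNIV. w c d * z c d)
       - 2 * (\<Sum>e\<in>UNIV. \<Sum>c\<in>UNIV. \<Sum>d\<in>UNIV. w c d * (k c e * k d e))"
proof -
  define KT where "KT = (\<Sum>c\<in>UNIV. \<Sum>d\<in>UNIV. k c d * t c d)"
  define RW where "RW = (\<Sum>c\<in>UNIV. \<Sum>d\<in>UNIV. w c d * r c d)"
  define ZW where "ZW = (\<Sum>c\<in>UNIV. \<Sum>d\<in>UNIV. w c d * z c d)"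
  define chain where "chain = (\<Sum>c\<in>UNIV. \<Sum>d\<in>UNIV. \<Sum>e\<in>UNIV. w c d * (k c e * k e d))"
  define inn where "inn = (\<Sum>c\<in>UNIV. \<Sum>d\<in>UNIV. \<Sum>e\<in>UNIV. w c d * (k c e * k d e))"
  define out where "out = (\<Sum>c\<in>UNIV. \<Sum>d\<in>UNIV. \<Sum>e\<in>UNIV. w c d * (k e c * k e d))"
  have "(\<Sum>c\<in>UNIV. \<Sum>d\<in>UNIV. k d c * t c d) = KT"
    unfolding KT_def by (subst sum.swap, intro sum.cong refl, subst t) (rule refl)
  then have 1: "(\<Sum>c\<in>UNIV. \<Sum>d\<in>UNIV. (k c d + k d c) * t c d) = 2 * KT"
    by (simp add: distrib_right sum.distrib KT_def)
  have RW': "(\<Sum>c\<in>UNIV. \<Sum>d\<in>UNIV. w c d * r d c) = RW"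
    unfolding RW_def by (subst sum.swap, intro sum.cong refl, subst w) (rule refl)
  have chain': "(\<Sum>c\<in>UNIV. \<Sum>d\<in>UNIV. \<Sum>e\<in>UNIV. w c d * (k e c * k d e)) = chain"
    unfolding chain_def by (subst sum.swap, intro sum.cong refl, subst w) (simp only: mult.commute)
  have "(\<Sum>c\<in>UNIV. \<Sum>d\<in>UNIV. (2 * (\<Sum>e\<in>UNIV. (k c e + k e c) * (k e d + k d e))
            + r c d + 2 * z c d + r d c) * w c d)
      = (\<Sum>c\<in>UNIV. \<Sum>d\<in>UNIV. 2 * ((\<Sum>e\<in>UNIV. w c d * (k c e * k e d)) + (\<Sum>e\<in>UNIV. w c d * (k c e * k d e))
          + (\<Sum>e\<in>UNIV. w c d * (k e c * k e d)) + (\<Sum>e\<in>UNIV. w c d * (k e c * k d e)))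
          + w c d * r c d + 2 * (w c d * z c d) + w c d * r d c)"
  proof (intro sum.cong refl)
    fix c d
    have expand: "(\<Sum>e\<in>UNIV. (k c e + k e c) * (k e d + k d e)) * w c d
        = (\<Sum>e\<in>UNIV. w c d * (k c e * k e d)) + (\<Sum>e\<in>UNIV. w c d * (k c e * k d e))
          + (\<Sum>e\<in>UNIV. w c d * (k e c * k e d)) + (\<Sum>e\<in>UNIV. w c d * (k e c * k d e))"
      unfolding sum.distrib[symmetric] sum_distrib_right
      by (rule sum.cong[OF refl]) (simp add: distrib_left distrib_right mult_ac)
    have "(2 * S + r1 + 2 * z1 + r2) * w1 = 2 * (S * w1) + w1 * r1 + 2 * (w1 * z1) + w1 * r2"
      for S r1 z1 r2 w1 :: real
      by (simp add: algebra_simps)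
    then show "(2 * (\<Sum>e\<in>UNIV. (k c e + k e c) * (k e d + k d e)) + r c d + 2 * z c d + r d c) * w c d
      = 2 * ((\<Sum>e\<in>UNIV. w c d * (k c e * k e d)) + (\<Sum>e\<in>UNIV. w c d * (k c e * k d e))
          + (\<Sum>e\<in>UNIV. w c d * (k e c * k e d)) + (\<Sum>e\<in>UNIV. w c d * (k e c * k d e)))
          + w c d * r c d + 2 * (w c d * z c d) + w c d * r d c"
      unfolding expand[symmetric] .
  qed
  also have "\<dots> = 2 * (chain + inn + out + chain) + RW + 2 * ZW + RW"
  proof -
    have two: "(\<Sum>c\<in>UNIV. \<Sum>d\<in>UNIV. 2 * f c d) = 2 * (\<Sum>c\<in>UNIV. \<Sum>d\<in>UNIV. f c d)"
      for f :: "'m \<Rightarrow> 'm \<Rightarrow> real"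
      by (simp add: sum_distrib_left)
    show ?thesis
      by (simp only: sum.distrib two RW' chain' flip: chain_def inn_def out_def RW_def ZW_def)
  qed
  finally have 2: "(\<Sum>c\<in>UNIV. \<Sum>d\<in>UNIV. (2 * (\<Sum>e\<in>UNIV. (k c e + k e c) * (k e d + k d e))
            + r c d + 2 * z c d + r d c) * w c d) = 2 * (chain + inn + out + chain) + RW + 2 * ZW + RW" .
  have 3: "(\<Sum>c\<in>UNIV. \<Sum>d\<in>UNIV. \<Sum>e\<in>UNIV. k c d * k c e * w d e) = out"
    unfolding out_def
    by (subst sum.swap, rule sum.cong[OF refl], subst sum.swap) (simp add: mult_ac)
  have 4: "(\<Sum>e\<in>UNIV. \<Sum>c\<in>UNIV. \<Sum>d\<in>UNIV. w c d * (k c e * k d e)) = inn"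
    unfolding inn_def by (subst sum.swap, rule sum.cong[OF refl], rule sum.swap)
  show ?thesis
    using eq unfolding 1 2 3 4 KT_def[symmetric] RW_def[symmetric] ZW_def[symmetric] chain_def[symmetric]
    by (simp add: algebra_simps)
qed

context translator_frame
begin

text \<open>
  \<open>V v c\<close> and \<open>Z q c\<close> are the velocities of \<open>v\<close> and \<open>q\<close> under parallel transport in direction \<open>E c\<close>, for
  the tangential and for the dual normal connection. This choice is what makes the first variations of
  \<open>first_form\<close> and \<open>normal_form\<close> vanish.
\<close>

abbreviation "W q c d \<equiv> q \<bullet> A c d"
abbreviation "V v c \<equiv> (\<Sum>d\<in>UNIV. k v c d *\<^sub>R E d)"
abbreviation "Z q c \<equiv> (\<Sum>d\<in>UNIV. W q c d *\<^sub>R p d)"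

lemma first_form_frame_sum:
  "first_form U x (\<Sum>d\<in>UNIV. f d *\<^sub>R E d) (\<Sum>d\<in>UNIV. h d *\<^sub>R E d) = (\<Sum>d\<in>UNIV. f d * h d)"
  by (subst first_form_sum_left, subst first_form_sum_right) (simp add: orthonormal if_distrib cong: if_cong)

lemma D_expansion: "D v U x = (\<Sum>d\<in>UNIV. first_form U x (E d) v *\<^sub>R p d)"
  by (subst expansion[of v]) (rule D1_sum)

lemma D2_expansion: "D w (D v U) x = (\<Sum>d\<in>UNIV. first_form U x (E d) v *\<^sub>R D w (D (E d) U) x)"
  by (subst expansion[of v]) (rule D2_sum_right)

lemma D_V: "D (V v c) U x = (\<Sum>d\<in>UNIV. k v c d *\<^sub>R p d)"
  by (rule D1_sum)

lemma first_form_V: "first_form U x v (V v c) = D v U x \<bullet> y v c"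
proof -
  have "first_form U x v (V v c) = (\<Sum>d\<in>UNIV. k v c d * first_form U x (E d) v)"
    by (simp add: first_form_sum_right first_form_commute)
  also have "\<dots> = (\<Sum>d\<in>UNIV. first_form U x (E d) v *\<^sub>R p d) \<bullet> y v c"
    by (simp add: inner_sum_left mult.commute)
  also have "\<dots> = D v U x \<bullet> y v c"
    by (simp flip: D_expansion)
  finally show ?thesis .
qed

text \<open>
  The first variation is \<open>2 g(v, V) - 2 U\<^sub>v \<bullet> y\<close>, which vanishes by the choice of \<open>V\<close>. The terms of the
  second variation that are quadratic in first order quantities are \<open>2 |V|\<^sup>2 - 2 |y + U\<^sub>V|\<^sup>2\<close>. With
  \<open>g(V, V) = y \<bullet> U\<^sub>V = \<Sum> k\<^sup>2\<close> they combine to \<open>-2 |B|\<^sup>2\<close>, since \<open>|y|\<^sup>2 + \<Sum> k\<^sup>2\<close> is the squared length of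
  the normal part of \<open>(0, y)\<close>.
\<close>

lemma jet2_first_form_curve:
  "jet2 (\<lambda>s. first_form U (x + s *\<^sub>R E c) (v + s *\<^sub>R V v c) (v + s *\<^sub>R V v c)) (first_form U x v v) 0
     (- 2 * (y v c \<bullet> y v c + (\<Sum>d\<in>UNIV. k v c d * k v c d))
      - 2 * (D v U x \<bullet> (D (E c) (D (E c) (D v U)) x + 2 *\<^sub>R (\<Sum>d\<in>UNIV. k v c d *\<^sub>R A c d))))"
proof -
  let ?V = "V v c"
  let ?T = "D (E c) (D (E c) (D v U)) x"
  let ?P = "\<lambda>s. D v U (x + s *\<^sub>R E c) + s *\<^sub>R D ?V U (x + s *\<^sub>R E c)"
  have P: "jet2 ?P (D v U x + 0) (y v c + D ?V U x) (?T + 2 *\<^sub>R D (E c) (D ?V U) x)"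
    by (intro jet2_add jet2_times_id[OF jet2_along_line] jet2_along_line smooth1)
  have v: "jet2 (\<lambda>s. v + s *\<^sub>R ?V) v ?V 0"
    by (rule jet2_line)
  have key: "?V \<bullet> ?V - (y v c + D ?V U x) \<bullet> (y v c + D ?V U x)
      = - (y v c \<bullet> y v c + (\<Sum>d\<in>UNIV. k v c d * k v c d))"
  proof -
    have "y v c \<bullet> D ?V U x = (\<Sum>d\<in>UNIV. k v c d * k v c d)"
      by (simp add: D_V inner_sum_right inner_commute)
    moreover have "?V \<bullet> ?V - D ?V U x \<bullet> D ?V U x = (\<Sum>d\<in>UNIV. k v c d * k v c d)"
      using first_form_frame_sum[of "k v c" "k v c"] by (simp add: first_form_def)
    ultimately show ?thesis
      by (simp add: inner_add_left inner_add_right inner_commute)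
  qed
  have mixed: "D (E c) (D ?V U) x = (\<Sum>d\<in>UNIV. k v c d *\<^sub>R A c d)"
    by (rule D2_sum_right)
  show ?thesis
  proof (rule jet2_cong[OF jet2_add[OF jet2_inner[OF v v] jet2_mult[OF jet2_const jet2_inner[OF P P]]]])
    show "first_form U (x + s *\<^sub>R E c) (v + s *\<^sub>R ?V) (v + s *\<^sub>R ?V)
        = (v + s *\<^sub>R ?V) \<bullet> (v + s *\<^sub>R ?V) + (- 1) * (?P s \<bullet> ?P s)" for s
      by (simp add: first_form_def D_along_varying_direction smooth_map_differentiable smooth)
    show "0 = v \<bullet> ?V + ?V \<bullet> v + (- 1 * ((D v U x + 0) \<bullet> (y v c + D ?V U x) + (y v c + D ?V U x) \<bullet> (D v U x + 0))
        + 0 * ((D v U x + 0) \<bullet> (D v U x + 0)))"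
      using first_form_V[of v c] by (simp add: first_form_def inner_add_right inner_add_left inner_commute)
    show "- 2 * (y v c \<bullet> y v c + (\<Sum>d\<in>UNIV. k v c d * k v c d))
        - 2 * (D v U x \<bullet> (?T + 2 *\<^sub>R (\<Sum>d\<in>UNIV. k v c d *\<^sub>R A c d)))
      = v \<bullet> 0 + 2 *\<^sub>R (?V \<bullet> ?V) + 0 \<bullet> v
        + (- 1 * ((D v U x + 0) \<bullet> (?T + 2 *\<^sub>R D (E c) (D ?V U) x)
             + 2 *\<^sub>R ((y v c + D ?V U x) \<bullet> (y v c + D ?V U x))
             + (?T + 2 *\<^sub>R D (E c) (D ?V U) x) \<bullet> (D v U x + 0))
           + 2 *\<^sub>R (0 * ((D v U x + 0) \<bullet> (y v c + D ?V U x) + (y v c + D ?V U x) \<bullet> (D v U x + 0)))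
           + 0 * ((D v U x + 0) \<bullet> (D v U x + 0)))"
    proof -
      have "- 2 * h - 2 * t = 0 + 2 * z + 0 + (- 1 * (t + 2 * l + t) + 2 * (0 * f) + 0 * g)"
        if "z - l = - h" for h t z l f g :: real
        using that by simp
      from this[OF key] show ?thesis
        unfolding mixed real_scaleR_def inner_zero_left inner_zero_right add_0_right
          inner_commute[of "?T + _" "D v U x"] by (simp only: add_0_right)
    qed
  qed (simp add: first_form_def)
qed

text \<open>
  The third derivatives are exactly those in the once differentiated equation, which trades them for a
  drift term. The subtracted last term is the derivative of \<open>first_form\<close> along \<open>a\<close> and cancels it.
\<close>

lemma sum_second_variation_first_form:
  "(\<Sum>c\<in>UNIV. - 2 * (y v c \<bullet> y v c + (\<Sum>d\<in>UNIV. k v c d * k v c d))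
      - 2 * (D v U x \<bullet> (D (E c) (D (E c) (D v U)) x + 2 *\<^sub>R (\<Sum>d\<in>UNIV. k v c d *\<^sub>R A c d))))
     - 2 * (D v U x \<bullet> D a (D v U) x)
   = - 2 * (\<Sum>c\<in>UNIV. y v c \<bullet> y v c + (\<Sum>d\<in>UNIV. k v c d * k v c d))"
proof -
  have "(\<Sum>c\<in>UNIV. D (E c) (D (E c) (D v U)) x + 2 *\<^sub>R (\<Sum>d\<in>UNIV. k v c d *\<^sub>R A c d)) = - D a (D v U) x"
    using differentiated_equation_symmetric[of v]
    by (simp add: sum.distrib scaleR_sum_right eq_neg_iff_add_eq_0)
  then have "(\<Sum>c\<in>UNIV. D v U x \<bullet> (D (E c) (D (E c) (D v U)) x + 2 *\<^sub>R (\<Sum>d\<in>UNIV. k v c d *\<^sub>R A c d)))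
      = - (D v U x \<bullet> D a (D v U) x)"
    by (simp flip: inner_sum_right)
  then show ?thesis
    by (simp add: sum_subtractf sum_negf sum.distrib flip: sum_distrib_left)
qed

lemma jet2_first_form_drift:
  "\<exists>l. jet2 (\<lambda>s. first_form U (x + s *\<^sub>R w) v v) (first_form U x v v) (- 2 * (D v U x \<bullet> D w (D v U) x)) l"
proof -
  have P: "jet2 (\<lambda>s. D v U (x + s *\<^sub>R w)) (D v U x) (D w (D v U) x) (D w (D w (D v U)) x)"
    by (intro jet2_along_line smooth1)
  show ?thesis
    using jet2_add[OF jet2_const[of "v \<bullet> v"] jet2_mult[OF jet2_const jet2_inner[OF P P]], of "- 1"]
    by (auto simp: first_form_def inner_commute intro!: exI)
qed

text \<open>
  \<open>Xi q c\<close> is the derivative of the covector \<open>grad (q \<bullet> U)\<close> along \<open>E c\<close> when \<open>q\<close> is transported. It is the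
  vector with frame coordinates \<open>W q c d\<close>, and \<open>DU\<close> maps it to \<open>Z q c\<close>; both facts together give the
  jet of \<open>normal_form\<close>.
\<close>

abbreviation "Xi q c i \<equiv> q \<bullet> y (axis i 1) c + Z q c \<bullet> D (axis i 1) U x"

lemma covector_transport: "Xi q c i = (\<Sum>d\<in>UNIV. W q c d *\<^sub>R E d) $ i"
proof -
  have "q \<bullet> y (axis i 1) c = (\<Sum>d\<in>UNIV. first_form U x (E d) (axis i 1) * W q c d)"
    by (simp add: D2_expansion[of "E c" "axis i 1"] inner_sum_right)
  also have "\<dots> = (\<Sum>d\<in>UNIV. W q c d * E d $ i) - Z q c \<bullet> D (axis i 1) U x"
    by (simp add: first_form_def inner_axis inner_sum_left sum_subtractf algebra_simps)
  finally show ?thesis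
    by simp
qed

lemma D_Xi: "(\<Sum>i\<in>UNIV. Xi q c i *\<^sub>R D (axis i 1) U x) = Z q c"
proof -
  have "(\<Sum>i\<in>UNIV. Xi q c i *\<^sub>R D (axis i 1) U x) = D (\<Sum>d\<in>UNIV. W q c d *\<^sub>R E d) U x"
    unfolding covector_transport
    by (rule linear_axis_expansion[OF linear_D, symmetric]) (intro smooth_map_differentiable smooth)
  then show ?thesis
    by (simp add: D1_sum)
qed

lemma jet2_normal_form_curve:
  "jet2 (\<lambda>s. normal_form U (x + s *\<^sub>R E c) (q + s *\<^sub>R Z q c)) (normal_form U x q) 0
     (- 2 * (\<Sum>d\<in>UNIV. W q c d * W q c d)
      - 2 * (\<Sum>i\<in>UNIV. (q \<bullet> D (axis i 1) U x) *
         (q \<bullet> D (E c) (D (E c) (D (axis i 1) U)) x + 2 * (Z q c \<bullet> y (axis i 1) c))))"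
proof -
  let ?Z = "Z q c"
  let ?U = "\<lambda>i. D (axis i 1) U"
  let ?T = "\<lambda>i. D (E c) (D (E c) (?U i)) x"
  have Q: "jet2 (\<lambda>s. q + s *\<^sub>R ?Z) q ?Z 0"
    by (rule jet2_line)
  have P: "jet2 (\<lambda>s. (q + s *\<^sub>R ?Z) \<bullet> ?U i (x + s *\<^sub>R E c)) (q \<bullet> ?U i x) (Xi q c i)
      (q \<bullet> ?T i + 2 * (?Z \<bullet> y (axis i 1) c))" for i
    using jet2_inner[OF Q jet2_along_line[OF smooth1, of "axis i 1" x "E c"]] by simp
  let ?f = "\<lambda>i s. (q + s *\<^sub>R ?Z) \<bullet> ?U i (x + s *\<^sub>R E c)"
  let ?N = "\<lambda>i. q \<bullet> ?T i + 2 * (?Z \<bullet> y (axis i 1) c)"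
  have S: "jet2 (\<lambda>s. \<Sum>i\<in>UNIV. ?f i s * ?f i s) (\<Sum>i\<in>UNIV. (q \<bullet> ?U i x) * (q \<bullet> ?U i x))
     (\<Sum>i\<in>UNIV. (q \<bullet> ?U i x) * Xi q c i + Xi q c i * (q \<bullet> ?U i x))
     (\<Sum>i\<in>UNIV. (q \<bullet> ?U i x) * ?N i + 2 *\<^sub>R (Xi q c i * Xi q c i) + ?N i * (q \<bullet> ?U i x))"
    by (intro jet2_sum jet2_mult P)
  have first: "(\<Sum>i\<in>UNIV. (q \<bullet> ?U i x) * Xi q c i) = q \<bullet> ?Z"
    by (subst D_Xi[symmetric]) (simp only: inner_sum_right inner_scaleR_right mult.commute)
  have second: "?Z \<bullet> ?Z - (\<Sum>i\<in>UNIV. Xi q c i * Xi q c i) = - (\<Sum>d\<in>UNIV. W q c d * W q c d)"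
  proof -
    let ?X = "\<Sum>d\<in>UNIV. W q c d *\<^sub>R E d"
    have "first_form U x ?X ?X = (\<Sum>d\<in>UNIV. W q c d * W q c d)"
      by (rule first_form_frame_sum)
    moreover have "?X \<bullet> ?X = (\<Sum>i\<in>UNIV. Xi q c i * Xi q c i)"
      unfolding covector_transport by (simp only: inner_vec_def inner_real_def)
    ultimately show ?thesis
      by (simp add: first_form_def D1_sum)
  qed
  show ?thesis
  proof (rule jet2_cong[OF jet2_add[OF jet2_inner[OF Q Q] jet2_mult[OF jet2_const[of "- 1"] S]]])
    show "normal_form U (x + s *\<^sub>R E c) (q + s *\<^sub>R ?Z)
        = (q + s *\<^sub>R ?Z) \<bullet> (q + s *\<^sub>R ?Z) + - 1 * (\<Sum>i\<in>UNIV. ?f i s * ?f i s)" for s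
      by (simp add: normal_form_def)
    show "normal_form U x q = q \<bullet> q + - 1 * (\<Sum>i\<in>UNIV. (q \<bullet> ?U i x) * (q \<bullet> ?U i x))"
      by (simp add: normal_form_def)
    have "(\<Sum>i\<in>UNIV. (q \<bullet> ?U i x) * Xi q c i + Xi q c i * (q \<bullet> ?U i x)) = q \<bullet> ?Z + q \<bullet> ?Z"
      by (simp only: sum.distrib mult.commute[of "Xi q c _"] first)
    then show "0 = q \<bullet> ?Z + ?Z \<bullet> q
        + (- 1 * (\<Sum>i\<in>UNIV. (q \<bullet> ?U i x) * Xi q c i + Xi q c i * (q \<bullet> ?U i x))
          + 0 * (\<Sum>i\<in>UNIV. (q \<bullet> ?U i x) * (q \<bullet> ?U i x)))"
      by (simp only: inner_commute[of ?Z q] mult_zero_left mult_minus1 add_0_right right_minus)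
    have "(\<Sum>i\<in>UNIV. (q \<bullet> ?U i x) * ?N i + 2 *\<^sub>R (Xi q c i * Xi q c i) + ?N i * (q \<bullet> ?U i x))
       = 2 * (\<Sum>i\<in>UNIV. (q \<bullet> ?U i x) * ?N i) + 2 * (\<Sum>i\<in>UNIV. Xi q c i * Xi q c i)"
    proof -
      have "(\<Sum>i\<in>UNIV. f i * h i + 2 *\<^sub>R (l i * l i) + h i * f i)
          = 2 * (\<Sum>i\<in>UNIV. f i * h i) + 2 * (\<Sum>i\<in>UNIV. l i * l i)" for f h l :: "'m \<Rightarrow> real"
        by (simp add: sum.distrib sum_distrib_left mult.commute)
      then show ?thesis .
    qed
    moreover have "- 2 * w - 2 * f = 0 + 2 * z + 0 + (- 1 * (2 * f + 2 * l) + 2 * (0 * g) + 0 * h)"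
      if "z - l = - w" for w f z l g h :: real
      using that by simp
    ultimately show "- 2 * (\<Sum>d\<in>UNIV. W q c d * W q c d) - 2 * (\<Sum>i\<in>UNIV. (q \<bullet> ?U i x) * ?N i)
      = q \<bullet> 0 + 2 *\<^sub>R (?Z \<bullet> ?Z) + 0 \<bullet> q
        + (- 1 * (\<Sum>i\<in>UNIV. (q \<bullet> ?U i x) * ?N i + 2 *\<^sub>R (Xi q c i * Xi q c i) + ?N i * (q \<bullet> ?U i x))
           + 2 *\<^sub>R (0 * (\<Sum>i\<in>UNIV. (q \<bullet> ?U i x) * Xi q c i + Xi q c i * (q \<bullet> ?U i x)))
           + 0 * (\<Sum>i\<in>UNIV. (q \<bullet> ?U i x) * (q \<bullet> ?U i x)))"
      unfolding real_scaleR_def inner_zero_left inner_zero_right using second by (simp only:)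
  qed
qed

lemma sum_second_variation_normal_form:
  "(\<Sum>c\<in>UNIV. - 2 * (\<Sum>d\<in>UNIV. W q c d * W q c d)
      - 2 * (\<Sum>i\<in>UNIV. (q \<bullet> D (axis i 1) U x) *
         (q \<bullet> D (E c) (D (E c) (D (axis i 1) U)) x + 2 * (Z q c \<bullet> y (axis i 1) c))))
     - 2 * (\<Sum>i\<in>UNIV. (q \<bullet> D (axis i 1) U x) * (q \<bullet> D a (D (axis i 1) U) x))
   = - 2 * (\<Sum>c\<in>UNIV. \<Sum>d\<in>UNIV. W q c d * W q c d)"
proof -
  let ?U = "\<lambda>i. D (axis i 1) U"
  have "(\<Sum>c\<in>UNIV. q \<bullet> D (E c) (D (E c) (?U i)) x + 2 * (Z q c \<bullet> y (axis i 1) c)) = - (q \<bullet> D a (?U i) x)" for i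
  proof -
    have "(\<Sum>c\<in>UNIV. q \<bullet> D (E c) (D (E c) (?U i)) x)
        + 2 * (\<Sum>c\<in>UNIV. \<Sum>d\<in>UNIV. k (axis i 1) c d * W q c d) + q \<bullet> D a (?U i) x = 0"
      using arg_cong[OF differentiated_equation_symmetric[of "axis i 1"], of "\<lambda>t. q \<bullet> t"]
      by (simp add: inner_add_right inner_sum_right)
    then show ?thesis
      by (simp add: sum.distrib inner_sum_left mult.commute flip: sum_distrib_left)
  qed
  then have "(\<Sum>c\<in>UNIV. \<Sum>i\<in>UNIV. (q \<bullet> ?U i x) *
         (q \<bullet> D (E c) (D (E c) (?U i)) x + 2 * (Z q c \<bullet> y (axis i 1) c)))
      = - (\<Sum>i\<in>UNIV. (q \<bullet> ?U i x) * (q \<bullet> D a (?U i) x))"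
    by (subst sum.swap) (simp add: sum_negf flip: sum_distrib_left)
  then show ?thesis
    by (simp add: sum_subtractf sum_negf flip: sum_distrib_left)
qed

lemma jet2_normal_form_drift:
  "\<exists>l. jet2 (\<lambda>s. normal_form U (x + s *\<^sub>R w) q) (normal_form U x q)
     (- 2 * (\<Sum>i\<in>UNIV. (q \<bullet> D (axis i 1) U x) * (q \<bullet> D w (D (axis i 1) U) x))) l"
proof -
  have P: "jet2 (\<lambda>s. q \<bullet> D (axis i 1) U (x + s *\<^sub>R w)) (q \<bullet> D (axis i 1) U x)
     (q \<bullet> D w (D (axis i 1) U) x) (q \<bullet> D w (D w (D (axis i 1) U)) x)" for i
    using jet2_inner[OF jet2_const jet2_along_line[OF smooth1, of "axis i 1" x w]] by simp
  have S: "jet2 (\<lambda>s. \<Sum>i\<in>UNIV. (q \<bullet> D (axis i 1) U (x + s *\<^sub>R w)) * (q \<bullet> D (axis i 1) U (x + s *\<^sub>R w)))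
     (\<Sum>i\<in>UNIV. (q \<bullet> D (axis i 1) U x) * (q \<bullet> D (axis i 1) U x))
     (\<Sum>i\<in>UNIV. (q \<bullet> D (axis i 1) U x) * (q \<bullet> D w (D (axis i 1) U) x)
        + (q \<bullet> D w (D (axis i 1) U) x) * (q \<bullet> D (axis i 1) U x))
     (\<Sum>i\<in>UNIV. (q \<bullet> D (axis i 1) U x) * (q \<bullet> D w (D w (D (axis i 1) U)) x)
        + 2 *\<^sub>R ((q \<bullet> D w (D (axis i 1) U) x) * (q \<bullet> D w (D (axis i 1) U) x))
        + (q \<bullet> D w (D w (D (axis i 1) U)) x) * (q \<bullet> D (axis i 1) U x))"
    by (intro jet2_sum jet2_mult P)
  show ?thesis
    by (rule exI, rule jet2_cong[OF jet2_add[OF jet2_const[of "q \<bullet> q"] jet2_mult[OF jet2_const[of "- 1"] S]]])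
      (simp_all add: normal_form_def mult.commute sum.distrib sum_distrib_left sum_negf)
qed

text \<open>
  The first derivative is left unspecified: at a maximum it is determined by the cutoff.
\<close>

lemma jet2_second_derivative_curve:
  "\<exists>l. jet2 (\<lambda>s. (q + s *\<^sub>R Z q c) \<bullet>
        D (v + s *\<^sub>R V v c) (D (v + s *\<^sub>R V v c) U) (x + s *\<^sub>R E c)) (q \<bullet> D v (D v U) x) l
     (q \<bullet> D v (D v (D (E c) (D (E c) U))) x
      + 4 * (\<Sum>d\<in>UNIV. k v c d * (q \<bullet> D v (D (E c) (D (E d) U)) x))
      + 2 * (\<Sum>d\<in>UNIV. \<Sum>e\<in>UNIV. k v c d * k v c e * W q d e)
      + 2 * (\<Sum>d\<in>UNIV. W q c d * (p d \<bullet> D v (D v (D (E c) U)) x))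
      + 4 * (\<Sum>d\<in>UNIV. \<Sum>e\<in>UNIV. W q c d * (k v c e * k v e d)))"
proof -
  let ?V = "V v c" and ?Z = "Z q c"
  let ?F = "\<lambda>v w. D v (D w U)"
  let ?Y = "\<lambda>s. ?F v v (x + s *\<^sub>R E c) + (s *\<^sub>R 2 *\<^sub>R ?F ?V v (x + s *\<^sub>R E c)
      + s *\<^sub>R s *\<^sub>R ?F ?V ?V (x + s *\<^sub>R E c))"
  have line: "jet2 (\<lambda>s. ?F w w' (x + s *\<^sub>R E c)) (?F w w' x) (D (E c) (?F w w') x)
      (D (E c) (D (E c) (?F w w')) x)" for w w'
    by (intro jet2_along_line smooth2)
  have Y: "jet2 ?Y (?F v v x) (D (E c) (?F v v) x + 2 *\<^sub>R ?F ?V v x)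
     (D (E c) (D (E c) (?F v v)) x + (4 *\<^sub>R D (E c) (?F ?V v) x + 2 *\<^sub>R ?F ?V ?V x))"
    using jet2_add[OF line[of v v] jet2_add[OF jet2_times_id[OF jet2_scaleR[OF jet2_const[of 2] line[of ?V v]]]
          jet2_times_id[OF jet2_times_id[OF line[of ?V ?V]]]]]
    by simp
  have Q: "jet2 (\<lambda>s. q + s *\<^sub>R ?Z) q ?Z 0"
    by (rule jet2_line)
  have curve: "D (v + s *\<^sub>R ?V) (D (v + s *\<^sub>R ?V) U) (x + s *\<^sub>R E c) = ?Y s" for s
  proof -
    have outer: "D (v + s *\<^sub>R ?V) (D w U) z = ?F v w z + s *\<^sub>R ?F ?V w z" for w z
      by (intro D_along_varying_direction smooth_map_differentiable smooth1)
    have inner: "?F w (v + s *\<^sub>R ?V) z = ?F w v z + s *\<^sub>R ?F w ?V z" for w z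
      unfolding D2_commute[of w] by (rule outer)
    have swap: "?F v ?V z = ?F ?V v z" for z
      by (rule fun_cong[OF D2_commute])
    have collect: "(B + s *\<^sub>R C) + s *\<^sub>R (C + s *\<^sub>R F) = B + (s *\<^sub>R 2 *\<^sub>R C + s *\<^sub>R s *\<^sub>R F)"
      for B C F :: "real^'n"
      by (simp add: scaleR_2 scaleR_right_distrib)
    show ?thesis
      by (subst outer, subst inner, subst inner, subst swap, rule collect)
  qed
  have 1: "D (E c) (D (E c) (?F v v)) x = D v (D v (D (E c) (D (E c) U))) x"
  proof -
    have "D (E c) (D (E c) (D v (D v U))) = D (E c) (D v (D (E c) (D v U)))"
      by (simp only: D3_commute[of "E c" v])
    also have "\<dots> = D v (D (E c) (D v (D (E c) U)))"
      by (simp only: D_commute[OF smooth2, of "E c" v] D2_commute[of "E c" v])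
    also have "\<dots> = D v (D v (D (E c) (D (E c) U)))"
      by (simp only: D3_commute[of "E c" v])
    finally show ?thesis
      by simp
  qed
  have 2: "D (E c) (?F ?V v) x = (\<Sum>d\<in>UNIV. k v c d *\<^sub>R D v (D (E c) (D (E d) U)) x)"
  proof -
    have "D (E c) (?F ?V v) x = D ?V (D (E c) (D v U)) x"
      by (simp only: D3_commute[of "E c" ?V])
    also have "\<dots> = (\<Sum>d\<in>UNIV. k v c d *\<^sub>R D (E d) (D (E c) (D v U)) x)"
      by (rule D3_sum)
    also have "\<dots> = (\<Sum>d\<in>UNIV. k v c d *\<^sub>R D v (D (E c) (D (E d) U)) x)"
    proof (intro sum.cong refl)
      fix d
      have "D (E d) (D (E c) (D v U)) = D v (D (E c) (D (E d) U))"
        by (simp only: D2_commute[of "E c" v] D3_commute[of _ v] D2_commute[of "E d" "E c"])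
      then show "k v c d *\<^sub>R D (E d) (D (E c) (D v U)) x = k v c d *\<^sub>R D v (D (E c) (D (E d) U)) x"
        by (rule arg_cong[OF fun_cong])
    qed
    finally show ?thesis .
  qed
  have 3: "?F ?V ?V x = (\<Sum>d\<in>UNIV. \<Sum>e\<in>UNIV. (k v c d * k v c e) *\<^sub>R A d e)"
    unfolding D2_sum by (simp add: D2_sum_right scaleR_sum_right)
  have 4: "?F ?V v x = (\<Sum>d\<in>UNIV. k v c d *\<^sub>R y v d)"
    by (rule D2_sum)
  have 5: "D (E c) (?F v v) x = D v (D v (D (E c) U)) x"
    by (simp only: D3_commute[of "E c" v] D2_commute[of "E c" v])
  have chain: "(\<Sum>d\<in>UNIV. \<Sum>e\<in>UNIV. W q c d * (k v c e * k v e d))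
      = (\<Sum>d\<in>UNIV. \<Sum>e\<in>UNIV. k v c d * (W q c e * k v d e))"
    by (subst sum.swap) (simp add: mult_ac)
  have jet: "q \<bullet> (D (E c) (D (E c) (?F v v)) x + (4 *\<^sub>R D (E c) (?F ?V v) x + 2 *\<^sub>R ?F ?V ?V x))
      + 2 *\<^sub>R (?Z \<bullet> (D (E c) (?F v v) x + 2 *\<^sub>R ?F ?V v x)) + 0 \<bullet> ?F v v x
    = q \<bullet> D v (D v (D (E c) (D (E c) U))) x
      + 4 * (\<Sum>d\<in>UNIV. k v c d * (q \<bullet> D v (D (E c) (D (E d) U)) x))
      + 2 * (\<Sum>d\<in>UNIV. \<Sum>e\<in>UNIV. k v c d * k v c e * W q d e)
      + 2 * (\<Sum>d\<in>UNIV. W q c d * (p d \<bullet> D v (D v (D (E c) U)) x))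
      + 4 * (\<Sum>d\<in>UNIV. \<Sum>e\<in>UNIV. W q c d * (k v c e * k v e d))"
    unfolding 1 2 3 4 5 chain
    by (simp add: inner_add_right inner_sum_right inner_sum_left sum_distrib_left mult.assoc)
  show ?thesis
    unfolding curve by (rule exI, rule jet2_cong[OF jet2_inner[OF Q Y] refl refl refl jet[symmetric]])
qed

lemma sum_second_variation_second_derivative:
  "(\<Sum>c\<in>UNIV. q \<bullet> D v (D v (D (E c) (D (E c) U))) x
      + 4 * (\<Sum>d\<in>UNIV. k v c d * (q \<bullet> D v (D (E c) (D (E d) U)) x))
      + 2 * (\<Sum>d\<in>UNIV. \<Sum>e\<in>UNIV. k v c d * k v c e * W q d e)
      + 2 * (\<Sum>d\<in>UNIV. W q c d * (p d \<bullet> D v (D v (D (E c) U)) x))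
      + 4 * (\<Sum>d\<in>UNIV. \<Sum>e\<in>UNIV. W q c d * (k v c e * k v e d)))
     + q \<bullet> D a (D v (D v U)) x
   = - 2 * (\<Sum>c\<in>UNIV. \<Sum>d\<in>UNIV. W q c d * (y v c \<bullet> y v d))
     - 2 * (\<Sum>e\<in>UNIV. \<Sum>c\<in>UNIV. \<Sum>d\<in>UNIV. W q c d * (k v c e * k v d e))"
proof -
  have drift: "D v (D v (D a U)) = D a (D v (D v U))"
    by (simp only: D3_commute[of a v] D2_commute[of a v])
  have W: "W q c d = W q d c" for c d
    by (simp add: D2_commute)
  have "(\<Sum>c\<in>UNIV. q \<bullet> D v (D v (D (E c) (D (E c) U))) x)
     + 4 * (\<Sum>c\<in>UNIV. \<Sum>d\<in>UNIV. k v c d * (q \<bullet> D v (D (E c) (D (E d) U)) x))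
     + 2 * (\<Sum>c\<in>UNIV. \<Sum>d\<in>UNIV. \<Sum>e\<in>UNIV. k v c d * k v c e * W q d e)
     + 2 * (\<Sum>c\<in>UNIV. \<Sum>d\<in>UNIV. W q c d * (p d \<bullet> D v (D v (D (E c) U)) x))
     + 4 * (\<Sum>c\<in>UNIV. \<Sum>d\<in>UNIV. \<Sum>e\<in>UNIV. W q c d * (k v c e * k v e d)) + q \<bullet> D a (D v (D v U)) x
   = - 2 * (\<Sum>c\<in>UNIV. \<Sum>d\<in>UNIV. W q c d * (y v c \<bullet> y v d))
     - 2 * (\<Sum>e\<in>UNIV. \<Sum>c\<in>UNIV. \<Sum>d\<in>UNIV. W q c d * (k v c e * k v d e))"
  proof (rule numerator_algebra[where k = "\<lambda>c d. k v c d" and w = "\<lambda>c d. W q c d"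
        and t = "\<lambda>c d. q \<bullet> D v (D (E c) (D (E d) U)) x" and z = "\<lambda>c d. y v c \<bullet> y v d"
        and r = "\<lambda>c d. p d \<bullet> D v (D v (D (E c) U)) x"])
    show "q \<bullet> D v (D (E c) (D (E d) U)) x = q \<bullet> D v (D (E d) (D (E c) U)) x" for c d
      by (simp add: D2_commute)
    show "W q c d = W q d c" for c d
      by (rule W)
    show "(\<Sum>c\<in>UNIV. q \<bullet> D v (D v (D (E c) (D (E c) U))) x)
      + 2 * (\<Sum>c\<in>UNIV. \<Sum>d\<in>UNIV. (k v c d + k v d c) * (q \<bullet> D v (D (E c) (D (E d) U)) x))
      + (\<Sum>c\<in>UNIV. \<Sum>d\<in>UNIV. (2 * (\<Sum>e\<in>UNIV. (k v c e + k v e c) * (k v e d + k v d e))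
          + p d \<bullet> D v (D v (D (E c) U)) x + 2 * (y v c \<bullet> y v d) + p c \<bullet> D v (D v (D (E d) U)) x) * W q c d)
      + q \<bullet> D a (D v (D v U)) x = 0"
      using arg_cong[OF differentiated_equation(2)[of v], of "\<lambda>t. q \<bullet> t"]
      by (simp only: inner_add_right inner_sum_right inner_scaleR_right inner_zero_right drift)
  qed
  then show ?thesis
    by (simp only: sum.distrib sum_distrib_left[of "2::real", symmetric] sum_distrib_left[of "4::real", symmetric])
qed

end

context translator_frame
begin

section \<open>The curvature estimate at a maximum\<close>

lemma quadratic_form_frame_sum:
  "q \<bullet> D (\<Sum>c\<in>UNIV. f c *\<^sub>R E c) (D (\<Sum>c\<in>UNIV. f c *\<^sub>R E c) U) x
     = (\<Sum>c\<in>UNIV. \<Sum>d\<in>UNIV. W q c d * (f c * f d))"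
  unfolding D2_sum D2_sum_right
  by (simp add: inner_sum_right sum_distrib_left mult_ac) (subst sum.swap, simp add: mult.left_commute)

text \<open>
  Cauchy-Schwarz for the matrices \<open>W\<close> and \<open>f f\<^sup>T\<close>, where \<open>f\<close> are the frame coordinates of the unit
  vector \<open>v\<close>, in the form that the squared distance of \<open>W\<close> to \<open>\<kappa> f f\<^sup>T\<close> is nonnegative.
\<close>

lemma sum_squares_ge_quadratic_form:
  assumes v: "first_form U x v v = 1"
  shows "(q \<bullet> D v (D v U) x)\<^sup>2 \<le> (\<Sum>c\<in>UNIV. \<Sum>d\<in>UNIV. W q c d * W q c d)"
proof -
  define f where "f c = first_form U x (E c) v" for c
  define \<kappa> where "\<kappa> = q \<bullet> D v (D v U) x"
  have v_eq: "v = (\<Sum>c\<in>UNIV. f c *\<^sub>R E c)"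
    unfolding f_def by (rule expansion)
  have f: "(\<Sum>c\<in>UNIV. f c * f c) = 1"
    using v first_form_frame_sum[of f f] by (simp flip: v_eq)
  have \<kappa>: "\<kappa> = (\<Sum>c\<in>UNIV. \<Sum>d\<in>UNIV. W q c d * (f c * f d))"
    unfolding \<kappa>_def by (subst (1 2) v_eq) (rule quadratic_form_frame_sum)
  have "0 \<le> (\<Sum>c\<in>UNIV. \<Sum>d\<in>UNIV. (W q c d - \<kappa> * (f c * f d))\<^sup>2)"
    by (intro sum_nonneg) auto
  also have "\<dots> = (\<Sum>c\<in>UNIV. \<Sum>d\<in>UNIV. W q c d * W q c d + (- 2 * \<kappa>) * (W q c d * (f c * f d))
      + \<kappa>\<^sup>2 * ((f c * f c) * (f d * f d)))"
    by (intro sum.cong refl) (simp add: power2_eq_square algebra_simps)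
  also have "\<dots> = (\<Sum>c\<in>UNIV. \<Sum>d\<in>UNIV. W q c d * W q c d) + (- 2 * \<kappa>) * \<kappa>
      + \<kappa>\<^sup>2 * ((\<Sum>c\<in>UNIV. f c * f c) * (\<Sum>d\<in>UNIV. f d * f d))"
    unfolding sum.distrib sum_distrib_left[symmetric] sum_distrib_right[symmetric] \<kappa>[symmetric] ..
  also have "\<dots> = (\<Sum>c\<in>UNIV. \<Sum>d\<in>UNIV. W q c d * W q c d) - \<kappa>\<^sup>2"
    by (simp add: f power2_eq_square)
  finally show ?thesis
    by (simp add: \<kappa>_def)
qed

text \<open>
  The left side pairs \<open>W\<close> with the Gram matrix of the normal vectors \<open>B(E\<^sub>c, v)\<close>, and the sum on the
  right is the trace of that matrix. Decomposing the Gram matrix into squares, one for each coordinate of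
  \<open>y\<close> and one for each column of \<open>k\<close>, reduces the claim to \<open>W \<le> \<kappa> g\<close>.
\<close>

lemma weighted_traces_le:
  assumes le: "\<And>\<zeta>. q \<bullet> D \<zeta> (D \<zeta> U) x \<le> \<kappa> * first_form U x \<zeta> \<zeta>"
  shows "(\<Sum>c\<in>UNIV. \<Sum>d\<in>UNIV. W q c d * (y v c \<bullet> y v d))
      + (\<Sum>e\<in>UNIV. \<Sum>c\<in>UNIV. \<Sum>d\<in>UNIV. W q c d * (k v c e * k v d e))
    \<le> \<kappa> * (\<Sum>c\<in>UNIV. y v c \<bullet> y v c + (\<Sum>d\<in>UNIV. k v c d * k v c d))"
proof -
  have quad: "(\<Sum>c\<in>UNIV. \<Sum>d\<in>UNIV. W q c d * (f c * f d)) \<le> \<kappa> * (\<Sum>c\<in>UNIV. f c * f c)" for f :: "'m \<Rightarrow> real"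
    using le[of "\<Sum>c\<in>UNIV. f c *\<^sub>R E c"] unfolding quadratic_form_frame_sum first_form_frame_sum .
  have "(\<Sum>c\<in>UNIV. \<Sum>d\<in>UNIV. W q c d * (y v c \<bullet> y v d))
      = (\<Sum>i\<in>UNIV. \<Sum>c\<in>UNIV. \<Sum>d\<in>UNIV. W q c d * (y v c $ i * y v d $ i))"
  proof -
    have "(\<Sum>c\<in>UNIV. \<Sum>d\<in>UNIV. W q c d * (y v c \<bullet> y v d))
        = (\<Sum>c\<in>UNIV. \<Sum>d\<in>UNIV. \<Sum>i\<in>UNIV. W q c d * (y v c $ i * y v d $ i))"
      unfolding inner_vec_def[of "y v _" "y v _"] by (simp only: sum_distrib_left inner_real_def)
    also have "\<dots> = (\<Sum>c\<in>UNIV. \<Sum>i\<in>UNIV. \<Sum>d\<in>UNIV. W q c d * (y v c $ i * y v d $ i))"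
      by (rule sum.cong[OF refl], rule sum.swap)
    finally show ?thesis
      by (subst (asm) sum.swap)
  qed
  also have "\<dots> \<le> (\<Sum>i\<in>UNIV. \<kappa> * (\<Sum>c\<in>UNIV. y v c $ i * y v c $ i))"
    by (intro sum_mono quad)
  also have "\<dots> = \<kappa> * (\<Sum>c\<in>UNIV. y v c \<bullet> y v c)"
    unfolding sum_distrib_left[symmetric] inner_vec_def[of "y v _" "y v _"] inner_real_def
    by (subst sum.swap) (rule refl)
  finally have 1: "(\<Sum>c\<in>UNIV. \<Sum>d\<in>UNIV. W q c d * (y v c \<bullet> y v d)) \<le> \<kappa> * (\<Sum>c\<in>UNIV. y v c \<bullet> y v c)" .
  have "(\<Sum>e\<in>UNIV. \<Sum>c\<in>UNIV. \<Sum>d\<in>UNIV. W q c d * (k v c e * k v d e))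
      \<le> (\<Sum>e\<in>UNIV. \<kappa> * (\<Sum>c\<in>UNIV. k v c e * k v c e))"
    by (intro sum_mono quad)
  also have "\<dots> = \<kappa> * (\<Sum>c\<in>UNIV. \<Sum>d\<in>UNIV. k v c d * k v c d)"
    unfolding sum_distrib_left[symmetric] by (subst sum.swap) (rule refl)
  finally have 2: "(\<Sum>e\<in>UNIV. \<Sum>c\<in>UNIV. \<Sum>d\<in>UNIV. W q c d * (k v c e * k v d e))
      \<le> \<kappa> * (\<Sum>c\<in>UNIV. \<Sum>d\<in>UNIV. k v c d * k v c d)" .
  show ?thesis
    using add_mono[OF 1 2] unfolding sum.distrib distrib_left .
qed

text \<open>
  The function \<open>\<eta> k\<close> is replaced by the difference in \<open>max\<close>, which has a maximum with value 0 at
  \<open>(x, v, q)\<close>; the arithmetic-geometric mean \<open>2 \<surd>N \<le> 1 + N\<close>, sharp for \<open>N = 1\<close>, removes the square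
  root. Its second derivatives along the transported curves are summed over the frame, and the vanishing
  derivative along \<open>a\<close> at fixed \<open>v\<close> and \<open>q\<close> is added. In the result the terms \<open>H\<close> from the first
  fundamental form dominate the term \<open>S\<close> from the numerator.
\<close>

lemma curvature_estimate_at_max:
  fixes \<eta> :: "real^'m \<Rightarrow> real"
  assumes \<eta>: "\<And>e. jet2 (\<lambda>s. \<eta> (x + s *\<^sub>R e)) h (h1 e) (h2 e)" and h: "h > 0"
    and v: "first_form U x v v = 1" and q: "normal_form U x q = 1"
    and \<kappa>: "\<kappa> = q \<bullet> D v (D v U) x" "\<kappa> > 0" and \<delta>: "\<delta> > 0"
    and max: "\<And>z v' q'. norm (z - x) < \<delta> \<Longrightarrow>
        \<eta> z * (q' \<bullet> D v' (D v' U) z) \<le> h * \<kappa> / 2 * (first_form U z v' v' * (1 + normal_form U z q'))"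
  shows "(h * \<kappa>)\<^sup>2 \<le> 2 * (\<Sum>c\<in>UNIV. (h1 (E c))\<^sup>2) - h * ((\<Sum>c\<in>UNIV. h2 (E c)) + h1 a)"
proof -
  define H where "H = (\<Sum>c\<in>UNIV. y v c \<bullet> y v c + (\<Sum>d\<in>UNIV. k v c d * k v c d))"
  define WW where "WW = (\<Sum>c\<in>UNIV. \<Sum>d\<in>UNIV. W q c d * W q c d)"
  define S where "S = (\<Sum>c\<in>UNIV. \<Sum>d\<in>UNIV. W q c d * (y v c \<bullet> y v d))
      + (\<Sum>e\<in>UNIV. \<Sum>c\<in>UNIV. \<Sum>d\<in>UNIV. W q c d * (k v c e * k v d e))"
  have "\<exists>F2. (\<forall>c. jet2 (\<lambda>s. first_form U (x + s *\<^sub>R E c) (v + s *\<^sub>R V v c) (v + s *\<^sub>R V v c)) (first_form U x v v) 0 (F2 c)) \<and>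
      (\<Sum>c\<in>UNIV. F2 c) - 2 * (D v U x \<bullet> D a (D v U) x) = - 2 * H"
    unfolding H_def
    by (rule exI, rule conjI, rule allI, rule jet2_first_form_curve, rule sum_second_variation_first_form)
  then obtain F2 where
    F2: "\<And>c. jet2 (\<lambda>s. first_form U (x + s *\<^sub>R E c) (v + s *\<^sub>R V v c) (v + s *\<^sub>R V v c)) 1 0 (F2 c)"
    and F2_sum: "(\<Sum>c\<in>UNIV. F2 c) - 2 * (D v U x \<bullet> D a (D v U) x) = - 2 * H"
    unfolding v by blast
  have "\<exists>G2. (\<forall>c. jet2 (\<lambda>s. normal_form U (x + s *\<^sub>R E c) (q + s *\<^sub>R Z q c)) (normal_form U x q) 0 (G2 c)) \<and>
      (\<Sum>c\<in>UNIV. G2 c) - 2 * (\<Sum>i\<in>UNIV. (q \<bullet> D (axis i 1) U x) * (q \<bullet> D a (D (axis i 1) U) x)) = - 2 * WW"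
    unfolding WW_def
    by (rule exI, rule conjI, rule allI, rule jet2_normal_form_curve, rule sum_second_variation_normal_form)
  then obtain G2 where
    G2: "\<And>c. jet2 (\<lambda>s. normal_form U (x + s *\<^sub>R E c) (q + s *\<^sub>R Z q c)) 1 0 (G2 c)"
    and G2_sum: "(\<Sum>c\<in>UNIV. G2 c)
        - 2 * (\<Sum>i\<in>UNIV. (q \<bullet> D (axis i 1) U x) * (q \<bullet> D a (D (axis i 1) U) x)) = - 2 * WW"
    unfolding q by blast
  have "\<exists>N2. (\<forall>c. \<exists>l. jet2 (\<lambda>s. (q + s *\<^sub>R Z q c) \<bullet>
        D (v + s *\<^sub>R V v c) (D (v + s *\<^sub>R V v c) U) (x + s *\<^sub>R E c)) \<kappa> l (N2 c)) \<and>
      (\<Sum>c\<in>UNIV. N2 c) + q \<bullet> D a (D v (D v U)) x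
        = - 2 * (\<Sum>c\<in>UNIV. \<Sum>d\<in>UNIV. W q c d * (y v c \<bullet> y v d))
         - 2 * (\<Sum>e\<in>UNIV. \<Sum>c\<in>UNIV. \<Sum>d\<in>UNIV. W q c d * (k v c e * k v d e))"
    unfolding \<kappa>(1)
    by (rule exI, rule conjI, rule allI, rule jet2_second_derivative_curve,
        rule sum_second_variation_second_derivative)
  then obtain N2 where N2: "\<forall>c. \<exists>l. jet2 (\<lambda>s. (q + s *\<^sub>R Z q c) \<bullet>
        D (v + s *\<^sub>R V v c) (D (v + s *\<^sub>R V v c) U) (x + s *\<^sub>R E c)) \<kappa> l (N2 c)"
      and N2_sum': "(\<Sum>c\<in>UNIV. N2 c) + q \<bullet> D a (D v (D v U)) x
        = - 2 * (\<Sum>c\<in>UNIV. \<Sum>d\<in>UNIV. W q c d * (y v c \<bullet> y v d))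
         - 2 * (\<Sum>e\<in>UNIV. \<Sum>c\<in>UNIV. \<Sum>d\<in>UNIV. W q c d * (k v c e * k v d e))"
    by (elim exE conjE) (rule that)
  have N2_sum: "(\<Sum>c\<in>UNIV. N2 c) + q \<bullet> D a (D v (D v U)) x = - 2 * S"
    unfolding S_def N2_sum' by (simp only: distrib_left mult_minus_left diff_conv_add_uminus)
  obtain N1 where N1: "\<And>c. jet2 (\<lambda>s. (q + s *\<^sub>R Z q c) \<bullet>
        D (v + s *\<^sub>R V v c) (D (v + s *\<^sub>R V v c) U) (x + s *\<^sub>R E c)) \<kappa> (N1 c) (N2 c)"
    using choice[OF N2] by (elim exE) (rule that, erule spec)
  \<comment> \<open>the derivatives in the drift direction \<open>a\<close>, at fixed \<open>v\<close> and \<open>q\<close>\<close>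
  define F1 where "F1 = - 2 * (D v U x \<bullet> D a (D v U) x)"
  define G1 where "G1 = - 2 * (\<Sum>i\<in>UNIV. (q \<bullet> D (axis i 1) U x) * (q \<bullet> D a (D (axis i 1) U) x))"
  define Na where "Na = q \<bullet> D a (D v (D v U)) x"
  have curve: "h * N1 c + h1 (E c) * \<kappa> = 0"
      "h * N2 c + 2 * (h1 (E c) * N1 c) + h2 (E c) * \<kappa> - h * \<kappa> / 2 * (G2 c + 2 * F2 c) \<le> 0" for c
  proof -
    let ?n = "\<lambda>s. (q + s *\<^sub>R Z q c) \<bullet> D (v + s *\<^sub>R V v c) (D (v + s *\<^sub>R V v c) U) (x + s *\<^sub>R E c)"
    let ?f = "\<lambda>s. first_form U (x + s *\<^sub>R E c) (v + s *\<^sub>R V v c) (v + s *\<^sub>R V v c)"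
    let ?g = "\<lambda>s. normal_form U (x + s *\<^sub>R E c) (q + s *\<^sub>R Z q c)"
    let ?\<Phi> = "\<lambda>s. \<eta> (x + s *\<^sub>R E c) * ?n s + - (h * \<kappa> / 2) * (?f s * (1 + ?g s))"
    obtain r where r: "r > 0" "\<And>s. \<bar>s\<bar> < r \<Longrightarrow> norm (x + s *\<^sub>R E c - x) < \<delta>"
      using line_stays_near[OF \<delta>] by blast
    note J = jet2_add[OF jet2_mult[OF \<eta>[of "E c"] N1[of c]]
        jet2_mult[OF jet2_const[of "- (h * \<kappa> / 2)"] jet2_mult[OF F2[of c] jet2_add[OF jet2_const[of 1] G2[of c]]]]]
    have "?\<Phi> 0 = 0"
      using J by (simp add: jet2_def)
    moreover have "?\<Phi> s \<le> 0" if "\<bar>s\<bar> < r" for s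
      using max[OF r(2)[OF that]] by (simp add: mult.assoc)
    ultimately have le: "?\<Phi> s \<le> ?\<Phi> 0" if "\<bar>s\<bar> < r" for s
      using that by (simp only:)
    show "h * N1 c + h1 (E c) * \<kappa> = 0"
      using jet2_local_max(1)[OF J r(1) le] by simp
    show "h * N2 c + 2 * (h1 (E c) * N1 c) + h2 (E c) * \<kappa> - h * \<kappa> / 2 * (G2 c + 2 * F2 c) \<le> 0"
      using jet2_local_max(2)[OF J r(1) le] by (simp add: mult.commute[of _ 2])
  qed
  have drift: "h * Na + h1 a * \<kappa> - h * \<kappa> / 2 * (G1 + 2 * F1) = 0"
  proof -
    let ?n = "\<lambda>s. q \<bullet> D v (D v U) (x + s *\<^sub>R a)"
    let ?f = "\<lambda>s. first_form U (x + s *\<^sub>R a) v v"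
    let ?g = "\<lambda>s. normal_form U (x + s *\<^sub>R a) q"
    let ?\<Phi> = "\<lambda>s. \<eta> (x + s *\<^sub>R a) * ?n s + - (h * \<kappa> / 2) * (?f s * (1 + ?g s))"
    obtain r where r: "r > 0" "\<And>s. \<bar>s\<bar> < r \<Longrightarrow> norm (x + s *\<^sub>R a - x) < \<delta>"
      using line_stays_near[OF \<delta>] by blast
    have n: "jet2 ?n \<kappa> Na (q \<bullet> D a (D a (D v (D v U))) x)"
      using jet2_inner[OF jet2_const[of q] jet2_along_line[OF smooth2[of v v], of x a]]
      by (simp add: \<kappa>(1) Na_def)
    obtain f2 where f: "jet2 ?f 1 F1 f2"
      using jet2_first_form_drift[of a v] unfolding v F1_def by blast
    obtain g2 where g: "jet2 ?g 1 G1 g2"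
      using jet2_normal_form_drift[of a q] unfolding q G1_def by blast
    note J = jet2_add[OF jet2_mult[OF \<eta>[of a] n]
        jet2_mult[OF jet2_const[of "- (h * \<kappa> / 2)"] jet2_mult[OF f jet2_add[OF jet2_const[of 1] g]]]]
    have "?\<Phi> 0 = 0"
      using J by (simp add: jet2_def)
    moreover have "?\<Phi> s \<le> 0" if "\<bar>s\<bar> < r" for s
      using max[OF r(2)[OF that]] by (simp add: mult.assoc)
    ultimately have le: "?\<Phi> s \<le> ?\<Phi> 0" if "\<bar>s\<bar> < r" for s
      using that by (simp only:)
    show ?thesis
      using jet2_local_max(1)[OF J r(1) le] by (simp add: algebra_simps)
  qed
  have S: "S \<le> \<kappa> * H"
    unfolding S_def H_def
  proof (rule weighted_traces_le)
    fix \<zeta>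
    have "h * (q \<bullet> D \<zeta> (D \<zeta> U) x) \<le> h * (\<kappa> * first_form U x \<zeta> \<zeta>)"
      using max[of x q \<zeta>] \<delta> q \<eta>[of 0] by (simp add: jet2_def)
    then show "q \<bullet> D \<zeta> (D \<zeta> U) x \<le> \<kappa> * first_form U x \<zeta> \<zeta>"
      using h by simp
  qed
  have WW: "\<kappa>\<^sup>2 \<le> WW"
    unfolding WW_def \<kappa>(1) by (rule sum_squares_ge_quadratic_form[OF v])
  define P where "P = (\<Sum>c\<in>UNIV. (h1 (E c))\<^sup>2)"
  define L where "L = (\<Sum>c\<in>UNIV. h2 (E c)) + h1 a"
  have N1_eq: "h1 (E c) * N1 c = - ((\<kappa> / h) * (h1 (E c))\<^sup>2)" for c
  proof -
    have "N1 c * h = - (h1 (E c) * \<kappa>)"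
      using curve(1)[of c] by (simp add: eq_neg_iff_add_eq_0 mult.commute)
    then have "N1 c = - (h1 (E c) * \<kappa>) / h"
      using h by (simp add: eq_divide_eq del: divide_minus_left)
    then show ?thesis
      by (simp add: power2_eq_square)
  qed
  have "(\<Sum>c\<in>UNIV. h * N2 c + 2 * (h1 (E c) * N1 c) + h2 (E c) * \<kappa> - h * \<kappa> / 2 * (G2 c + 2 * F2 c)) \<le> 0"
    by (intro sum_nonpos curve)
  also have "(\<Sum>c\<in>UNIV. h * N2 c + 2 * (h1 (E c) * N1 c) + h2 (E c) * \<kappa> - h * \<kappa> / 2 * (G2 c + 2 * F2 c))
     = h * (\<Sum>c\<in>UNIV. N2 c) - 2 * (\<kappa> / h) * P + (\<Sum>c\<in>UNIV. h2 (E c)) * \<kappa>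
       - h * \<kappa> / 2 * ((\<Sum>c\<in>UNIV. G2 c) + 2 * (\<Sum>c\<in>UNIV. F2 c))"
    unfolding N1_eq P_def
    by (simp only: sum.distrib sum_subtractf mult_minus_right sum_negf sum_distrib_left[symmetric]
        sum_distrib_right[symmetric])
  finally have "h * ((\<Sum>c\<in>UNIV. N2 c) + Na) - 2 * (\<kappa> / h) * P + L * \<kappa>
       - h * \<kappa> / 2 * (((\<Sum>c\<in>UNIV. G2 c) + G1) + 2 * ((\<Sum>c\<in>UNIV. F2 c) + F1)) \<le> 0"
    using drift by (simp add: L_def algebra_simps)
  then have "h * (- 2 * S) - 2 * (\<kappa> / h) * P + L * \<kappa> - h * \<kappa> / 2 * (- 2 * WW + 2 * (- 2 * H)) \<le> 0"
    using N2_sum F2_sum G2_sum by (simp add: Na_def F1_def G1_def)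
  moreover have "h * S \<le> h * (\<kappa> * H)" "h * \<kappa> * \<kappa>\<^sup>2 \<le> h * \<kappa> * WW"
    using S WW h \<kappa>(2) by (auto intro: mult_left_mono)
  ultimately have "h * \<kappa> * \<kappa>\<^sup>2 - 2 * (\<kappa> / h) * P + L * \<kappa> \<le> 0"
    by (simp add: algebra_simps)
  \<comment> \<open>The bound is homogeneous of degree two in \<open>\<eta>\<close>, hence the factor \<open>h / \<kappa>\<close>.\<close>
  then have "(h / \<kappa>) * (h * \<kappa> * \<kappa>\<^sup>2 - 2 * (\<kappa> / h) * P + L * \<kappa>) \<le> 0"
    using h \<kappa>(2) by (intro mult_nonneg_nonpos) auto
  also have "(h / \<kappa>) * (h * \<kappa> * \<kappa>\<^sup>2 - 2 * (\<kappa> / h) * P + L * \<kappa>) = (h * \<kappa>)\<^sup>2 - (2 * P - h * L)"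
    using h \<kappa>(2) by (simp add: field_simps power2_eq_square)
  finally show ?thesis
    by (simp add: P_def L_def)
qed

end

context translator_system
begin

section \<open>Letting the cutoff exhaust the space\<close>

lemma frame_exists:
  obtains E where "translator_frame U a b x E"
    and "(\<Sum>c\<in>UNIV. E c \<bullet> E c) \<le> real CARD('m) * fact CARD('m) / det (metric_matrix U x)"
proof -
  obtain E :: "'m \<Rightarrow> real^'m"
    where E: "\<And>c d. E c \<bullet> (metric_matrix U x *v E d) = (if c = d then 1 else 0)"
      "\<And>v. v = (\<Sum>c\<in>UNIV. (E c \<bullet> (metric_matrix U x *v v)) *\<^sub>R E c)"
      "det (metric_matrix U x) > 0"
    by (rule orthonormal_frame_exists[OF transpose_metric_matrix[of x] pos_metric_matrix[of _ x]],
        assumption, rule that)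
  have "translator_frame U a b x E"
  proof
    show "first_form U x (E c) (E d) = (if c = d then 1 else 0)" for c d
      unfolding first_form_matrix by (rule E)
    show "v = (\<Sum>c\<in>UNIV. first_form U x (E c) v *\<^sub>R E c)" for v
      unfolding first_form_matrix by (rule E)
  qed
  moreover have "\<bar>metric_matrix U x $ i $ j\<bar> \<le> 1" for i j
  proof -
    have U1: "norm (D (axis i 1) U x) \<le> 1" for i
      using spacelike[of "axis i 1" x] by (simp add: first_form_def inner_axis_axis norm_le_square)
    have "\<bar>D (axis i 1) U x \<bullet> D (axis j 1) U x\<bar> \<le> 1 * 1"
      by (rule order_trans[OF Cauchy_Schwarz_ineq2]) (intro mult_mono U1, auto)
    moreover have "0 \<le> D (axis i 1) U x \<bullet> D (axis i 1) U x"
      by simp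
    ultimately show ?thesis
      by (cases "i = j") (auto simp: metric_matrix_def first_form_def inner_axis_axis)
  qed
  ultimately show ?thesis
    using that orthonormal_frame_norm_bound[OF E(2,3)] by blast
qed

lemma norm_D_less:
  assumes "v \<noteq> 0"
  shows "norm (D v U x) < norm v"
  using spacelike[OF assms, of x] by (simp add: first_form_def norm_lt)

text \<open>
  A map and its adjoint have the same norm: if \<open>|DU w| < |w|\<close> for \<open>w = DU\<^sup>T q\<close>, then
  \<open>|w|\<^sup>2 = q \<bullet> DU w < |q| |w|\<close>.
\<close>

lemma normal_form_pos:
  assumes "q \<noteq> 0"
  shows "normal_form U x q > 0"
proof -
  define w where "w = (\<chi> i. q \<bullet> D (axis i 1) U x)"
  have nf: "normal_form U x q = q \<bullet> q - w \<bullet> w"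
    by (simp add: normal_form_def w_def inner_vec_def[of "vec_lambda _" "vec_lambda _"])
  show ?thesis
  proof (cases "w = 0")
    case True
    then show ?thesis
      using assms by (simp add: nf)
  next
    case False
    have "D w U x = (\<Sum>i\<in>UNIV. w $ i *\<^sub>R D (axis i 1) U x)"
      by (rule linear_axis_expansion[OF linear_D]) (intro smooth_map_differentiable smooth)
    then have "w \<bullet> w = q \<bullet> D w U x"
      by (simp add: inner_sum_right w_def inner_vec_def[of "vec_lambda _"])
    also have "\<dots> \<le> norm q * norm (D w U x)"
      by (rule norm_cauchy_schwarz)
    also have "\<dots> < norm q * norm w"
      using norm_D_less[OF False] assms by (intro mult_strict_left_mono) auto
    finally have "norm w * norm w < norm q * norm w"
      by (simp add: dot_square_norm power2_eq_square)
    then have "norm w < norm q"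
      using False by simp
    then show ?thesis
      by (simp add: nf norm_lt)
  qed
qed

lemma D1_scale: "D (c *\<^sub>R v) U x = c *\<^sub>R D v U x"
  by (intro linear_scale[OF linear_D] smooth_map_differentiable smooth)

lemma D2_scale: "D (c *\<^sub>R v) (D (c *\<^sub>R v) U) x = c\<^sup>2 *\<^sub>R D v (D v U) x"
proof -
  have outer: "D (c *\<^sub>R v) (D w U) x = c *\<^sub>R D v (D w U) x" for w
    by (intro linear_scale[OF linear_D] smooth_map_differentiable smooth1)
  have "D v (D (c *\<^sub>R v) U) x = c *\<^sub>R D v (D v U) x"
    by (subst D2_commute) (rule outer)
  then show ?thesis
    by (simp add: outer power2_eq_square)
qed

lemma first_form_scale: "first_form U x (c *\<^sub>R v) (c *\<^sub>R v) = c\<^sup>2 * first_form U x v v"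
  by (simp add: first_form_def D1_scale power2_eq_square algebra_simps)

lemma normal_form_scale: "normal_form U x (c *\<^sub>R q) = c\<^sup>2 * normal_form U x q"
  by (simp add: normal_form_def power2_eq_square sum_distrib_left algebra_simps)

definition normal_curvature :: "real^'m \<Rightarrow> real^'m \<Rightarrow> real^'n \<Rightarrow> real" where
  "normal_curvature x v q = (q \<bullet> D v (D v U) x) / (first_form U x v v * sqrt (normal_form U x q))"

lemma normal_curvature_scale:
  assumes "c > 0" "d > 0"
  shows "normal_curvature x (c *\<^sub>R v) (d *\<^sub>R q) = normal_curvature x v q"
  using assms by (simp add: normal_curvature_def D2_scale first_form_scale normal_form_scale real_sqrt_mult)

lemma continuous_on_normal_curvature:
  "continuous_on (UNIV \<times> (- {0}) \<times> (- {0})) (\<lambda>(x, v, q). normal_curvature x v q)"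
proof -
  let ?S = "UNIV \<times> (- {0}) \<times> (- {0}) :: ((real^'m) \<times> (real^'m) \<times> (real^'n)) set"
  have 1: "D v U x = (\<Sum>i\<in>UNIV. v $ i *\<^sub>R D (axis i 1) U x)" for v x
    by (rule linear_axis_expansion[OF linear_D]) (intro smooth_map_differentiable smooth)
  have 2: "D v (D v U) x = (\<Sum>i\<in>UNIV. v $ i *\<^sub>R (\<Sum>j\<in>UNIV. v $ j *\<^sub>R D (axis j 1) (D (axis i 1) U) x))" for v x
  proof -
    have lin: "D v (D w U) x = (\<Sum>i\<in>UNIV. v $ i *\<^sub>R D (axis i 1) (D w U) x)" for v w
      by (rule linear_axis_expansion[OF linear_D]) (intro smooth_map_differentiable smooth1)
    have "D v (D v U) x = (\<Sum>i\<in>UNIV. v $ i *\<^sub>R D v (D (axis i 1) U) x)"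
      by (subst lin, subst D2_commute) (rule refl)
    also have "\<dots> = (\<Sum>i\<in>UNIV. v $ i *\<^sub>R (\<Sum>j\<in>UNIV. v $ j *\<^sub>R D (axis j 1) (D (axis i 1) U) x))"
      by (simp only: lin[of v])
    finally show ?thesis .
  qed
  have comp: "continuous_on ?S (\<lambda>p. F (fst p))" if "smooth_map F" for F :: "real^'m \<Rightarrow> real^'n"
    by (rule continuous_on_compose2[OF smooth_map_continuous_on[OF that, of UNIV] continuous_on_fst[OF continuous_on_id]])
      simp
  have c1: "continuous_on ?S (\<lambda>p. D (fst (snd p)) U (fst p))"
    by (rule continuous_on_eq[OF _ 1[symmetric]]) (intro continuous_on_sum continuous_on_scaleR continuous_on_component continuous_on_fst
        continuous_on_snd continuous_on_id comp smooth1)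
  have c2: "continuous_on ?S (\<lambda>p. D (fst (snd p)) (D (fst (snd p)) U) (fst p))"
    by (rule continuous_on_eq[OF _ 2[symmetric]]) (intro continuous_on_sum continuous_on_scaleR continuous_on_component continuous_on_fst
        continuous_on_snd continuous_on_id comp smooth2)
  have c3: "continuous_on ?S (\<lambda>p. normal_form U (fst p) (snd (snd p)))"
    unfolding normal_form_def by (intro continuous_on_diff continuous_on_sum continuous_on_mult
        continuous_on_inner continuous_on_fst continuous_on_snd continuous_on_id comp smooth1)
  have "continuous_on ?S (\<lambda>p. normal_curvature (fst p) (fst (snd p)) (snd (snd p)))"
    unfolding normal_curvature_def first_form_def
  proof (intro continuous_on_divide continuous_on_diff continuous_on_mult continuous_on_inner
      continuous_on_real_sqrt continuous_on_fst continuous_on_snd continuous_on_id c1 c2 c3 ballI)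
    fix p :: "(real^'m) \<times> (real^'m) \<times> (real^'n)"
    assume "p \<in> ?S"
    then show "(fst (snd p) \<bullet> fst (snd p) - D (fst (snd p)) U (fst p) \<bullet> D (fst (snd p)) U (fst p)) *
        sqrt (normal_form U (fst p) (snd (snd p))) \<noteq> 0"
      using spacelike[of "fst (snd p)" "fst p"] normal_form_pos[of "snd (snd p)" "fst p"]
      by (auto simp: first_form_def)
  qed
  then show ?thesis
    by (simp add: case_prod_beta)
qed

lemma det_metric_matrix_pos: "det (metric_matrix U x) > 0"
proof -
  obtain E :: "'m \<Rightarrow> real^'m" where "det (metric_matrix U x) > 0"
    by (rule orthonormal_frame_exists[OF transpose_metric_matrix[of x] pos_metric_matrix[of _ x]],
        assumption, rule that)
  then show ?thesis .
qed

text \<open>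
  Outside a ball the hypothesis bounds \<open>1 / det g\<close> linearly, inside by compactness. The quadratic bound
  is what the logarithmic cutoff needs.
\<close>

lemma inverse_det_bound:
  assumes \<epsilon>: "\<epsilon> > 0" and R\<^sub>0: "R\<^sub>0 > 0" "\<And>x. norm x > R\<^sub>0 \<Longrightarrow> det (metric_matrix U x) > \<epsilon> / norm x"
  obtains C where "\<And>x. real CARD('m) * fact CARD('m) / det (metric_matrix U x) \<le> C * (1 + x \<bullet> x)"
proof -
  have "continuous_on (cball 0 R\<^sub>0) (\<lambda>x. det (metric_matrix U x))"
    unfolding continuous_on_def
  proof (intro ballI tendsto_det)
    fix x :: "real^'m" and i j :: 'm
    assume x: "x \<in> cball 0 R\<^sub>0"
    have "((\<lambda>x. D (axis i 1) U x) \<longlongrightarrow> D (axis i 1) U x) (at x within cball 0 R\<^sub>0)" for i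
      using bspec[OF smooth_map_continuous_on[OF smooth1, unfolded continuous_on_def] x] .
    then show "((\<lambda>x. metric_matrix U x $ i $ j) \<longlongrightarrow> metric_matrix U x $ i $ j) (at x within cball 0 R\<^sub>0)"
      by (auto simp: metric_matrix_def first_form_def intro!: tendsto_intros)
  qed
  moreover have "cball (0::real^'m) R\<^sub>0 \<noteq> {}"
    using R\<^sub>0(1) by simp
  ultimately obtain x\<^sub>1 where x\<^sub>1: "\<forall>x\<in>cball 0 R\<^sub>0. det (metric_matrix U x\<^sub>1) \<le> det (metric_matrix U x)"
    using continuous_attains_inf[OF compact_cball] by blast
  define c where "c = det (metric_matrix U x\<^sub>1)"
  have c: "c > 0"
    by (simp add: c_def det_metric_matrix_pos)
  have inv_det: "1 / det (metric_matrix U x) \<le> (1 / c + 1 / \<epsilon>) * (1 + x \<bullet> x)" for x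
  proof (cases "norm x \<le> R\<^sub>0")
    case True
    then have "1 / det (metric_matrix U x) \<le> 1 / c"
      using x\<^sub>1 c by (intro divide_left_mono) (auto simp: c_def det_metric_matrix_pos)
    also have "\<dots> \<le> (1 / c + 1 / \<epsilon>) * 1"
      using \<epsilon> by simp
    also have "\<dots> \<le> (1 / c + 1 / \<epsilon>) * (1 + x \<bullet> x)"
      using c \<epsilon> by (intro mult_left_mono) auto
    finally show ?thesis .
  next
    case False
    then have "norm x > 0"
      using R\<^sub>0(1) by linarith
    then have "1 / det (metric_matrix U x) \<le> 1 / (\<epsilon> / norm x)"
      using R\<^sub>0(2)[of x] False \<epsilon> by (intro divide_left_mono) (auto simp: det_metric_matrix_pos)
    also have "\<dots> = (1 / \<epsilon>) * norm x"
      by simp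
    also have "\<dots> \<le> (1 / \<epsilon>) * (1 + x \<bullet> x)"
    proof (intro mult_left_mono)
      have "0 \<le> (norm x - 1)\<^sup>2"
        by simp
      then have "2 * norm x \<le> 1 + x \<bullet> x"
        by (simp add: dot_square_norm power2_eq_square algebra_simps)
      then show "norm x \<le> 1 + x \<bullet> x"
        using norm_ge_zero[of x] by linarith
    qed (use \<epsilon> in simp)
    also have "\<dots> \<le> (1 / c + 1 / \<epsilon>) * (1 + x \<bullet> x)"
      using c by (intro mult_right_mono) auto
    finally show ?thesis .
  qed
  define C where "C = real CARD('m) * fact CARD('m) * (1 / c + 1 / \<epsilon>)"
  have "real CARD('m) * fact CARD('m) / det (metric_matrix U x) \<le> C * (1 + x \<bullet> x)" for x
    using mult_left_mono[OF inv_det[of x], of "real CARD('m) * fact CARD('m)"] by (simp add: C_def mult.assoc)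
  then show ?thesis
    by (rule that)
qed

text \<open>
  Homogeneity of degree zero confines \<open>v\<close> and \<open>q\<close> to unit spheres, so \<open>\<eta> k\<close> attains its maximum over
  the ball where \<open>\<eta> \<ge> 0\<close>. The maximum is positive and \<open>\<eta>\<close> vanishes on the boundary, so it is interior,
  where \<open>v\<close> and \<open>q\<close> may be rescaled to the normalisation of the pointwise estimate.
\<close>

lemma cutoff_estimate:
  assumes C: "\<And>x. real CARD('m) * fact CARD('m) / det (metric_matrix U x) \<le> C * (1 + x \<bullet> x)"
    and v\<^sub>0: "v\<^sub>0 \<noteq> 0" and q\<^sub>0: "q\<^sub>0 \<noteq> 0" and pos: "normal_curvature x\<^sub>0 v\<^sub>0 q\<^sub>0 > 0"
    and R: "R > ln (1 + x\<^sub>0 \<bullet> x\<^sub>0)"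
  shows "((R - ln (1 + x\<^sub>0 \<bullet> x\<^sub>0)) * normal_curvature x\<^sub>0 v\<^sub>0 q\<^sub>0)\<^sup>2 \<le> 8 * C + R * (2 * C + norm a)"
proof -
  define \<eta> where "\<eta> z = R - ln (1 + z \<bullet> z)" for z :: "real^'m"
  have ln_nonneg: "ln (1 + z \<bullet> z) \<ge> 0" for z :: "real^'m"
    by simp
  have R_pos: "R > 0"
    using R ln_nonneg[of x\<^sub>0] by linarith
  define \<rho> where "\<rho> = sqrt (exp R - 1)"
  have \<rho>: "\<rho> > 0" "\<rho>\<^sup>2 = exp R - 1"
    using R_pos by (auto simp: \<rho>_def)
  have pos1: "1 + z \<bullet> z > 0" for z :: "real^'m"
    by (simp add: add_pos_nonneg)
  have \<eta>_nonneg: "\<eta> z \<ge> 0 \<longleftrightarrow> norm z \<le> \<rho>" and \<eta>_pos: "\<eta> z > 0 \<longleftrightarrow> norm z < \<rho>" for z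
  proof -
    have "\<eta> z \<ge> 0 \<longleftrightarrow> 1 + z \<bullet> z \<le> exp R"
      using ln_le_cancel_iff[OF pos1[of z] exp_gt_zero[of R]] by (simp add: \<eta>_def)
    also have "\<dots> \<longleftrightarrow> (norm z)\<^sup>2 \<le> \<rho>\<^sup>2"
      unfolding \<rho>(2) power2_norm_eq_inner by auto
    also have "\<dots> \<longleftrightarrow> norm z \<le> \<rho>"
      using \<rho>(1) by (simp add: power2_le_iff_abs_le)
    finally show "\<eta> z \<ge> 0 \<longleftrightarrow> norm z \<le> \<rho>" .
    have "\<eta> z > 0 \<longleftrightarrow> 1 + z \<bullet> z < exp R"
      using ln_less_cancel_iff[OF pos1[of z] exp_gt_zero[of R]] by (simp add: \<eta>_def)
    also have "\<dots> \<longleftrightarrow> (norm z)\<^sup>2 < \<rho>\<^sup>2"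
      unfolding \<rho>(2) power2_norm_eq_inner by auto
    also have "\<dots> \<longleftrightarrow> norm z < \<rho>"
      using \<rho>(1) by (auto intro: power_strict_mono power2_less_imp_less)
    finally show "\<eta> z > 0 \<longleftrightarrow> norm z < \<rho>" .
  qed
  define K where "K = cball (0::real^'m) \<rho> \<times> sphere (0::real^'m) 1 \<times> sphere (0::real^'n) 1"
  define \<Psi> where "\<Psi> = (\<lambda>(z, v, q). \<eta> z * normal_curvature z v q)"
  have "continuous_on K \<Psi>"
  proof -
    have "continuous_on K (\<lambda>p. (case p of (x, v, q) \<Rightarrow> normal_curvature x v q))"
      by (rule continuous_on_subset[OF continuous_on_normal_curvature]) (auto simp: K_def)
    moreover have "continuous_on K (\<lambda>p. \<eta> (fst p))"
      unfolding \<eta>_def using pos1 by (intro continuous_intros) (auto simp: less_imp_neq[THEN not_sym])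
    ultimately have "continuous_on K (\<lambda>p. \<eta> (fst p) * (case p of (x, v, q) \<Rightarrow> normal_curvature x v q))"
      by (intro continuous_on_mult)
    then show ?thesis
      by (simp add: \<Psi>_def case_prod_beta)
  qed
  moreover have "compact K"
    unfolding K_def by (intro compact_Times compact_cball compact_sphere)
  moreover have unit: "(1 / norm v) *\<^sub>R v \<in> sphere 0 1" if "v \<noteq> 0" for v :: "'z::real_normed_vector"
    using that by simp
  have "(x\<^sub>0, (1 / norm v\<^sub>0) *\<^sub>R v\<^sub>0, (1 / norm q\<^sub>0) *\<^sub>R q\<^sub>0) \<in> K"
    using unit[OF v\<^sub>0] unit[OF q\<^sub>0] \<eta>_pos[of x\<^sub>0] R by (simp add: K_def \<eta>_def)
  then have "K \<noteq> {}"
    by blast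
  ultimately obtain p where "p \<in> K" "\<And>p'. p' \<in> K \<Longrightarrow> \<Psi> p' \<le> \<Psi> p"
    using continuous_attains_sup[of K \<Psi>] by blast
  then obtain x v q where xvq: "(x, v, q) \<in> K" and sup: "\<And>p'. p' \<in> K \<Longrightarrow> \<Psi> p' \<le> \<Psi> (x, v, q)"
    by (metis prod_cases3)
  define M where "M = \<eta> x * normal_curvature x v q"
  have le_M: "\<eta> z * normal_curvature z v' q' \<le> M" if "norm z \<le> \<rho>" "v' \<noteq> 0" "q' \<noteq> 0" for z v' q'
  proof -
    have "(z, (1 / norm v') *\<^sub>R v', (1 / norm q') *\<^sub>R q') \<in> K"
      using unit[OF that(2)] unit[OF that(3)] that(1) by (simp add: K_def)
    from sup[OF this] show ?thesis
      using that by (simp add: \<Psi>_def M_def normal_curvature_scale)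
  qed
  have \<eta>0: "\<eta> x\<^sub>0 > 0"
    using R by (simp add: \<eta>_def)
  have M0: "\<eta> x\<^sub>0 * normal_curvature x\<^sub>0 v\<^sub>0 q\<^sub>0 \<le> M"
    using le_M[OF _ v\<^sub>0 q\<^sub>0, of x\<^sub>0] \<eta>_pos[of x\<^sub>0] \<eta>0 by simp
  have M_pos: "M > 0"
    using M0 mult_pos_pos[OF \<eta>0 pos] by linarith
  have x_le: "norm x \<le> \<rho>" and v_nz: "v \<noteq> 0" and q_nz: "q \<noteq> 0"
    using xvq by (auto simp: K_def)
  have "\<eta> x \<noteq> 0"
    using M_pos by (auto simp: M_def)
  then have h: "\<eta> x > 0"
    using \<eta>_nonneg[of x] x_le by linarith
  have x_less: "norm x < \<rho>"
    using h \<eta>_pos by blast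
  define v1 where "v1 = (1 / sqrt (first_form U x v v)) *\<^sub>R v"
  define q1 where "q1 = (1 / sqrt (normal_form U x q)) *\<^sub>R q"
  have ff: "first_form U x v v > 0" and nf: "normal_form U x q > 0"
    using spacelike[OF v_nz] normal_form_pos[OF q_nz] by auto
  have v1: "first_form U x v1 v1 = 1"
    using ff by (simp add: v1_def first_form_scale power_divide)
  have q1: "normal_form U x q1 = 1"
    using nf by (simp add: q1_def normal_form_scale power_divide)
  define \<kappa> where "\<kappa> = q1 \<bullet> D v1 (D v1 U) x"
  have "normal_curvature x v1 q1 = normal_curvature x v q"
    using ff nf by (simp add: v1_def q1_def normal_curvature_scale)
  then have M: "\<eta> x * \<kappa> = M"
    by (simp add: M_def \<kappa>_def normal_curvature_def v1 q1)
  have \<kappa>: "\<kappa> > 0"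
    using M M_pos h by (metis zero_less_mult_pos)
  obtain E where E: "translator_frame U a b x E"
    and trace: "(\<Sum>c\<in>UNIV. E c \<bullet> E c) \<le> real CARD('m) * fact CARD('m) / det (metric_matrix U x)"
    by (rule frame_exists[of x], rule that)
  have tr: "(\<Sum>c\<in>UNIV. E c \<bullet> E c) \<le> C * (1 + x \<bullet> x)"
    by (rule order_trans[OF trace C])
  interpret translator_frame U a b x E
    by (rule E)
  define r where "r = 1 + x \<bullet> x"
  have r: "r > 0" "x \<bullet> x \<le> r"
    using pos1[of x] by (auto simp: r_def)
  let ?h1 = "\<lambda>e. - (2 * (x \<bullet> e) / r)"
  let ?h2 = "\<lambda>e. - (2 * (e \<bullet> e) / r - (2 * (x \<bullet> e) / r)\<^sup>2)"
  have "(\<eta> x * \<kappa>)\<^sup>2 \<le> 2 * (\<Sum>c\<in>UNIV. (?h1 (E c))\<^sup>2) - \<eta> x * ((\<Sum>c\<in>UNIV. ?h2 (E c)) + ?h1 a)"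
  proof (rule curvature_estimate_at_max[where \<eta> = \<eta> and v = v1 and q = q1 and \<delta> = "\<rho> - norm x"])
    show "jet2 (\<lambda>s. \<eta> (x + s *\<^sub>R e)) (\<eta> x) (?h1 e) (?h2 e)" for e
      unfolding \<eta>_def r_def by (rule jet2_log_cutoff)
    show "\<kappa> = q1 \<bullet> D v1 (D v1 U) x"
      by (rule \<kappa>_def)
    show "0 < \<rho> - norm x"
      using x_less by simp
    fix z v' q'
    assume "norm (z - x) < \<rho> - norm x"
    then have z: "norm z < \<rho>"
      using norm_triangle_sub[of z x] by linarith
    show "\<eta> z * (q' \<bullet> D v' (D v' U) z) \<le> \<eta> x * \<kappa> / 2 * (first_form U z v' v' * (1 + normal_form U z q'))"
    proof (cases "v' = 0 \<or> q' = 0")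
      case True
      have zero: "D 0 (D 0 U) z = 0" "first_form U z 0 0 = 0" "normal_form U z 0 = 0"
        using D2_scale[of 0 0 z] first_form_scale[of z 0 0] normal_form_scale[of z 0 0] by auto
      have "first_form U z v' v' \<ge> 0"
        using spacelike[of v' z] zero by (cases "v' = 0") auto
      with True show ?thesis
        using zero h \<kappa> by auto
    next
      case False
      have ff': "first_form U z v' v' > 0" and nf': "normal_form U z q' > 0"
        using False spacelike normal_form_pos by auto
      define t where "t = sqrt (normal_form U z q')"
      have t: "t > 0" "normal_form U z q' = t\<^sup>2"
        using nf' by (auto simp: t_def)
      have "\<eta> z * (q' \<bullet> D v' (D v' U) z) = \<eta> z * normal_curvature z v' q' * (first_form U z v' v' * t)"
        using ff' t by (simp add: normal_curvature_def flip: t_def)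
      also have "\<dots> \<le> M * (first_form U z v' v' * t)"
        using le_M[of z v' q'] z False ff' t by (intro mult_right_mono) auto
      also have "\<dots> \<le> M * (first_form U z v' v' * ((1 + t\<^sup>2) / 2))"
      proof -
        have "0 \<le> (t - 1)\<^sup>2" by simp
        then have "t \<le> (1 + t\<^sup>2) / 2"
          by (simp add: power2_eq_square algebra_simps)
        then show ?thesis
          using M_pos ff' by (intro mult_left_mono) auto
      qed
      finally show ?thesis
        by (simp add: M t(2))
    qed
  qed (use h v1 q1 \<kappa> in auto)
  also have "2 * (\<Sum>c\<in>UNIV. (?h1 (E c))\<^sup>2) \<le> 8 * C"
  proof -
    have "(?h1 (E c))\<^sup>2 \<le> 4 * (E c \<bullet> E c) / r" for c
    proof -
      have "(x \<bullet> E c)\<^sup>2 \<le> (x \<bullet> x) * (E c \<bullet> E c)"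
        by (rule Cauchy_Schwarz_ineq)
      also have "\<dots> \<le> r * (E c \<bullet> E c)"
        using r by (intro mult_right_mono) auto
      finally have "4 * (x \<bullet> E c)\<^sup>2 / r\<^sup>2 \<le> 4 * (r * (E c \<bullet> E c)) / r\<^sup>2"
        using r by (intro divide_right_mono) auto
      then show ?thesis
        using r by (simp add: power_divide power2_eq_square)
    qed
    then have "(\<Sum>c\<in>UNIV. (?h1 (E c))\<^sup>2) \<le> (\<Sum>c\<in>UNIV. 4 * (E c \<bullet> E c) / r)"
      by (intro sum_mono)
    also have "\<dots> = 4 * (\<Sum>c\<in>UNIV. E c \<bullet> E c) / r"
      by (simp add: sum_distrib_left sum_divide_distrib)
    also have "\<dots> \<le> 4 * (C * r) / r"
      using tr r by (intro divide_right_mono mult_left_mono) (auto simp: r_def)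
    finally show ?thesis
      using r by simp
  qed
  also have "8 * C - \<eta> x * ((\<Sum>c\<in>UNIV. ?h2 (E c)) + ?h1 a) \<le> 8 * C + R * (2 * C + norm a)"
  proof -
    have "- (\<Sum>c\<in>UNIV. ?h2 (E c)) \<le> (\<Sum>c\<in>UNIV. 2 * (E c \<bullet> E c) / r)"
      unfolding sum_negf[symmetric] by (intro sum_mono) simp
    also have "\<dots> = 2 * (\<Sum>c\<in>UNIV. E c \<bullet> E c) / r"
      by (simp add: sum_distrib_left sum_divide_distrib)
    also have "\<dots> \<le> 2 * (C * r) / r"
      using tr r by (intro divide_right_mono mult_left_mono) (auto simp: r_def)
    finally have 1: "- (\<Sum>c\<in>UNIV. ?h2 (E c)) \<le> 2 * C"
      using r by simp
    have "2 * norm x \<le> r"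
    proof -
      have "0 \<le> (norm x - 1)\<^sup>2" by simp
      then show ?thesis
        by (simp add: r_def dot_square_norm power2_eq_square algebra_simps)
    qed
    then have "2 * (norm x * norm a) \<le> r * norm a"
      using mult_right_mono[of "2 * norm x" r "norm a"] by (simp add: mult.assoc)
    moreover have "x \<bullet> a \<le> norm x * norm a"
      by (rule norm_cauchy_schwarz)
    ultimately have 2: "- ?h1 a \<le> norm a"
      using r by (simp add: field_simps)
    have "0 \<le> 2 * C + norm a"
    proof -
      have "0 \<le> (\<Sum>c\<in>UNIV. E c \<bullet> E c)"
        by (intro sum_nonneg) auto
      then have "0 \<le> C * r"
        using tr by (simp add: r_def)
      then have "0 \<le> C"
        using r by (simp add: zero_le_mult_iff)
      then show ?thesis
        by simp
    qed
    moreover have "\<eta> x \<le> R"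
      using ln_nonneg[of x] by (simp add: \<eta>_def)
    ultimately have "\<eta> x * (2 * C + norm a) \<le> R * (2 * C + norm a)"
      by (intro mult_right_mono)
    moreover have "\<eta> x * (- ((\<Sum>c\<in>UNIV. ?h2 (E c)) + ?h1 a)) \<le> \<eta> x * (2 * C + norm a)"
      using 1 2 h by (intro mult_left_mono) auto
    ultimately have "- (\<eta> x * ((\<Sum>c\<in>UNIV. ?h2 (E c)) + ?h1 a)) \<le> R * (2 * C + norm a)"
      unfolding mult_minus_right by (rule order_trans[rotated])
    then show ?thesis
      by linarith
  qed
  finally have "M\<^sup>2 \<le> 8 * C + R * (2 * C + norm a)"
    by (simp add: M)
  moreover have "(\<eta> x\<^sub>0 * normal_curvature x\<^sub>0 v\<^sub>0 q\<^sub>0)\<^sup>2 \<le> M\<^sup>2"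
    using M0 \<eta>0 pos by (intro power_mono) auto
  ultimately show ?thesis
    by (simp add: \<eta>_def)
qed

text \<open>
  A positive normal curvature \<open>N\<close> at \<open>x\<close> makes the left side of the cutoff estimate grow quadratically
  in \<open>R\<close>, against linear growth on the right.
\<close>

lemma second_derivative_zero:
  assumes C: "\<And>x. real CARD('m) * fact CARD('m) / det (metric_matrix U x) \<le> C * (1 + x \<bullet> x)"
  shows "D v (D v U) x = 0"
proof -
  have "q \<bullet> D v (D v U) x \<le> 0" for q
  proof (rule ccontr)
    assume contr: "\<not> q \<bullet> D v (D v U) x \<le> 0"
    have v: "v \<noteq> 0" and q: "q \<noteq> 0"
      using contr D2_scale[of 0 0 x] by auto
    define N where "N = normal_curvature x v q"
    have N: "N > 0"
      using contr spacelike[OF v, of x] normal_form_pos[OF q, of x] by (simp add: N_def normal_curvature_def)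
    define l where "l = ln (1 + x \<bullet> x)"
    have l: "l \<ge> 0"
      by (simp add: l_def)
    define B where "B = 8 * \<bar>C\<bar> + 2 * \<bar>C\<bar> + norm a"
    have B: "B \<ge> 0"
      by (simp add: B_def)
    \<comment> \<open>Twice \<open>l\<close> gives \<open>R - l \<ge> R / 2\<close>; the last summand violates \<open>R\<^sup>2 N\<^sup>2 / 4 \<le> R B\<close>.\<close>
    define R where "R = 1 + 2 * l + 4 * B / N\<^sup>2"
    have "R \<ge> 1 + 2 * l"
      using B by (simp add: R_def)
    then have R: "R \<ge> 1" "R > l" "R / 2 \<le> R - l"
      using l by auto
    have "(R / 2 * N)\<^sup>2 \<le> ((R - l) * N)\<^sup>2"
      using R N by (intro power_mono mult_right_mono) auto
    also have "\<dots> \<le> 8 * C + R * (2 * C + norm a)"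
      unfolding l_def N_def
      by (rule cutoff_estimate[OF C v q]) (use N R in \<open>auto simp: N_def l_def\<close>)
    also have "\<dots> \<le> R * (8 * \<bar>C\<bar>) + R * (2 * \<bar>C\<bar> + norm a)"
    proof (rule add_mono)
      have "8 * C \<le> 1 * (8 * \<bar>C\<bar>)" by simp
      also have "\<dots> \<le> R * (8 * \<bar>C\<bar>)"
        using R by (intro mult_right_mono) auto
      finally show "8 * C \<le> R * (8 * \<bar>C\<bar>)" .
      show "R * (2 * C + norm a) \<le> R * (2 * \<bar>C\<bar> + norm a)"
        using R by (intro mult_left_mono) auto
    qed
    also have "\<dots> = R * B"
      by (simp add: B_def algebra_simps)
    finally have "R * (R * N\<^sup>2) \<le> R * (4 * B)"
      by (simp add: power2_eq_square algebra_simps)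
    then have "R * N\<^sup>2 \<le> 4 * B"
      using R by simp
    moreover have "R * N\<^sup>2 = (1 + 2 * l) * N\<^sup>2 + 4 * B"
      using N by (simp add: R_def algebra_simps)
    moreover have "(1 + 2 * l) * N\<^sup>2 > 0"
      using N l by simp
    ultimately show False
      by linarith
  qed
  then show ?thesis
    by (metis inner_gt_zero_iff not_le)
qed

lemma affine_if_second_derivative_zero:
  assumes zero: "\<And>v x. D v (D v U) x = 0"
  shows "U x = U 0 + D x U 0"
proof -
  have mixed: "D v (D w U) x = 0" for v w x
  proof -
    have outer: "D (v + w) (D z U) x = D v (D z U) x + D w (D z U) x" for z
      by (intro linear_add[OF linear_D] smooth_map_differentiable smooth1)
    have inner: "D z (D (v + w) U) x = D z (D v U) x + D z (D w U) x" for z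
      by (subst (1 2 3) D2_commute[of z]) (intro linear_add[OF linear_D] smooth_map_differentiable smooth1)
    have "D (v + w) (D (v + w) U) x = D v (D v U) x + D v (D w U) x + (D w (D v U) x + D w (D w U) x)"
      by (simp only: outer inner add_ac)
    moreover have "D w (D v U) x = D v (D w U) x"
      by (rule fun_cong[OF D2_commute])
    ultimately have "2 *\<^sub>R D v (D w U) x = 0"
      by (simp add: zero scaleR_2)
    then show ?thesis
      by simp
  qed
  have const: "D w U x = D w U 0" for w x
    by (rule constant_if_D_zero) (auto intro: smooth_map_differentiable smooth1 mixed)
  let ?F = "\<lambda>x. U x - D x U 0"
  have lin: "linear (\<lambda>x. D x U 0)"
    by (intro linear_D smooth_map_differentiable smooth)
  have F: "(?F has_derivative (\<lambda>h. D h U x - D h U 0)) (at x)" for x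
  proof (rule has_derivative_diff)
    show "(U has_derivative (\<lambda>h. D h U x)) (at x)"
      unfolding D_def using smooth_map_differentiable[OF smooth] frechet_derivative_works by blast
    show "((\<lambda>x. D x U 0) has_derivative (\<lambda>h. D h U 0)) (at x)"
      using lin linear_conv_bounded_linear bounded_linear_imp_has_derivative by blast
  qed
  have "?F x = ?F 0"
  proof (rule constant_if_D_zero)
    show "?F differentiable (at x)" for x
      using F differentiableI by blast
    show "D v ?F x = 0" for v x
      unfolding D_def[of v ?F] frechet_derivative_at[OF F, symmetric] by (simp add: const[of v x])
  qed
  then show ?thesis
    using linear_0[OF lin] by (simp add: algebra_simps)
qed

end

section \<open>Graphs\<close>

lemma
  fixes u :: "'n::finite \<Rightarrow> real^'m::finite \<Rightarrow> real"
  assumes u: "\<And>\<alpha>. smooth (u \<alpha>)"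
  defines "U \<equiv> \<lambda>x. \<chi> \<alpha>. u \<alpha> x"
  shows smooth_map_components: "smooth_map U"
    and D_graph_map: "D v (graph_map u) x = (v, D v U x)"
    and metric_matrix_eq_induced_metric: "metric_matrix U x = induced_metric u x"
proof -
  show U: "smooth_map U"
    using u by (simp add: smooth_map_def U_def)
  have nth: "D v U x $ \<alpha> = D v (u \<alpha>) x" for v x \<alpha>
    using D_nth[OF smooth_map_differentiable[OF U]] by (simp add: U_def)
  have "(graph_map u has_derivative (\<lambda>v. (v, \<chi> \<alpha>. frechet_derivative (u \<alpha>) (at x) v))) (at x)"
    by (intro graph_map_has_derivative smooth_differentiable u)
  then have "D v (graph_map u) x = (v, \<chi> \<alpha>. frechet_derivative (u \<alpha>) (at x) v)"
    unfolding D_def by (simp add: frechet_derivative_at[symmetric])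
  also have "(\<chi> \<alpha>. frechet_derivative (u \<alpha>) (at x) v) = D v U x"
    using nth by (simp add: vec_eq_iff D_def)
  finally show "D v (graph_map u) x = (v, D v U x)" .
  have "partial i (u \<alpha>) x = D (axis i 1) U x $ \<alpha>" for i \<alpha>
    unfolding nth by (simp only: partial_def D_def)
  then show "metric_matrix U x = induced_metric u x"
    by (simp add: vec_eq_iff metric_matrix_def induced_metric_def first_form_def inner_axis_axis
        inner_vec_def[of "D _ _ _" "D _ _ _"])
qed

text \<open>
  A vector differs from its normal part by a tangent vector, so \<open>H = T\<^sup>\<bottom>\<close> says that \<open>T\<close> minus the trace
  of \<open>(0, D\<^sup>2U)\<close> is tangent, that is, of the form \<open>(v, D\<^sub>v U)\<close>. The first component identifies \<open>v\<close> as
  the horizontal part of \<open>T\<close>.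
\<close>

lemma translator_equation:
  fixes u :: "'n::finite \<Rightarrow> real^'m::finite \<Rightarrow> real"
  assumes u: "\<And>\<alpha>. smooth (u \<alpha>)" and sp: "spacelike_graph u"
    and T: "mean_curvature u x = normal_part u x T"
  defines "U \<equiv> \<lambda>x. \<chi> \<alpha>. u \<alpha> x"
  shows "(\<Sum>i\<in>UNIV. \<Sum>j\<in>UNIV. matrix_inv (induced_metric u x) $ i $ j *\<^sub>R
      D (axis i 1) (D (axis j 1) U) x) + D (fst T) U x = snd T"
proof -
  let ?G = "\<lambda>i j. matrix_inv (induced_metric u x) $ i $ j"
  let ?N = "normal_part u x" and ?TS = "graph_tangent_space u x"
  have U: "smooth_map U"
    unfolding U_def by (rule smooth_map_components[OF u])
  have DF: "D v (graph_map u) z = (v, D v U z)" for v z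
    unfolding U_def by (rule D_graph_map[OF u])
  have tangent: "?TS = range (\<lambda>v. (v, D v U x))"
  proof -
    have "frechet_derivative (graph_map u) (at x) = (\<lambda>v. (v, D v U x))"
    proof
      fix v
      have "frechet_derivative (graph_map u) (at x) v = D v (graph_map u) x"
        by (simp only: D_def)
      also have "\<dots> = (v, D v U x)"
        by (rule DF)
      finally show "frechet_derivative (graph_map u) (at x) v = (v, D v U x)" .
    qed
    then show ?thesis
      unfolding graph_tangent_space_def by (rule arg_cong)
  qed
  have lin: "linear (\<lambda>v. (v, D v U x))"
  proof -
    have "linear (\<lambda>v. D v U x)"
      by (intro linear_D smooth_map_differentiable U)
    from linear_add[OF this] linear_scale[OF this] show ?thesis
      by (intro linearI) simp_all
  qed
  have sub: "subspace ?TS"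
    unfolding tangent by (rule linear_subspace_image[OF lin subspace_UNIV])
  have N: "w - ?N w \<in> ?TS" for w
    unfolding normal_part_def
    by (rule conjunct2[OF theI'[OF normal_part_ex1[OF smooth_differentiable[OF u] sp]]])
  have flat: "flat_conn (partial i (graph_map u)) (partial j (graph_map u)) x
      = (0, D (axis i 1) (D (axis j 1) U) x)" for i j
  proof -
    have "partial j (graph_map u) = (\<lambda>z. (axis j 1, D (axis j 1) U z))"
      using DF[of "axis j 1"] unfolding D_def[of _ "graph_map u"] partial_def by (intro ext)
    moreover have "((\<lambda>z. (axis j (1::real), D (axis j 1) U z)) has_derivative
        (\<lambda>v. (0, frechet_derivative (D (axis j 1) U) (at x) v))) (at x)"
      by (intro has_derivative_Pair has_derivative_const
          frechet_derivative_works[THEN iffD1] smooth_map_differentiable smooth_map_D U)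
    moreover have "fst (partial i (graph_map u) x) = axis i 1"
      using DF[of "axis i 1" x] unfolding D_def[of _ "graph_map u"] partial_def by simp
    ultimately show ?thesis
      unfolding flat_conn_def D_def[of "axis i 1"] by (simp add: frechet_derivative_at[symmetric])
  qed
  let ?w = "\<lambda>i j. (0, D (axis i 1) (D (axis j 1) U) x)"
  have "(T - ?N T) - (\<Sum>i\<in>UNIV. \<Sum>j\<in>UNIV. ?G i j *\<^sub>R (?w i j - ?N (?w i j))) \<in> ?TS"
    by (intro subspace_diff[OF sub] subspace_sum[OF sub] subspace_scale[OF sub] N)
  moreover have "(\<Sum>i\<in>UNIV. \<Sum>j\<in>UNIV. ?G i j *\<^sub>R ?N (?w i j)) = ?N T"
    using T by (simp add: mean_curvature_def second_fundamental_form_def flat)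
  ultimately have "T - (\<Sum>i\<in>UNIV. \<Sum>j\<in>UNIV. ?G i j *\<^sub>R ?w i j) \<in> ?TS"
    by (simp add: scaleR_diff_right sum_subtractf)
  then obtain v where v: "T - (\<Sum>i\<in>UNIV. \<Sum>j\<in>UNIV. ?G i j *\<^sub>R ?w i j) = (v, D v U x)"
    unfolding tangent by blast
  have "v = fst T"
    using arg_cong[OF v, of fst] by (simp add: fst_sum)
  moreover have "snd (T - (\<Sum>i\<in>UNIV. \<Sum>j\<in>UNIV. ?G i j *\<^sub>R ?w i j))
      = snd T - (\<Sum>i\<in>UNIV. \<Sum>j\<in>UNIV. ?G i j *\<^sub>R D (axis i 1) (D (axis j 1) U) x)"
    by (simp add: snd_sum)
  ultimately have "snd T - (\<Sum>i\<in>UNIV. \<Sum>j\<in>UNIV. ?G i j *\<^sub>R D (axis i 1) (D (axis j 1) U) x) = D (fst T) U x"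
    using arg_cong[OF v, of snd] by simp
  from this[symmetric] show ?thesis
    by simp
qed

lemma affine_graph:
  fixes L :: "real^'m::finite \<Rightarrow> real^'n::finite"
  assumes L: "linear L"
  shows "affine (range (\<lambda>x. (x, c + L x)))" and "aff_dim (range (\<lambda>x. (x, c + L x))) = int CARD('m)"
proof -
  let ?S = "range (\<lambda>x. (x, L x))"
  have lin: "linear (\<lambda>x. (x, L x))"
    using L by (simp add: linear_iff)
  have sub: "subspace ?S"
    by (rule linear_subspace_image[OF lin subspace_UNIV])
  have eq: "range (\<lambda>x. (x, c + L x)) = (+) (0, c) ` ?S"
    by (auto simp: image_image)
  show "affine (range (\<lambda>x. (x, c + L x)))"
    unfolding eq using subspace_imp_affine[OF sub] affine_translation by blast
  have "dim ?S = dim (UNIV :: (real^'m) set)"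
    by (rule dim_image_eq[OF lin]) (auto simp: inj_on_def)
  then show "aff_dim (range (\<lambda>x. (x, c + L x))) = int CARD('m)"
    unfolding eq using aff_dim_subspace[OF sub] by (simp add: aff_dim_translation_eq)
qed

theorem corollary2:
  fixes u :: "'n::finite \<Rightarrow> real^'m::finite \<Rightarrow> real" and \<epsilon> :: real
  assumes "\<And>\<alpha>. smooth (u \<alpha>)"
    and "spacelike_translator u"
    and "\<epsilon> > 0"
    and "\<exists>R\<^sub>0>0. \<forall>x. norm x > R\<^sub>0 \<longrightarrow> det (induced_metric u x) > \<epsilon> / norm x"
  shows "affine (graph_of u) \<and> aff_dim (graph_of u) = int CARD('m)"
proof -
  define U where "U x = (\<chi> \<alpha>. u \<alpha> x)" for x
  have U_eq: "U = (\<lambda>x. \<chi> \<alpha>. u \<alpha> x)"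
    by (rule ext) (rule U_def)
  have smooth: "smooth_map U"
    unfolding U_eq by (rule smooth_map_components[OF assms(1)])
  have metric: "metric_matrix U x = induced_metric u x" for x
    unfolding U_eq by (rule metric_matrix_eq_induced_metric[OF assms(1)])
  have sp: "spacelike_graph u"
    using assms(2) by (simp add: spacelike_translator_def)
  obtain T where T: "\<And>x. mean_curvature u x = normal_part u x T"
    using assms(2) unfolding spacelike_translator_def by blast
  interpret translator_system U "fst T" "snd T"
  proof
    show "smooth_map U"
      by (rule smooth)
    show "first_form U x v v > 0" if "v \<noteq> 0" for x v
    proof -
      have "first_form U x v v = pseudo_inner (D v (graph_map u) x) (D v (graph_map u) x)"
        unfolding D_graph_map[OF assms(1)] by (simp add: pseudo_inner_def first_form_def flip: U_eq)
      also have "\<dots> = v \<bullet> (induced_metric u x *v v)"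
        unfolding D_def by (rule induced_metric_quadratic[symmetric]) (intro smooth_differentiable assms(1))
      also have "\<dots> > 0"
        using sp that by (simp add: spacelike_graph_def)
      finally show ?thesis .
    qed
    show "(\<Sum>i\<in>UNIV. \<Sum>j\<in>UNIV. matrix_inv (metric_matrix U x) $ i $ j *\<^sub>R
        D (axis i 1) (D (axis j 1) U) x) + D (fst T) U x = snd T" for x
      unfolding metric unfolding U_eq by (rule translator_equation[OF assms(1) sp T])
  qed
  obtain R\<^sub>0 where R\<^sub>0: "R\<^sub>0 > 0" "\<And>x. norm x > R\<^sub>0 \<Longrightarrow> det (metric_matrix U x) > \<epsilon> / norm x"
    using assms(4) unfolding metric by blast
  obtain C where C: "\<And>x. real CARD('m) * fact CARD('m) / det (metric_matrix U x) \<le> C * (1 + x \<bullet> x)"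
    using inverse_det_bound[OF assms(3) R\<^sub>0] by metis
  have "D v (D v U) x = 0" for v x
    by (rule second_derivative_zero[OF C])
  then have "U x = U 0 + D x U 0" for x
    by (rule affine_if_second_derivative_zero)
  then have "graph_map u x = (x, U 0 + D x U 0)" for x
    by (metis graph_map_def U_def)
  then have "graph_of u = range (\<lambda>x. (x, U 0 + D x U 0))"
    unfolding graph_of_def by simp
  then show ?thesis
    using affine_graph[OF linear_D[OF smooth_map_differentiable[OF smooth], of 0], of "U 0"] by simp
qed

end
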